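(* Let $\Omega$ be a convex domain of finite type in $\mathbb{C}^n$, let $k\ge1$ be an integer, and let $\mu$ be a positive Borel measure on $\Omega$. Then $$( * )\qquad \exists p>1,\ \exists C_p>0,\ \forall f\in A^p_{k-1}(\Omega),\quad \int_\Omega|f|^p\,d\mu\le C_p^p\,\|f\|^p_{A^p_{k-1}(\Omega)}$$ if and only if $$( ** )\qquad \exists C>0,\ \forall a\in\Omega,\quad \mu(\Omega\cap P_a(2))\le C\,m_{k-1}(\Omega\cap P_a(2)).$$ Hence if the inequality in $( * )$ holds for one $p>1$ (with some constant $C_p$), then for every $q>1$ it holds with $q$ in place of $p$ (with some constant $C_q$). Here $P_a(2)$ denotes the polydisc of the McNeal family associated with $\Omega$.
   Context: $\Omega=\{r<0\}$ is a bounded convex open set of $\mathbb{C}^n$, with real valued convex $r\in\mathcal{C}^\infty(\mathbb{C}^n)$, $\mathrm{grad}\, r\ne0$ on $\partial\Omega$, $-r(z)\simeq\delta(z):=d(z,\Omega^c)$ on $\bar\Omega$; finite type means that the orders of contact of $\partial\Omega$ with complex analytic varieties are bounded. $dm$ is Lebesgue measure, $dm_0=dm$, $dm_j=(j+1)v_{j+1}(-r)^j\,dm$ for $j\ge1$ ($v_j$ the volume of the unit ball of $\mathbb{C}^j$); $A^p_{k-1}(\Omega)$ is the space of holomorphic $f$ with $\|f\|^p_{A^p_{k-1}(\Omega)}=\int_\Omega|f|^p\,dm_{k-1}<\infty$. McNeal polydiscs: let $\mathcal{U}$ be a neighbourhood of $\partial\Omega$ in $\Omega$ on which the normal projection $\pi$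 onto $\partial\Omega$ is smooth and well defined. For $a\in\mathcal{U}$ and a unit vector $v$, let $\tau(a,v)=\sup\{s>0: a+\lambda v\in\Omega \text{ for all } \lambda\in\mathbb{C},\ |\lambda|<s\}$. Choose an orthonormal basis $(L_1,\dots,L_n)$ by taking $L_1$ the complex normal direction at $\pi(a)$ (so $\tau(a,L_1)=\delta(a)$) and, for $j\ge2$, $L_j$ a unit vector minimizing $\tau(a,\cdot)$ in the orthogonal complement of $L_1,\dots,L_{j-1}$; put $\tau_j=\tau(a,L_j)$ and $P_a(t)=\{a+\sum_j\lambda_jL_j: |\lambda_j|<t\tau_j\}$. For $a\in\Omega\setminus\mathcal{U}$, $P_a(t)$ is the polydisc centered at $a$ with sides parallel to the axes, of radius $t\delta(a)$ in the $z_1$ direction and $t\delta(a)^{1/2}$ in the other directions. *)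

theory Defs
  imports "HOL-Complex_Analysis.Complex_Analysis" "HOL-Library.Landau_Symbols"
    "HOL-Library.Extended_Nat"
begin

text \<open>
  \<open>\<complex>\<^sup>n\<close> is \<^typ>\<open>complex ^ 'n\<close> with \<open>n = CARD('n)\<close>. As a Euclidean space its real inner product is
  \<open>Re (\<Sum>\<^sub>i x\<^sub>i cnj y\<^sub>i)\<close>, so \<^term>\<open>norm\<close> and \<^term>\<open>lborel\<close> are the usual ones, and the real
  gradient is the vector with components \<open>\<partial>r/\<partial>x\<^sub>i + \<i> \<partial>r/\<partial>y\<^sub>i\<close>.
\<close>

definition herm :: "complex ^ 'n \<Rightarrow> complex ^ 'n \<Rightarrow> complex" where
  "herm x y = (\<Sum>i\<in>UNIV. x $ i * cnj (y $ i))"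

definition grad :: "('a::real_inner \<Rightarrow> real) \<Rightarrow> 'a \<Rightarrow> 'a" where
  "grad f x = (THE D. GDERIV f x :> D)"


text \<open>The following two notions are meant for open sets \<open>S\<close>.\<close>

primrec Ck_on :: "nat \<Rightarrow> 'a::real_normed_vector set \<Rightarrow> ('a \<Rightarrow> 'b::real_normed_vector) \<Rightarrow> bool" where
  "Ck_on 0 S f \<longleftrightarrow> continuous_on S f"
| "Ck_on (Suc k) S f \<longleftrightarrow>
     (\<forall>x\<in>S. f differentiable (at x)) \<and> (\<forall>v. Ck_on k S (\<lambda>x. frechet_derivative f (at x) v))"

definition smooth_on :: "'a::real_normed_vector set \<Rightarrow> ('a \<Rightarrow> 'b::real_normed_vector) \<Rightarrow> bool" where
  "smooth_on S f \<longleftrightarrow> (\<forall>k. Ck_on k S f)"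

definition holomorphic_Cn_on :: "(complex ^ 'n \<Rightarrow> complex) \<Rightarrow> (complex ^ 'n) set \<Rightarrow> bool" where
  "holomorphic_Cn_on f S \<longleftrightarrow>
     (\<forall>z\<in>S. \<exists>f'. (f has_derivative f') (at z) \<and> (\<forall>c h. f' (c *s h) = c * f' h))"


text \<open>
  For a smooth \<open>g\<close>, \<open>g \<zeta> = O(|\<zeta>|\<^sup>k)\<close> says that all Taylor coefficients of \<open>g\<close> at \<open>0\<close> of order
  \<open>< k\<close> vanish, so the supremum below is the order of vanishing of \<open>g\<close> at \<open>0\<close>.
\<close>

definition vanishing_order :: "(complex \<Rightarrow> 'b::real_normed_vector) \<Rightarrow> enat" where
  "vanishing_order g =
     (SUP k\<in>{k::nat. (\<lambda>\<zeta>. norm (g \<zeta>)) \<in> O[at 0](\<lambda>\<zeta>. norm \<zeta> ^ k)}. enat k)"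

text \<open>
  Finite type in the sense of D'Angelo: the orders of contact
  \<open>\<nu>(r \<circ> \<phi>) / \<nu>(\<phi> - p)\<close> of the boundary with nonconstant holomorphic discs \<open>\<phi>\<close> centred at
  boundary points \<open>p\<close>, possibly singular at \<open>p\<close> (that is, with parametrised one-dimensional complex
  analytic varieties), are bounded.
\<close>

definition finite_type :: "(complex ^ 'n) set \<Rightarrow> (complex ^ 'n \<Rightarrow> real) \<Rightarrow> bool" where
  "finite_type \<Omega> r \<longleftrightarrow>
     (\<exists>M::nat. \<forall>p\<in>frontier \<Omega>. \<forall>\<epsilon>>0. \<forall>\<phi> :: complex \<Rightarrow> complex ^ 'n.
        (\<forall>i. (\<lambda>\<zeta>. \<phi> \<zeta> $ i) holomorphic_on ball 0 \<epsilon>) \<longrightarrow> \<phi> 0 = p \<longrightarrow>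
        \<not> \<phi> constant_on ball 0 \<epsilon> \<longrightarrow>
        vanishing_order (r \<circ> \<phi>) \<le> enat M * vanishing_order (\<lambda>\<zeta>. \<phi> \<zeta> - p))"

definition bdist :: "(complex ^ 'n) set \<Rightarrow> complex ^ 'n \<Rightarrow> real" where
  "bdist \<Omega> z = infdist z (- \<Omega>)"

definition convex_finite_type_domain ::
  "(complex ^ 'n) set \<Rightarrow> (complex ^ 'n \<Rightarrow> real) \<Rightarrow> bool" where
  "convex_finite_type_domain \<Omega> r \<longleftrightarrow>
     \<Omega> = {z. r z < 0} \<and> \<Omega> \<noteq> {} \<and> open \<Omega> \<and> bounded \<Omega> \<and> convex \<Omega> \<and>
     smooth_on UNIV r \<and> convex_on UNIV r \<and>
     (\<forall>z\<in>frontier \<Omega>. grad r z \<noteq> 0) \<and>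
     (\<exists>c>0. \<exists>C>0. \<forall>z\<in>closure \<Omega>. c * bdist \<Omega> z \<le> - r z \<and> - r z \<le> C * bdist \<Omega> z) \<and>
     finite_type \<Omega> r"


text \<open>
  The measure \<open>m\<^sub>j\<close> on \<open>\<Omega>\<close>. The unit ball of \<open>\<complex>\<^bsup>j+1\<^esup>\<close> is the unit ball of real dimension
  \<open>2(j+1)\<close>. The case \<open>j = 0\<close> carries no normalising constant.
\<close>

definition bergman_measure ::
  "(complex ^ 'n) set \<Rightarrow> (complex ^ 'n \<Rightarrow> real) \<Rightarrow> nat \<Rightarrow> (complex ^ 'n) measure" where
  "bergman_measure \<Omega> r j = density (restrict_space lborel \<Omega>) (\<lambda>z. ennreal
     (if j = 0 then 1 else real (j + 1) * unit_ball_vol (real (2 * (j + 1))) * (- r z) ^ j))"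

definition bergman_space ::
  "(complex ^ 'n) set \<Rightarrow> (complex ^ 'n \<Rightarrow> real) \<Rightarrow> nat \<Rightarrow> real \<Rightarrow> (complex ^ 'n \<Rightarrow> complex) set" where
  "bergman_space \<Omega> r j p = {f. holomorphic_Cn_on f \<Omega> \<and>
     (\<integral>\<^sup>+ z. ennreal (cmod (f z) powr p) \<partial>bergman_measure \<Omega> r j) < \<infinity>}"

definition bergman_norm ::
  "(complex ^ 'n) set \<Rightarrow> (complex ^ 'n \<Rightarrow> real) \<Rightarrow> nat \<Rightarrow> real \<Rightarrow> (complex ^ 'n \<Rightarrow> complex) \<Rightarrow> real" where
  "bergman_norm \<Omega> r j p f =
     enn2real (\<integral>\<^sup>+ z. ennreal (cmod (f z) powr p) \<partial>bergman_measure \<Omega> r j) powr (1 / p)"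

definition carleson_inequality ::
  "(complex ^ 'n) measure \<Rightarrow> (complex ^ 'n) set \<Rightarrow> (complex ^ 'n \<Rightarrow> real) \<Rightarrow> nat \<Rightarrow> real \<Rightarrow> real \<Rightarrow> bool" where
  "carleson_inequality \<mu> \<Omega> r j p C \<longleftrightarrow> (\<forall>f\<in>bergman_space \<Omega> r j p.
     (\<integral>\<^sup>+ z. ennreal (cmod (f z) powr p) \<partial>\<mu>) \<le> ennreal (C powr p * bergman_norm \<Omega> r j p f powr p))"


definition is_nearest_bdry_point ::
  "(complex ^ 'n) set \<Rightarrow> complex ^ 'n \<Rightarrow> complex ^ 'n \<Rightarrow> bool" where
  "is_nearest_bdry_point \<Omega> a w \<longleftrightarrow> w \<in> frontier \<Omega> \<and> dist a w = infdist a (frontier \<Omega>)"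

definition normal_proj :: "(complex ^ 'n) set \<Rightarrow> complex ^ 'n \<Rightarrow> complex ^ 'n" where
  "normal_proj \<Omega> a = (THE w. is_nearest_bdry_point \<Omega> a w)"

definition projection_nbhd :: "(complex ^ 'n) set \<Rightarrow> (complex ^ 'n) set \<Rightarrow> bool" where
  "projection_nbhd \<Omega> U \<longleftrightarrow>
     (\<exists>V. open V \<and> frontier \<Omega> \<subseteq> V \<and> U = \<Omega> \<inter> V) \<and>
     (\<forall>a\<in>U. \<exists>!w. is_nearest_bdry_point \<Omega> a w) \<and> smooth_on U (normal_proj \<Omega>)"

definition disc_radius :: "(complex ^ 'n) set \<Rightarrow> complex ^ 'n \<Rightarrow> complex ^ 'n \<Rightarrow> real" where
  "disc_radius \<Omega> a v = Sup {s. s > 0 \<and> (\<forall>\<xi>::complex. cmod \<xi> < s \<longrightarrow> a + \<xi> *s v \<in> \<Omega>)}"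

text \<open>
  An admissible choice \<open>L 1, \<dots>, L n\<close> of orthonormal basis at \<open>a\<close>; values of \<open>L\<close> outside
  \<open>{1..n}\<close> are irrelevant. The first vector spans the complex line generated by the gradient
  of \<open>r\<close> at the projection of \<open>a\<close>.
\<close>

definition mcneal_basis ::
  "(complex ^ 'n) set \<Rightarrow> (complex ^ 'n \<Rightarrow> real) \<Rightarrow> complex ^ 'n \<Rightarrow> (nat \<Rightarrow> complex ^ 'n) \<Rightarrow> bool" where
  "mcneal_basis \<Omega> r a L \<longleftrightarrow>
     (\<forall>i\<in>{1..CARD('n)}. \<forall>j\<in>{1..CARD('n)}. herm (L i) (L j) = (if i = j then 1 else 0)) \<and>
     (\<exists>c. L 1 = c *s grad r (normal_proj \<Omega> a)) \<and>
     (\<forall>j\<in>{2..CARD('n)}. \<forall>v. norm v = 1 \<and> (\<forall>i\<in>{1..<j}. herm v (L i) = 0) \<longrightarrow>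
        disc_radius \<Omega> a (L j) \<le> disc_radius \<Omega> a v)"

text \<open>
  The polydisc \<open>P\<^sub>a(t)\<close> determined by the neighbourhood \<open>U\<close> and the bases \<open>L a\<close>. As the index type
  carries no order, \<open>i1\<close> names the index of the coordinate \<open>z\<^sub>1\<close>.
\<close>

definition mcneal_polydisc ::
  "(complex ^ 'n) set \<Rightarrow> (complex ^ 'n) set \<Rightarrow> (complex ^ 'n \<Rightarrow> nat \<Rightarrow> complex ^ 'n) \<Rightarrow> 'n \<Rightarrow>
   complex ^ 'n \<Rightarrow> real \<Rightarrow> (complex ^ 'n) set" where
  "mcneal_polydisc \<Omega> U L i1 a t =
     (if a \<in> U
      then {a + (\<Sum>j=1..CARD('n). \<xi> j *s L a j) | \<xi> :: nat \<Rightarrow> complex.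
              \<forall>j\<in>{1..CARD('n)}. cmod (\<xi> j) < t * disc_radius \<Omega> a (L a j)}
      else {z. \<forall>i. cmod (z $ i - a $ i) <
              t * (if i = i1 then bdist \<Omega> a else bdist \<Omega> a powr (1 / 2))})"

end

theory Submission imports Defs begin

text \<open>
  For \<open>a \<in> \<Omega>\<close> let \<open>D\<^sub>a\<close> be the largest circled set with \<open>a + D\<^sub>a \<subseteq> \<Omega>\<close>; it is convex. At the contact
  points of the McNeal discs one has supporting functionals \<open>q\<^sub>1, \<dots>, q\<^sub>n\<close> of \<open>\<Omega>\<close>, and the minimality
  of the radii makes them triangular with respect to \<open>L\<^sub>1, \<dots>, L\<^sub>n\<close>; hence \<open>P\<^sub>a(2)\<close> is comparable to
  \<open>a + D\<^sub>a\<close>.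

  The sets \<open>a + s D\<^sub>a\<close> satisfy an engulfing property by convexity, with \<open>d(\<cdot>, \<Omega>\<^sup>c)\<close> roughly constant on
  them for small \<open>s\<close>, and \<open>|f|\<^sup>q\<close> is submean on them because Lebesgue measure on \<open>D\<^sub>a\<close> is rotation
  invariant. Fubini's theorem then gives the embedding for every exponent. Conversely, the functions
  \<open>\<Prod>\<^sub>j (2 - \<langle>z - a, q\<^sub>j\<rangle>)\<^sup>-\<^sup>N\<close> are bounded below on \<open>P\<^sub>a(2)\<close> and decay fast outside multiples of
  \<open>D\<^sub>a\<close>, so testing the embedding on them gives the measure condition.
\<close>

section \<open>Rotation invariance of Lebesgue measure\<close>

text \<open>The polydiscs are awkward to compare directly: \<open>P_a(2)\<close> may leave the
  domain, and its basis is chosen separately at each \<open>a\<close>, with no continuity in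
  \<open>a\<close>. Membership in \<open>a + s D_a\<close>, by contrast, says that
  \<open>a + \<xi> (z - a)\<close> stays in \<Omega> for all \<open>|\<xi>| \<le> 1/s\<close>, so a
  change of centre reduces to a convex combination of two points of \<Omega>. Hence the polydiscs
  are only sandwiched: \<open>a + c D_a\<close> lies in \<open>P_a(2)\<close>, and
  \<open>\<Omega> \<inter> P_a(2)\<close> lies in \<open>a + K D_a\<close>, with
  \<open>c \<le> 1/2\<close> and \<open>K \<ge> 1\<close> uniform in \<open>a\<close>. The two
  implications use opposite ends of this sandwich. Testing with a single exponent bounds the measure
  of the large set \<open>\<Omega> \<inter> (a + K D_a)\<close>, whereas the embedding for any
  exponent asks for a bound on the small set \<open>a + c D_a\<close> only. The measure condition
  lies between the two and mentions no exponent, so it also passes the inequality from one exponent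
  to all others.\<close>

lemma norm_vector_smult: "norm (c *s x) = cmod c * norm x" for x :: "complex ^ 'n"
  by (simp add: norm_vec_def L2_set_right_distrib norm_mult)

lemma lborel_distr_reflect: "distr lborel borel (\<lambda>x. t - x) = (lborel :: 'a::euclidean_space measure)"
proof -
  have "lborel = density (distr lborel borel (\<lambda>x::'a. t + (-1) *\<^sub>R x)) (\<lambda>_. ennreal (\<bar>-1\<bar> ^ DIM('a)))"
    by (rule lborel_affine) simp
  then show ?thesis
    by (simp add: density_1)
qed

text \<open>Uniqueness of Haar measure: evaluate \<open>\<integral>\<integral> 1\<^sub>A(x) 1\<^sub>B(x + y)\<close> in both orders.\<close>

lemma translation_invariant_eq_lborel:
  fixes \<nu> :: "'a::euclidean_space measure"
  assumes sets: "sets \<nu> = sets borel"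
    and trans: "\<And>t. distr \<nu> borel ((+) t) = \<nu>"
    and balls: "\<And>s. emeasure \<nu> (ball 0 s) = emeasure lborel (ball (0::'a) s)"
  shows "\<nu> = lborel"
proof (rule measure_eqI)
  show "sets \<nu> = sets lborel" by (simp add: sets)
  fix A assume "A \<in> sets \<nu>"
  then have A[measurable]: "A \<in> sets borel" by (simp add: sets)
  define B :: "'a set" where "B = ball 0 1"
  have B[measurable]: "B \<in> sets borel" by (simp add: B_def)
  have meas: "\<And>f. f \<in> borel_measurable borel \<Longrightarrow> f \<in> borel_measurable \<nu>"
    using measurable_cong_sets[OF sets refl] by auto
  have sp: "space \<nu> = UNIV" using sets_eq_imp_space_eq[OF sets] by simp
  interpret \<nu>: sigma_finite_measure \<nu>
  proof
    have "emeasure lborel (ball (0::'a) s) \<noteq> \<infinity>" for s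
      using emeasure_bounded_finite[of "ball (0::'a) s"] by (simp add: less_top)
    moreover have "(\<Union>n::nat. ball (0::'a) (real n)) = UNIV"
      using reals_Archimedean2 by fastforce
    ultimately show "\<exists>A. countable A \<and> A \<subseteq> sets \<nu> \<and> \<Union> A = space \<nu> \<and> (\<forall>a\<in>A. emeasure \<nu> a \<noteq> \<infinity>)"
      by (intro exI[of _ "range (\<lambda>n::nat. ball (0::'a) (real n))"]) (auto simp: sets sp balls)
  qed
  interpret P: pair_sigma_finite \<nu> "lborel :: 'a measure" ..
  have bp: "sets (\<nu> \<Otimes>\<^sub>M (lborel :: 'a measure)) = sets (borel :: ('a \<times> 'a) measure)"
  proof -
    have "sets (\<nu> \<Otimes>\<^sub>M (lborel :: 'a measure)) = sets ((borel :: 'a measure) \<Otimes>\<^sub>M (borel :: 'a measure))"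
      by (intro sets_pair_measure_cong sets sets_lborel)
    then show ?thesis by (simp only: borel_prod)
  qed
  have mp: "\<And>f. f \<in> borel_measurable (borel :: ('a \<times> 'a) measure) \<Longrightarrow> f \<in> borel_measurable (\<nu> \<Otimes>\<^sub>M (lborel :: 'a measure))"
    using measurable_cong_sets[OF bp refl] by auto
  have shift: "(\<integral>\<^sup>+x. G x \<partial>\<nu>) = (\<integral>\<^sup>+x. G (t + x) \<partial>\<nu>)" if [measurable]: "G \<in> borel_measurable borel" for G t
  proof -
    have "(\<integral>\<^sup>+x. G x \<partial>\<nu>) = (\<integral>\<^sup>+x. G x \<partial>distr \<nu> borel ((+) t))" by (simp add: trans)
    also have "\<dots> = (\<integral>\<^sup>+x. G (t + x) \<partial>\<nu>)"
      by (simp add: nn_integral_distr meas[of "(+) t", simplified] measurable_cong_sets[OF sets refl])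
    finally show ?thesis .
  qed
  have lshift: "(\<integral>\<^sup>+x. G x \<partial>lborel) = (\<integral>\<^sup>+x. G (t + x) \<partial>lborel)" if [measurable]: "G \<in> borel_measurable borel" for G and t :: 'a
    by (subst lborel_distr_plus[of t, symmetric]) (simp add: nn_integral_distr)
  have refl: "(\<integral>\<^sup>+x. G x \<partial>lborel) = (\<integral>\<^sup>+x. G (t - x) \<partial>lborel)" if [measurable]: "G \<in> borel_measurable borel" for G and t :: 'a
    by (subst lborel_distr_reflect[of t, symmetric]) (simp add: nn_integral_distr)
  define I where "I S x = (indicator S x :: ennreal)" for S and x :: 'a
  have I[measurable]: "I A \<in> borel_measurable borel" "I B \<in> borel_measurable borel"
    unfolding I_def by measurable
  have int: "integral\<^sup>N lborel (I A) = emeasure lborel A" "integral\<^sup>N lborel (I B) = emeasure lborel B"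
    by (simp_all add: I_def[abs_def])
  have "emeasure \<nu> A * emeasure lborel B = (\<integral>\<^sup>+x. I A x * emeasure lborel B \<partial>\<nu>)"
    by (simp add: I_def nn_integral_multc meas sets)
  also have "\<dots> = (\<integral>\<^sup>+x. I A x * (\<integral>\<^sup>+y. I B (x + y) \<partial>lborel) \<partial>\<nu>)"
    by (subst lshift[symmetric]) (simp_all add: int)
  also have "\<dots> = (\<integral>\<^sup>+x. \<integral>\<^sup>+y. I A x * I B (x + y) \<partial>lborel \<partial>\<nu>)"
    by (simp add: nn_integral_cmult)
  also have "\<dots> = (\<integral>\<^sup>+y. \<integral>\<^sup>+x. I A x * I B (x + y) \<partial>\<nu> \<partial>lborel)"
    by (rule P.Fubini'[symmetric], rule mp) (simp add: split_beta' borel_prod[symmetric])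
  \<comment> \<open>Invariance of \<nu> moves \<open>y\<close> from the factor of \<open>B\<close>
    to that of \<open>A\<close>. The integral in \<open>y\<close> then sees only \<open>A\<close>,
    and the reflection \<open>y \<mapsto> x - y\<close> evaluates it as the Lebesgue measure of
    \<open>A\<close>.\<close>
  also have "\<dots> = (\<integral>\<^sup>+y. \<integral>\<^sup>+x. I A (x - y) * I B x \<partial>\<nu> \<partial>lborel)"
  proof (rule nn_integral_cong)
    fix y
    show "(\<integral>\<^sup>+x. I A x * I B (x + y) \<partial>\<nu>) = (\<integral>\<^sup>+x. I A (x - y) * I B x \<partial>\<nu>)"
      by (subst shift[of _ "-y"]) simp_all
  qed
  also have "\<dots> = (\<integral>\<^sup>+x. \<integral>\<^sup>+y. I A (x - y) * I B x \<partial>lborel \<partial>\<nu>)"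
    by (rule P.Fubini', rule mp) (simp add: split_beta' borel_prod[symmetric])
  also have "\<dots> = (\<integral>\<^sup>+x. (\<integral>\<^sup>+y. I A (x - y) \<partial>lborel) * I B x \<partial>\<nu>)"
    by (simp add: nn_integral_multc)
  also have "\<dots> = (\<integral>\<^sup>+x. emeasure lborel A * I B x \<partial>\<nu>)"
    by (subst refl[symmetric]) (simp_all add: int)
  also have "\<dots> = emeasure lborel A * emeasure \<nu> B"
    by (simp add: I_def nn_integral_cmult meas sets)
  also have "emeasure \<nu> B = emeasure lborel B" by (simp add: B_def balls)
  finally have "emeasure lborel B * emeasure \<nu> A = emeasure lborel B * emeasure lborel A"
    by (simp add: mult.commute)
  moreover have "emeasure lborel B \<noteq> \<infinity>"
    using emeasure_bounded_finite[of "ball (0::'a) 1"] by (simp add: B_def less_top)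
  moreover have "0 < emeasure lborel B"
    using unit_ball_vol_pos[of "real DIM('a)"] by (simp add: B_def emeasure_ball)
  ultimately show "emeasure \<nu> A = emeasure lborel A"
    by (auto simp: ennreal_mult_cancel_left)
qed

text \<open>Multiplication by \<open>c\<close> turns translation by \<open>inverse c *s t\<close>
  into translation by \<open>t\<close>, so the image measure is again translation invariant. As
  \<open>cmod c = 1\<close>, centred balls are preserved, which fixes the normalisation.\<close>

lemma lborel_distr_rotation:
  assumes "cmod c = 1"
  shows "distr lborel borel (\<lambda>x. c *s x) = (lborel :: (complex ^ 'n) measure)"
proof (rule translation_invariant_eq_lborel)
  have c: "c \<noteq> 0" using assms by auto
  have lin: "linear (\<lambda>x::complex^'n. c *s x)"
    by (rule linearI) (simp_all add: vec_eq_iff algebra_simps)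
  have [measurable]: "(\<lambda>x::complex^'n. c *s x) \<in> borel_measurable borel"
    by (intro borel_measurable_continuous_onI linear_continuous_on lin linear_conv_bounded_linear[THEN iffD1])
  show "sets (distr lborel borel (\<lambda>x::complex^'n. c *s x)) = sets borel" by simp
  fix t :: "complex ^ 'n"
  have "distr (distr lborel borel (\<lambda>x::complex^'n. c *s x)) borel ((+) t)
      = distr lborel borel (\<lambda>x. c *s (inverse c *s t + x))"
    by (subst distr_distr) (auto simp: o_def vector_add_ldistrib c)
  also have "\<dots> = distr (distr lborel borel ((+) (inverse c *s t))) borel (\<lambda>x. c *s x)"
    by (subst distr_distr) (auto simp: o_def)
  finally show "distr (distr lborel borel (\<lambda>x::complex^'n. c *s x)) borel ((+) t)
      = distr lborel borel (\<lambda>x. c *s x)" by (simp add: lborel_distr_plus)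
next
  fix s
  have lin: "linear (\<lambda>x::complex^'n. c *s x)"
    by (rule linearI) (simp_all add: vec_eq_iff algebra_simps)
  have [measurable]: "(\<lambda>x::complex^'n. c *s x) \<in> borel_measurable borel"
    by (intro borel_measurable_continuous_onI linear_continuous_on lin linear_conv_bounded_linear[THEN iffD1])
  have "(\<lambda>x::complex^'n. c *s x) -` ball 0 s = ball 0 s"
    by (auto simp: norm_vector_smult assms)
  then show "emeasure (distr lborel borel (\<lambda>x::complex^'n. c *s x)) (ball 0 s) = emeasure lborel (ball (0::complex^'n) s)"
    by (simp add: emeasure_distr)
qed

lemma vec_smult_of_real: "complex_of_real c *s x = c *\<^sub>R x" for x :: "complex ^ 'n"
  by (simp add: vec_eq_iff) (simp add: scaleR_conv_of_real)

text \<open>Openness makes the image a Borel set, on which \<open>lborel\<close> and its completion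
  agree.\<close>

lemma emeasure_lborel_affine:
  fixes S :: "'a::euclidean_space set"
  assumes "open S" "m \<noteq> 0"
  shows "emeasure lborel ((\<lambda>x. m *\<^sub>R x + c) ` S) = ennreal (\<bar>m\<bar> ^ DIM('a)) * emeasure lborel S"
proof -
  have "open ((\<lambda>x. c + x) ` ((\<lambda>x. m *\<^sub>R x) ` S))"
    by (intro open_translation open_scaling assms)
  then have "open ((\<lambda>x. m *\<^sub>R x + c) ` S)"
    by (simp add: image_image add.commute)
  then show ?thesis
    using emeasure_lebesgue_affine[of m c S] assms by (simp add: emeasure_completion)
qed

section \<open>Circled neighbourhoods in a convex domain\<close>

locale convex_domain =
  fixes \<Omega> :: "(complex ^ 'n) set"
  assumes open_dom: "open \<Omega>" and bounded_dom: "bounded \<Omega>"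
    and convex_dom: "convex \<Omega>" and nonempty_dom: "\<Omega> \<noteq> {}"
begin

text \<open>For \<open>s > 0\<close> this is \<open>a + s D\<^sub>a\<close>.\<close>

definition circled_nbhd :: "complex ^ 'n \<Rightarrow> real \<Rightarrow> (complex ^ 'n) set" where
  "circled_nbhd a s = {z. \<forall>\<xi>. cmod \<xi> * s \<le> 1 \<longrightarrow> a + \<xi> *s (z - a) \<in> \<Omega>}"

lemma circled_nbhd_center: "a \<in> \<Omega> \<Longrightarrow> a \<in> circled_nbhd a s"
  by (simp add: circled_nbhd_def)

lemma circled_nbhd_smult:
  assumes "a + v \<in> circled_nbhd a s" "cmod c * s \<le> t"
  shows "a + c *s v \<in> circled_nbhd a t"
  unfolding circled_nbhd_def
proof safe
  fix \<xi> assume \<xi>: "cmod \<xi> * t \<le> 1"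
  have "cmod (\<xi> * c) * s \<le> cmod \<xi> * t"
    using mult_left_mono[OF assms(2), of "cmod \<xi>"] by (simp add: norm_mult mult_ac)
  with \<xi> assms(1) have "a + (\<xi> * c) *s v \<in> \<Omega>"
    by (auto simp: circled_nbhd_def)
  then show "a + \<xi> *s (a + c *s v - a) \<in> \<Omega>"
    by (simp add: vector_smult_assoc)
qed

lemma circled_nbhd_scaleR:
  assumes "a + v \<in> circled_nbhd a s" "\<bar>c\<bar> * s \<le> t"
  shows "a + c *\<^sub>R v \<in> circled_nbhd a t"
  using circled_nbhd_smult[OF assms(1), of "complex_of_real c" t] assms(2)
  by (simp add: vec_smult_of_real)

lemma circled_nbhd_mono: "s \<le> t \<Longrightarrow> circled_nbhd a s \<subseteq> circled_nbhd a t"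
  using circled_nbhd_smult[of a _ s 1 t] by (metis add.commute diff_add_cancel mult_1 norm_one subsetI vector_smult_lid)

lemma circled_nbhd_subset_dom: "s \<le> 1 \<Longrightarrow> circled_nbhd a s \<subseteq> \<Omega>"
  by (auto simp: circled_nbhd_def dest: spec[of _ 1])

lemma circled_nbhd_scaled_dom:
  assumes "z \<in> circled_nbhd a s" "\<bar>c\<bar> * s \<le> 1"
  shows "a + c *\<^sub>R (z - a) \<in> \<Omega>"
proof -
  have "a + complex_of_real c *s (z - a) \<in> \<Omega>"
    using assms unfolding circled_nbhd_def by (auto simp del: vector_ssub_ldistrib)
  then show ?thesis by (simp only: vec_smult_of_real)
qed

lemma convex_dom_comb:
  assumes "x \<in> \<Omega>" "y \<in> \<Omega>" "0 \<le> u" "u \<le> 1"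
  shows "u *\<^sub>R x + (1 - u) *\<^sub>R y \<in> \<Omega>"
  using convex_dom assms unfolding convex_def by auto

text \<open>The point \<open>w + (1 - s) \<xi> v\<close> is the convex combination, with weights
  \<open>s\<close> and \<open>1 - s\<close>, of \<open>a + (w - a)/s\<close> and
  \<open>a + \<xi> v\<close>. In other words, a copy of the neighbourhood of \<open>a\<close>,
  shrunk by \<open>1 - s\<close> and recentred at \<open>w\<close>, fits into that of
  \<open>w\<close>.\<close>

lemma circled_nbhd_engulf:
  assumes w: "w \<in> circled_nbhd a s" and s: "0 < s" "s < 1" and v: "a + v \<in> circled_nbhd a t"
  shows "w + (1 - s) *\<^sub>R v \<in> circled_nbhd w t"
  unfolding circled_nbhd_def
proof safe
  fix \<xi> assume "cmod \<xi> * t \<le> 1"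
  with v have "a + \<xi> *s v \<in> \<Omega>" by (auto simp: circled_nbhd_def)
  moreover have "a + (1/s) *\<^sub>R (w - a) \<in> \<Omega>"
    using circled_nbhd_scaled_dom[OF w, of "1/s"] s by simp
  ultimately have "s *\<^sub>R (a + (1/s) *\<^sub>R (w - a)) + (1 - s) *\<^sub>R (a + \<xi> *s v) \<in> \<Omega>"
    using s by (intro convex_dom_comb) auto
  also have "s *\<^sub>R (a + (1/s) *\<^sub>R (w - a)) + (1 - s) *\<^sub>R (a + \<xi> *s v)
      = w + \<xi> *s (w + (1 - s) *\<^sub>R v - w)"
    using s by (simp add: vec_eq_iff algebra_simps)
  finally show "w + \<xi> *s (w + (1 - s) *\<^sub>R v - w) \<in> \<Omega>" .
qed

text \<open>Being circled, the neighbourhood of \<open>a\<close> contains the reflection of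
  \<open>w\<close>, and engulfing carries \<open>(1 - s)(a - w)\<close> over to \<open>w\<close>.
  Dividing by \<open>1 - s \<ge> 1/2\<close> costs at most the factor 2.\<close>

lemma circled_nbhd_sym:
  assumes w: "w \<in> circled_nbhd a s" and s: "0 < s" "s \<le> 1/2"
  shows "a \<in> circled_nbhd w (2 * s)"
proof -
  have "a + (-1) *\<^sub>R (w - a) \<in> circled_nbhd a s"
    by (rule circled_nbhd_scaleR[of _ _ s]) (use w in auto)
  then have "w + (1 - s) *\<^sub>R ((-1) *\<^sub>R (w - a)) \<in> circled_nbhd w s"
    using s by (intro circled_nbhd_engulf[OF w]) auto
  then have "w + (1 / (1 - s)) *\<^sub>R ((1 - s) *\<^sub>R ((-1) *\<^sub>R (w - a))) \<in> circled_nbhd w (2 * s)"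
    by (rule circled_nbhd_scaleR) (use s in \<open>auto simp: field_simps\<close>)
  then show ?thesis using s by simp
qed

section \<open>Distance to the complement of the domain\<close>

lemma compl_dom_nonempty: "- \<Omega> \<noteq> {}"
  using bounded_dom not_bounded_UNIV[where 'a = "complex ^ 'n"] by (metis Compl_empty_eq double_complement)

lemma bdist_nonneg: "0 \<le> bdist \<Omega> z"
  by (simp add: bdist_def infdist_nonneg)

lemma bdist_pos: "z \<in> \<Omega> \<Longrightarrow> 0 < bdist \<Omega> z"
  using infdist_pos_not_in_closed[of "- \<Omega>" z] open_dom compl_dom_nonempty
  by (simp add: bdist_def closed_def)

lemma ball_bdist_subset: "ball z (bdist \<Omega> z) \<subseteq> \<Omega>"
proof
  fix x assume x: "x \<in> ball z (bdist \<Omega> z)"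
  show "x \<in> \<Omega>"
  proof (rule ccontr)
    assume "x \<notin> \<Omega>"
    then have "bdist \<Omega> z \<le> dist z x" unfolding bdist_def by (intro infdist_le) auto
    with x show False by simp
  qed
qed

lemma bdist_ge:
  assumes "ball z \<rho> \<subseteq> \<Omega>" shows "\<rho> \<le> bdist \<Omega> z"
proof -
  have "\<rho> \<le> dist z x" if "x \<in> - \<Omega>" for x
    using assms that by (meson ComplD mem_ball not_le subsetD)
  then show ?thesis
    using compl_dom_nonempty by (auto simp: bdist_def infdist_def intro!: cINF_greatest)
qed

text \<open>The centre \<open>a\<close> is the combination of \<open>z\<close> and
  \<open>a - (z - a)/s\<close> with weights \<open>1/(1 + s)\<close> and \<open>s/(1 + s)\<close>,
  so a ball about \<open>z\<close> inside \<Omega> yields a ball about \<open>a\<close> that is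
  smaller by the factor \<open>1 + s\<close>. This works for arbitrarily large \<open>s\<close>, as
  the outer shells of the test function estimate require.\<close>

lemma bdist_upper:
  assumes z: "z \<in> circled_nbhd a s" and s: "0 < s"
  shows "bdist \<Omega> z \<le> (1 + s) * bdist \<Omega> a"
proof -
  have "ball a (bdist \<Omega> z / (1 + s)) \<subseteq> \<Omega>"
  proof
    fix x assume x: "x \<in> ball a (bdist \<Omega> z / (1 + s))"
    have "z + (1 + s) *\<^sub>R (x - a) \<in> ball z (bdist \<Omega> z)"
      using x s by (simp add: dist_norm norm_minus_commute pos_less_divide_eq mult.commute)
    then have 1: "z + (1 + s) *\<^sub>R (x - a) \<in> \<Omega>" using ball_bdist_subset by blast
    have 2: "a + (-(1/s)) *\<^sub>R (z - a) \<in> \<Omega>"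
      by (rule circled_nbhd_scaled_dom[OF z]) (use s in simp)
    define t where "t = 1 / (1 + s)"
    have t1: "t * (1 + s) = 1" using s by (simp add: t_def)
    then have "1 - t = t * s" by (simp add: algebra_simps)
    then have t: "t * (1 + s) = 1" "(1 - t) / s = t" "0 \<le> t" "t \<le> 1"
      using s t1 by (auto simp: t_def)
    have "t *\<^sub>R (z + (1 + s) *\<^sub>R (x - a)) + (1 - t) *\<^sub>R (a + (-(1/s)) *\<^sub>R (z - a)) \<in> \<Omega>"
      by (rule convex_dom_comb[OF 1 2 t(3,4)])
    also have "t *\<^sub>R (z + (1 + s) *\<^sub>R (x - a)) + (1 - t) *\<^sub>R (a + (-(1/s)) *\<^sub>R (z - a))
      = t *\<^sub>R z + (t * (1 + s)) *\<^sub>R (x - a) + (1 - t) *\<^sub>R a - ((1 - t) / s) *\<^sub>R (z - a)"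
      by (simp add: scaleR_add_right scaleR_diff_right)
    also have "\<dots> = x" unfolding t(1,2) by (simp add: algebra_simps)
    finally show "x \<in> \<Omega>" .
  qed
  then have "bdist \<Omega> z / (1 + s) \<le> bdist \<Omega> a" by (rule bdist_ge)
  then show ?thesis using s by (simp add: field_simps)
qed

text \<open>Here \<open>z\<close> is the combination of \<open>a + (z - a)/s\<close> and
  \<open>a\<close> with weights \<open>s\<close> and \<open>1 - s\<close>. The restriction
  \<open>s < 1\<close> leaves a positive share of the ball about \<open>a\<close>.\<close>

lemma bdist_lower:
  assumes z: "z \<in> circled_nbhd a s" and s: "0 < s" "s < 1"
  shows "(1 - s) * bdist \<Omega> a \<le> bdist \<Omega> z"
proof (rule bdist_ge, rule)
  fix x assume x: "x \<in> ball z ((1 - s) * bdist \<Omega> a)"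
  have "a + (1 / (1 - s)) *\<^sub>R (x - z) \<in> ball a (bdist \<Omega> a)"
    using x s by (simp add: dist_norm norm_minus_commute pos_divide_less_eq mult.commute)
  then have 1: "a + (1 / (1 - s)) *\<^sub>R (x - z) \<in> \<Omega>" using ball_bdist_subset by blast
  have 2: "a + (1/s) *\<^sub>R (z - a) \<in> \<Omega>"
    by (rule circled_nbhd_scaled_dom[OF z]) (use s in simp)
  have "s *\<^sub>R (a + (1/s) *\<^sub>R (z - a)) + (1 - s) *\<^sub>R (a + (1 / (1 - s)) *\<^sub>R (x - z)) \<in> \<Omega>"
    by (rule convex_dom_comb[OF 2 1]) (use s in auto)
  also have "s *\<^sub>R (a + (1/s) *\<^sub>R (z - a)) + (1 - s) *\<^sub>R (a + (1 / (1 - s)) *\<^sub>R (x - z)) = x"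
    using s by (simp add: algebra_simps)
  finally show "x \<in> \<Omega>" .
qed

lemma ball_subset_circled_nbhd:
  assumes "0 < s" "a \<in> \<Omega>"
  shows "ball a (s * bdist \<Omega> a) \<subseteq> circled_nbhd a s"
  unfolding circled_nbhd_def
proof safe
  fix z \<xi> assume z: "z \<in> ball a (s * bdist \<Omega> a)" and \<xi>: "cmod \<xi> * s \<le> 1"
  have "cmod \<xi> * norm (z - a) < bdist \<Omega> a"
  proof (cases "\<xi> = 0")
    case False
    then have "cmod \<xi> * norm (z - a) < cmod \<xi> * (s * bdist \<Omega> a)"
      using z by (simp add: dist_norm norm_minus_commute)
    also have "\<dots> \<le> 1 * bdist \<Omega> a"
      unfolding mult.assoc[symmetric] using \<xi> by (intro mult_right_mono bdist_nonneg)
    finally show ?thesis by simp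
  qed (use bdist_pos[OF assms(2)] in simp)
  then have "a + \<xi> *s (z - a) \<in> ball a (bdist \<Omega> a)"
    by (simp add: dist_norm norm_vector_smult del: vector_ssub_ldistrib)
  then show "a + \<xi> *s (z - a) \<in> \<Omega>" using ball_bdist_subset by blast
qed

lemma circled_nbhd_eq_image:
  assumes "0 < s"
  shows "circled_nbhd a s = (\<lambda>x. s *\<^sub>R x + (1 - s) *\<^sub>R a) ` circled_nbhd a 1"
proof safe
  fix z assume z: "z \<in> circled_nbhd a s"
  have "a + (1/s) *\<^sub>R (z - a) \<in> circled_nbhd a 1"
    by (rule circled_nbhd_scaleR[of _ _ s]) (use z assms in auto)
  moreover have "z = s *\<^sub>R (a + (1/s) *\<^sub>R (z - a)) + (1 - s) *\<^sub>R a"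
    using assms by (simp add: algebra_simps)
  ultimately show "z \<in> (\<lambda>x. s *\<^sub>R x + (1 - s) *\<^sub>R a) ` circled_nbhd a 1" by blast
next
  fix x assume x: "x \<in> circled_nbhd a 1"
  have "a + s *\<^sub>R (x - a) \<in> circled_nbhd a s"
    by (rule circled_nbhd_scaleR[of _ _ 1]) (use x assms in auto)
  then show "s *\<^sub>R x + (1 - s) *\<^sub>R a \<in> circled_nbhd a s" by (simp add: algebra_simps)
qed

text \<open>The complement is the projection of a closed set along the compact disc of parameters
  \<xi>. Openness is stated jointly in centre and point because both the measurability of the volume
  as a function of the centre and the later use of Fubini depend on the pair.\<close>

lemma open_circled_nbhd_graph:
  assumes "0 < s"
  shows "open {p. snd p \<in> circled_nbhd (fst p) s}"
proof -
  let ?K = "{\<xi>::complex. cmod \<xi> * s \<le> 1}"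
  let ?T = "{(\<xi>::complex, p :: (complex^'n) \<times> (complex^'n)). fst p + \<xi> *s (snd p - fst p) \<in> - \<Omega>}"
  have "?K = cball 0 (1/s)" using assms by (auto simp: field_simps)
  then have K: "compact ?K" by simp
  have c: "continuous_on UNIV (\<lambda>q::complex \<times> (complex^'n) \<times> (complex^'n). fst (snd q) + fst q *s (snd (snd q) - fst (snd q)))"
    unfolding vector_scalar_mult_def by (intro continuous_intros)
  have "closed ((\<lambda>q::complex \<times> (complex^'n) \<times> (complex^'n). fst (snd q) + fst q *s (snd (snd q) - fst (snd q))) -` (- \<Omega>))"
    using open_dom by (intro continuous_closed_vimage c[unfolded continuous_on_eq_continuous_at[OF open_UNIV], rule_format]) (auto simp: closed_def)
  then have "closed ?T" by (simp add: vimage_def case_prod_unfold)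
  from closed_compact_projection[OF K this]
  have "closed {p. \<exists>\<xi>. \<xi> \<in> ?K \<and> (\<xi>, p) \<in> ?T}" .
  then have "open (- {p. \<exists>\<xi>. \<xi> \<in> ?K \<and> (\<xi>, p) \<in> ?T})" by (simp add: open_closed)
  also have "- {p. \<exists>\<xi>. \<xi> \<in> ?K \<and> (\<xi>, p) \<in> ?T} = {p. snd p \<in> circled_nbhd (fst p) s}"
    by (auto simp: circled_nbhd_def)
  finally show ?thesis .
qed

lemma open_circled_nbhd:
  assumes "0 < s" shows "open (circled_nbhd a s)"
proof -
  have "open ((\<lambda>z. (a, z)) -` {p. snd p \<in> circled_nbhd (fst p) s})"
    by (rule open_vimage[OF open_circled_nbhd_graph[OF assms]]) (intro continuous_intros)
  then show ?thesis by (simp add: vimage_def)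
qed

lemma bounded_circled_nbhd:
  assumes "0 < s" shows "bounded (circled_nbhd a s)"
proof -
  have "bounded ((\<lambda>x. (1 - s) *\<^sub>R a + x) ` ((\<lambda>x. s *\<^sub>R x) ` circled_nbhd a 1))"
    using bounded_subset[OF bounded_dom circled_nbhd_subset_dom[of 1 a]]
    by (intro bounded_translation bounded_scaling) auto
  then show ?thesis
    unfolding circled_nbhd_eq_image[OF assms] by (simp add: image_image add.commute)
qed

section \<open>Volumes and weighted volumes of circled neighbourhoods\<close>

definition circled_vol :: "complex ^ 'n \<Rightarrow> real" where
  "circled_vol a = measure lborel (circled_nbhd a 1)"

lemma emeasure_circled_nbhd:
  assumes "0 < s"
  shows "emeasure lborel (circled_nbhd a s) = ennreal (s ^ DIM(complex ^ 'n) * circled_vol a)"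
proof -
  have "emeasure lborel (circled_nbhd a 1) = ennreal (circled_vol a)"
    unfolding circled_vol_def
    by (rule emeasure_eq_ennreal_measure) (use emeasure_bounded_finite[OF bounded_circled_nbhd[of 1 a]] in simp)
  then show ?thesis
    using emeasure_lborel_affine[OF open_circled_nbhd[of 1 a], of s "(1 - s) *\<^sub>R a"] assms
    by (simp add: circled_nbhd_eq_image[OF assms] ennreal_mult circled_vol_def)
qed

lemma circled_vol_pos:
  assumes "a \<in> \<Omega>" shows "0 < circled_vol a"
proof -
  have "0 < emeasure lborel (ball a (1 * bdist \<Omega> a))"
    using bdist_pos[OF assms] unit_ball_vol_pos[of "real DIM(complex ^ 'n)"] by (simp add: emeasure_ball)
  also have "\<dots> \<le> emeasure lborel (circled_nbhd a 1)"
    using ball_subset_circled_nbhd[of 1 a] assms by (intro emeasure_mono) (auto simp: open_circled_nbhd)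
  finally show ?thesis using emeasure_circled_nbhd[of 1 a] by (simp add: ennreal_less_zero_iff)
qed

text \<open>The shrunk and translated copy from \<open>circled_nbhd_engulf\<close> lies in the
  neighbourhood of \<open>w\<close>; the factor is its Jacobian in real dimension
  \<open>2n\<close>.\<close>

lemma circled_vol_engulf:
  assumes w: "w \<in> circled_nbhd a s" and s: "0 < s" "s < 1"
  shows "(1 - s) ^ DIM(complex ^ 'n) * circled_vol a \<le> circled_vol w"
proof -
  have "(\<lambda>x. (1 - s) *\<^sub>R x + (w - (1 - s) *\<^sub>R a)) ` circled_nbhd a 1 \<subseteq> circled_nbhd w 1"
  proof safe
    fix x assume "x \<in> circled_nbhd a 1"
    with circled_nbhd_engulf[OF w s, of "x - a" 1]
    show "(1 - s) *\<^sub>R x + (w - (1 - s) *\<^sub>R a) \<in> circled_nbhd w 1" by (simp add: algebra_simps)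
  qed
  then have "emeasure lborel ((\<lambda>x. (1 - s) *\<^sub>R x + (w - (1 - s) *\<^sub>R a)) ` circled_nbhd a 1)
      \<le> emeasure lborel (circled_nbhd w 1)"
    by (intro emeasure_mono) (auto simp: open_circled_nbhd)
  then have "ennreal ((1 - s) ^ DIM(complex ^ 'n)) * emeasure lborel (circled_nbhd a 1) \<le> emeasure lborel (circled_nbhd w 1)"
    using s by (subst (asm) emeasure_lborel_affine) (auto simp: open_circled_nbhd)
  then have "ennreal ((1 - s) ^ DIM(complex ^ 'n) * circled_vol a) \<le> ennreal (circled_vol w)"
    using s emeasure_circled_nbhd[of 1] by (simp add: ennreal_mult')
  then show ?thesis by (simp add: circled_vol_def ennreal_le_iff)
qed

text \<open>Up to constants, the measure with density \<open>bdist^j\<close> of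
  \<open>a + s D_a\<close> for fixed small \<open>s\<close>: the density is nearly constant there
  and leaves the integral. It serves as the common yardstick for \<mu> and for the Bergman
  measure.\<close>

definition weighted_vol :: "nat \<Rightarrow> complex ^ 'n \<Rightarrow> real" where
  "weighted_vol j a = bdist \<Omega> a ^ j * circled_vol a"

lemma weighted_vol_pos: "a \<in> \<Omega> \<Longrightarrow> 0 < weighted_vol j a"
  by (simp add: weighted_vol_def bdist_pos circled_vol_pos)

lemma weighted_vol_engulf:
  assumes w: "w \<in> circled_nbhd a s" and s: "0 < s" "s \<le> 1/2"
  shows "(1/2) ^ (j + DIM(complex ^ 'n)) * weighted_vol j a \<le> weighted_vol j w"
proof -
  have *: "(1/2) * bdist \<Omega> a \<le> bdist \<Omega> w"
    by (rule order_trans[OF mult_right_mono bdist_lower[OF w s(1)]]) (use s bdist_nonneg in auto)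
  have "(1/2) ^ DIM(complex ^ 'n) * circled_vol a \<le> (1 - s) ^ DIM(complex ^ 'n) * circled_vol a"
    using s by (intro mult_right_mono power_mono) (auto simp: circled_vol_def)
  also have "\<dots> \<le> circled_vol w" using s by (intro circled_vol_engulf[OF w]) auto
  finally have "(1/2 * bdist \<Omega> a) ^ j * ((1/2) ^ DIM(complex ^ 'n) * circled_vol a) \<le> bdist \<Omega> w ^ j * circled_vol w"
    using * bdist_nonneg by (intro mult_mono power_mono) (auto simp: circled_vol_def)
  then show ?thesis by (simp only: weighted_vol_def power_add power_mult_distrib mult_ac)
qed

end

section \<open>Submean property and the embedding\<close>

text \<open>A convex function lies above its tangent at \<open>b\<close>. Deriving this from Young's
  inequality with exponents \<open>q\<close> and \<open>q/(q - 1)\<close> covers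
  \<open>b = 0\<close> and \<open>s = 0\<close> without a separate case.\<close>

lemma powr_ge_tangent:
  fixes b s q :: real
  assumes "0 \<le> b" "0 \<le> s" "1 < q"
  shows "b powr q + q * b powr (q - 1) * (s - b) \<le> s powr q"
proof -
  have "s * b powr (q - 1) \<le> s powr q / q + (b powr (q - 1)) powr (q / (q - 1)) / (q / (q - 1))"
    by (rule Youngs_inequality) (use assms in \<open>auto simp: field_simps\<close>)
  also have "(b powr (q - 1)) powr (q / (q - 1)) = b powr q"
    using assms by (simp add: powr_powr)
  finally have "q * (s * b powr (q - 1)) \<le> q * (s powr q / q + b powr q / (q / (q - 1)))"
    using assms by (intro mult_left_mono) auto
  also have "\<dots> = s powr q + (q - 1) * b powr q" using assms by (simp add: field_simps)
  finally have 1: "q * (s * b powr (q - 1)) \<le> s powr q + (q - 1) * b powr q" .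
  have "b * b powr (q - 1) = b powr q" using assms by (simp add: powr_mult_base)
  with 1 show ?thesis by (simp add: algebra_simps)
qed

text \<open>Cauchy's formula gives the mean value property, and Jensen's inequality raises it to the
  power \<open>q\<close>. The circle is parametrised over \<open>[0, 1]\<close>, so the averaging
  measure has mass 1.\<close>

lemma holomorphic_powr_circle_mean:
  fixes g :: "complex \<Rightarrow> complex"
  assumes hol: "g holomorphic_on ball 0 R" and "1 < R" and q: "1 < q"
  shows "ennreal (cmod (g 0) powr q)
    \<le> (\<integral>\<^sup>+t. ennreal (cmod (g (exp (2 * of_real pi * \<i> * of_real t))) powr q) * indicator {0..1} t \<partial>lborel)"
proof -
  define e where "e t = exp (2 * of_real pi * \<i> * of_real t)" for t :: real
  have e1: "cmod (e t) = 1" for t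
  proof -
    have "2 * of_real pi * \<i> * of_real t = \<i> * of_real (2 * pi * t)" by simp
    then show ?thesis unfolding e_def by (metis norm_exp_i_times)
  qed
  have e0: "e t \<noteq> 0" for t by (simp add: e_def)
  have cont_e: "continuous_on {0..1} e" unfolding e_def by (intro continuous_intros)
  have cont_g: "continuous_on {0..1} (\<lambda>t. g (e t))"
    by (rule continuous_on_compose2[OF holomorphic_on_imp_continuous_on[OF hol] cont_e])
      (use e1 assms in auto)
  define h where "h t = cmod (g (e t))" for t
  have cont_h: "continuous_on {0..1} h" unfolding h_def by (intro continuous_intros cont_g)
  have "g holomorphic_on cball 0 1" using assms by (intro holomorphic_on_subset[OF hol]) auto
  then have "((\<lambda>u. g u / (u - 0)) has_contour_integral 2 * complex_of_real pi * \<i> * g 0) (circlepath 0 1)"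
    by (rule Cauchy_integral_circlepath_simple) auto
  then have "((\<lambda>t. g (e t) / e t * (2 * of_real pi * \<i> * e t)) has_integral 2 * complex_of_real pi * \<i> * g 0) {0..1}"
    unfolding has_contour_integral_def
  proof (rule has_integral_eq[rotated])
    fix t :: real assume "t \<in> {0..1}"
    then have "vector_derivative (circlepath 0 1) (at t within {0..1}) = 2 * of_real pi * \<i> * e t"
      by (simp add: vector_derivative_circlepath01 e_def)
    moreover have "circlepath 0 1 t = e t" by (simp add: circlepath e_def)
    ultimately show "g (circlepath 0 1 t) / (circlepath 0 1 t - 0) * vector_derivative (circlepath 0 1) (at t within {0..1})
        = g (e t) / e t * (2 * of_real pi * \<i> * e t)" by simp
  qed
  then have "((\<lambda>t. (g (e t) / e t * (2 * of_real pi * \<i> * e t)) / (2 * complex_of_real pi * \<i>)) has_integral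
      2 * complex_of_real pi * \<i> * g 0 / (2 * complex_of_real pi * \<i>)) {0..1}"
    by (rule has_integral_divide)
  then have "((\<lambda>t. g (e t)) has_integral g 0) {0..1}" using e0 by simp
  then have mean: "g 0 = integral {0..1} (\<lambda>t. g (e t))" by (simp add: integral_unique)
  have le: "cmod (g 0) \<le> integral {0..1} h" unfolding mean
    by (rule Henstock_Kurzweil_Integration.integral_norm_bound_integral)
      (auto intro!: integrable_continuous_interval cont_g cont_h simp: h_def)
  have hi: "(h has_integral integral {0..1} h) {0..1}"
    by (intro integrable_integral integrable_continuous_interval cont_h)
  have hp: "((\<lambda>t. h t powr q) has_integral integral {0..1} (\<lambda>t. h t powr q)) {0..1}"
    by (intro integrable_integral integrable_continuous_interval continuous_on_powr' cont_h continuous_intros)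
      (use q in \<open>auto simp: h_def\<close>)
  \<comment> \<open>Jensen by hand: the tangent inequality at \<open>b = |g(0)|\<close> is
    integrated over the circle. Its linear part contributes a nonnegative amount because the mean of
    \<open>h\<close> is at least \<open>b\<close>.\<close>
  define b where "b = cmod (g 0)"
  have "((\<lambda>t. b powr q + q * b powr (q - 1) * (h t - b)) has_integral
     b powr q + q * b powr (q - 1) * (integral {0..1} h - b)) {0..1}"
    using has_integral_add[OF has_integral_const_real[of "b powr q" 0 1]
       has_integral_mult_right[OF has_integral_diff[OF hi has_integral_const_real[of b 0 1]], of "q * b powr (q - 1)"]]
    by simp
  from has_integral_le[OF this hp] powr_ge_tangent[of b "h _" q] q
  have "b powr q + q * b powr (q - 1) * (integral {0..1} h - b) \<le> integral {0..1} (\<lambda>t. h t powr q)"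
    by (auto simp: b_def h_def)
  moreover have "0 \<le> q * b powr (q - 1) * (integral {0..1} h - b)"
    using q le by (simp add: b_def)
  ultimately have "b powr q \<le> integral {0..1} (\<lambda>t. h t powr q)" by linarith
  then have "ennreal (b powr q) \<le> ennreal (integral {0..1} (\<lambda>t. h t powr q))" by (rule ennreal_leI)
  also have "\<dots> = (\<integral>\<^sup>+t. ennreal (h t powr q) * indicator {0..1} t \<partial>lborel)"
    by (rule nn_integral_has_integral_lebesgue'[OF _ hp, symmetric]) simp
  finally show ?thesis by (simp add: b_def h_def e_def)
qed

context convex_domain
begin

text \<open>Outside \<Omega> the function \<open>f\<close> is arbitrary, so it is cut off there
  before integrals over the whole space are formed.\<close>

lemma borel_measurable_holomorphic_Cn:
  assumes "holomorphic_Cn_on f \<Omega>"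
  shows "(\<lambda>w. indicator \<Omega> w *\<^sub>R f w) \<in> borel_measurable borel"
proof (rule borel_measurable_continuous_on_indicator)
  show "\<Omega> \<in> sets borel" using open_dom by simp
  show "continuous_on \<Omega> f"
    using assms open_dom unfolding holomorphic_Cn_on_def
    by (meson continuous_at_imp_continuous_on has_derivative_continuous)
qed

lemma holomorphic_on_complex_line:
  assumes f: "holomorphic_Cn_on f \<Omega>" and sub: "\<And>\<xi>. \<xi> \<in> S \<Longrightarrow> z + \<xi> *s v \<in> \<Omega>"
  shows "(\<lambda>\<xi>. f (z + \<xi> *s v)) holomorphic_on S"
  unfolding holomorphic_on_def field_differentiable_def
proof
  fix \<xi> assume "\<xi> \<in> S"
  then obtain f' where f': "(f has_derivative f') (at (z + \<xi> *s v))" "\<And>c h. f' (c *s h) = c * f' h"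
    using f sub unfolding holomorphic_Cn_on_def by blast
  have "((\<lambda>\<xi>. z + \<xi> *s v) has_derivative (\<lambda>\<xi>. \<xi> *s v)) (at \<xi> within S)"
  proof -
    have "linear (\<lambda>\<xi>. \<xi> *s v)"
      by (rule linearI) (simp_all add: vec_eq_iff algebra_simps)
    then have "((\<lambda>\<xi>. \<xi> *s v) has_derivative (\<lambda>\<xi>. \<xi> *s v)) (at \<xi> within S)"
      by (intro bounded_linear_imp_has_derivative) (simp add: linear_conv_bounded_linear)
    from has_derivative_add[OF has_derivative_const this] show ?thesis by simp
  qed
  from diff_chain_within[OF this has_derivative_at_withinI[OF f'(1)]]
  have "((\<lambda>\<xi>. f (z + \<xi> *s v)) has_derivative (\<lambda>\<xi>. f' (\<xi> *s v))) (at \<xi> within S)"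
    by (simp add: o_def)
  then have "((\<lambda>\<xi>. f (z + \<xi> *s v)) has_field_derivative f' v) (at \<xi> within S)"
    unfolding has_field_derivative_def f'(2) by (simp add: mult_commute_abs)
  then show "\<exists>f'. ((\<lambda>\<xi>. f (z + \<xi> *s v)) has_field_derivative f') (at \<xi> within S)" ..
qed

text \<open>For each \<open>w\<close> in the neighbourhood \<open>N\<close>, the circle through
  \<open>w\<close> about \<open>z\<close> on their complex line stays in \<open>N\<close>, and
  \<open>s < 1\<close> makes \<open>f\<close> holomorphic on a disc of radius \<open>1/s > 1\<close>
  in the parameter. Averaging the circle inequality over \<open>w\<close> and exchanging the
  integrals leaves, for each angle, the integral over a rotated copy of \<open>N\<close>, which does
  not depend on the angle.\<close>

lemma submean_circled_nbhd:
  assumes f: "holomorphic_Cn_on f \<Omega>" and z: "z \<in> \<Omega>" and s: "0 < s" "s < 1" and q: "1 < q"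
  shows "ennreal (cmod (f z) powr q) * emeasure lborel (circled_nbhd z s)
    \<le> (\<integral>\<^sup>+w. indicator (circled_nbhd z s) w * ennreal (cmod (f w) powr q) \<partial>lborel)"
proof -
  define N where "N = circled_nbhd z s"
  define e where "e t = exp (2 * of_real pi * \<i> * of_real t)" for t :: real
  have e1: "cmod (e t) = 1" for t
  proof -
    have "2 * of_real pi * \<i> * of_real t = \<i> * of_real (2 * pi * t)" by simp
    then show ?thesis unfolding e_def by (metis norm_exp_i_times)
  qed
  have e0: "e t \<noteq> 0" for t by (simp add: e_def)
  define F where "F w = ennreal (cmod (indicator \<Omega> w *\<^sub>R f w) powr q)" for w
  have F[measurable]: "F \<in> borel_measurable borel"
    unfolding F_def using borel_measurable_holomorphic_Cn[OF f] by measurable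
  have N[measurable]: "N \<in> sets borel" unfolding N_def using open_circled_nbhd s by auto
  have N_dom: "N \<subseteq> \<Omega>" unfolding N_def using circled_nbhd_subset_dom s by auto
  define G where "G w = indicator N w * F w" for w
  have G[measurable]: "G \<in> borel_measurable borel" unfolding G_def by measurable
  have rot: "z + e t *s (w - z) \<in> N" if "w \<in> N" for w t
    unfolding N_def by (rule circled_nbhd_smult[of _ _ s]) (use that e1 in \<open>auto simp: N_def\<close>)
  have pt: "indicator N w * F z \<le> (\<integral>\<^sup>+t. G (z + e t *s (w - z)) * indicator {0..1} t \<partial>lborel)" for w
  proof (cases "w \<in> N")
    case True
    have "(\<lambda>\<xi>. f (z + \<xi> *s (w - z))) holomorphic_on ball 0 (1/s)"
    proof (rule holomorphic_on_complex_line[OF f])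
      fix \<xi> :: complex assume "\<xi> \<in> ball 0 (1/s)"
      then have "cmod \<xi> * s \<le> 1" using s by (simp add: field_simps)
      then show "z + \<xi> *s (w - z) \<in> \<Omega>" using True by (auto simp: N_def circled_nbhd_def)
    qed
    from holomorphic_powr_circle_mean[OF this _ q] s
    have "F z \<le> (\<integral>\<^sup>+t. ennreal (cmod (f (z + e t *s (w - z))) powr q) * indicator {0..1} t \<partial>lborel)"
      by (simp add: F_def z e_def)
    also have "\<dots> = (\<integral>\<^sup>+t. G (z + e t *s (w - z)) * indicator {0..1} t \<partial>lborel)"
      using rot[OF True] N_dom by (intro nn_integral_cong) (auto simp: G_def F_def subset_iff)
    finally show ?thesis using True by simp
  qed simp
  \<comment> \<open>Translate \<open>z\<close> to the origin, rotate there, and translate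
    back.\<close>
  have inner: "(\<integral>\<^sup>+w. G (z + e t *s (w - z)) \<partial>lborel) = (\<integral>\<^sup>+w. G w \<partial>lborel)" for t
  proof -
    have [measurable]: "(\<lambda>x::complex^'n. e t *s x) \<in> borel_measurable borel"
      unfolding vector_scalar_mult_def by (intro borel_measurable_continuous_onI continuous_intros)
    have "(\<integral>\<^sup>+w. G w \<partial>lborel) = (\<integral>\<^sup>+w. G (z + w) \<partial>lborel)"
      by (subst lborel_distr_plus[of z, symmetric]) (simp add: nn_integral_distr)
    also have "\<dots> = (\<integral>\<^sup>+w. G (z + e t *s w) \<partial>lborel)"
      by (subst lborel_distr_rotation[OF e1[of t], symmetric]) (simp add: nn_integral_distr)
    also have "\<dots> = (\<integral>\<^sup>+w. G (z + e t *s (- z + w)) \<partial>lborel)"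
      by (subst lborel_distr_plus[of "-z", symmetric]) (simp add: nn_integral_distr)
    finally show ?thesis by simp
  qed
  have mc: "(\<lambda>p :: (complex^'n) \<times> real. z + e (snd p) *s (fst p - z)) \<in> borel_measurable borel"
    unfolding vector_scalar_mult_def e_def by (intro borel_measurable_continuous_onI continuous_intros)
  have mG: "(\<lambda>(w, t). G (z + e t *s (w - z)) * indicator {0..1} t) \<in> borel_measurable ((lborel :: (complex^'n) measure) \<Otimes>\<^sub>M (lborel :: real measure))"
    using measurable_compose[OF mc G] by (simp add: split_beta' lborel_prod borel_prod[symmetric])
  have "F z * emeasure lborel N = (\<integral>\<^sup>+w. indicator N w * F z \<partial>lborel)"
    by (simp only: mult.commute[of _ "F z"]) (simp add: nn_integral_cmult_indicator)
  also have "\<dots> \<le> (\<integral>\<^sup>+w. \<integral>\<^sup>+t. G (z + e t *s (w - z)) * indicator {0..1} t \<partial>lborel \<partial>lborel)"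
    by (rule nn_integral_mono) (rule pt)
  also have "\<dots> = (\<integral>\<^sup>+t. \<integral>\<^sup>+w. G (z + e t *s (w - z)) * indicator {0..1} t \<partial>lborel \<partial>lborel)"
    by (rule lborel_pair.Fubini'[symmetric]) (rule mG)
  also have "\<dots> = (\<integral>\<^sup>+t. (\<integral>\<^sup>+w. G (z + e t *s (w - z)) \<partial>lborel) * indicator {0..1} t \<partial>lborel)"
  proof (rule nn_integral_cong)
    fix t
    have "(\<lambda>w::complex^'n. z + e t *s (w - z)) \<in> borel_measurable borel"
      unfolding vector_scalar_mult_def by (intro borel_measurable_continuous_onI continuous_intros)
    from measurable_compose[OF this G]
    show "(\<integral>\<^sup>+w. G (z + e t *s (w - z)) * indicator {0..1} t \<partial>lborel) = (\<integral>\<^sup>+w. G (z + e t *s (w - z)) \<partial>lborel) * indicator {0..1} t"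
      by (simp add: nn_integral_multc)
  qed
  also have "\<dots> = (\<integral>\<^sup>+w. G w \<partial>lborel)"
    unfolding inner by (simp add: nn_integral_cmult_indicator)
  also have "\<dots> = (\<integral>\<^sup>+w. indicator N w * ennreal (cmod (f w) powr q) \<partial>lborel)"
    using N_dom by (intro nn_integral_cong) (auto simp: G_def F_def indicator_def)
  finally show ?thesis by (simp add: F_def z N_def)
qed

end

text \<open>Only the size of the weight relative to \<open>bdist^j\<close> matters for the
  estimates, so the defining function and the normalising constant are hidden in \<open>c1\<close>
  and \<open>c2\<close>. Outside \<Omega> the weight is constrained only by measurability.\<close>

locale weighted_convex_domain = convex_domain \<Omega> for \<Omega> :: "(complex ^ 'n) set" +
  fixes W :: "complex ^ 'n \<Rightarrow> real" and j :: nat and c1 c2 :: real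
  assumes weight_measurable [measurable]: "W \<in> borel_measurable borel"
    and c1_pos: "0 < c1" and c2_pos: "0 < c2"
    and weight_lower: "z \<in> \<Omega> \<Longrightarrow> c1 * bdist \<Omega> z ^ j \<le> W z"
    and weight_upper: "z \<in> \<Omega> \<Longrightarrow> W z \<le> c2 * bdist \<Omega> z ^ j"
begin

definition wmeasure :: "(complex ^ 'n) measure" where
  "wmeasure = density (restrict_space lborel \<Omega>) (\<lambda>z. ennreal (W z))"

lemma dom_borel [measurable]: "\<Omega> \<in> sets borel"
  using open_dom by simp

lemma space_wmeasure: "space wmeasure = \<Omega>"
  by (simp add: wmeasure_def space_restrict_space)

lemma sets_wmeasure: "sets wmeasure = sets (restrict_space borel \<Omega>)"
  by (simp add: wmeasure_def sets_restrict_space)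

lemma nn_integral_wmeasure:
  assumes [measurable]: "F \<in> borel_measurable borel"
  shows "(\<integral>\<^sup>+z. F z \<partial>wmeasure) = (\<integral>\<^sup>+z. indicator \<Omega> z * (ennreal (W z) * F z) \<partial>lborel)"
proof -
  have [measurable]: "W \<in> borel_measurable (restrict_space lborel \<Omega>)" "F \<in> borel_measurable (restrict_space lborel \<Omega>)"
    by (auto intro!: measurable_restrict_space1)
  have "(\<integral>\<^sup>+z. F z \<partial>wmeasure) = (\<integral>\<^sup>+z. ennreal (W z) * F z \<partial>restrict_space lborel \<Omega>)"
    unfolding wmeasure_def by (rule nn_integral_density) measurable
  also have "\<dots> = (\<integral>\<^sup>+z. ennreal (W z) * F z * indicator \<Omega> z \<partial>lborel)"
    by (rule nn_integral_restrict_space) simp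
  finally show ?thesis by (simp add: mult.commute)
qed

lemma emeasure_wmeasure:
  assumes [measurable]: "S \<in> sets borel" and "S \<subseteq> \<Omega>"
  shows "emeasure wmeasure S = (\<integral>\<^sup>+z. ennreal (W z) * indicator S z \<partial>lborel)"
proof -
  have "S \<in> sets wmeasure" using assms by (auto simp: sets_wmeasure sets_restrict_space)
  then have "emeasure wmeasure S = (\<integral>\<^sup>+z. indicator S z \<partial>wmeasure)" by simp
  also have "\<dots> = (\<integral>\<^sup>+z. indicator \<Omega> z * (ennreal (W z) * indicator S z) \<partial>lborel)"
    by (rule nn_integral_wmeasure) measurable
  also have "\<dots> = (\<integral>\<^sup>+z. ennreal (W z) * indicator S z \<partial>lborel)"
    using assms(2) by (intro nn_integral_cong) (auto simp: indicator_def)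
  finally show ?thesis .
qed

lemma emeasure_wmeasure_upper:
  assumes [measurable]: "S \<in> sets borel" and S: "S \<subseteq> \<Omega>" "S \<subseteq> circled_nbhd a s" and s: "0 < s"
  shows "emeasure wmeasure S \<le> ennreal (c2 * (1 + s) ^ j * s ^ DIM(complex ^ 'n) * weighted_vol j a)"
proof -
  have W: "W z \<le> c2 * ((1 + s) * bdist \<Omega> a) ^ j" if "z \<in> S" for z
  proof -
    have "W z \<le> c2 * bdist \<Omega> z ^ j" using that S by (intro weight_upper) auto
    also have "\<dots> \<le> c2 * ((1 + s) * bdist \<Omega> a) ^ j"
      using that S s c2_pos by (intro mult_left_mono power_mono bdist_upper bdist_nonneg) auto
    finally show ?thesis .
  qed
  have [measurable]: "circled_nbhd a s \<in> sets borel" using open_circled_nbhd s by auto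
  have "emeasure wmeasure S \<le> (\<integral>\<^sup>+z. ennreal (c2 * ((1 + s) * bdist \<Omega> a) ^ j) * indicator (circled_nbhd a s) z \<partial>lborel)"
    unfolding emeasure_wmeasure[OF assms(1) S(1)]
    using W S(2) by (intro nn_integral_mono) (auto simp: indicator_def intro!: ennreal_leI)
  also have "\<dots> = ennreal (c2 * ((1 + s) * bdist \<Omega> a) ^ j) * emeasure lborel (circled_nbhd a s)"
    by (rule nn_integral_cmult_indicator) simp
  also have "\<dots> = ennreal (c2 * (1 + s) ^ j * s ^ DIM(complex ^ 'n) * weighted_vol j a)"
  proof -
    have "0 \<le> c2 * ((1 + s) * bdist \<Omega> a) ^ j" using c2_pos s bdist_nonneg by simp
    from ennreal_mult'[OF this, symmetric] show ?thesis
      unfolding emeasure_circled_nbhd[OF s] weighted_vol_def by (simp only: power_mult_distrib mult_ac)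
  qed
  finally show ?thesis .
qed

lemma emeasure_wmeasure_lower:
  assumes s: "0 < s" "s \<le> 1/2"
  shows "ennreal (c1 * (1/2) ^ j * s ^ DIM(complex ^ 'n) * weighted_vol j a) \<le> emeasure wmeasure (circled_nbhd a s)"
proof -
  have sub: "circled_nbhd a s \<subseteq> \<Omega>" using s by (intro circled_nbhd_subset_dom) auto
  have W: "c1 * (1/2 * bdist \<Omega> a) ^ j \<le> W z" if z: "z \<in> circled_nbhd a s" for z
  proof -
    have "(1/2) * bdist \<Omega> a \<le> bdist \<Omega> z"
      by (rule order_trans[OF mult_right_mono bdist_lower[OF z s(1)]]) (use s bdist_nonneg in auto)
    then have "c1 * (1/2 * bdist \<Omega> a) ^ j \<le> c1 * bdist \<Omega> z ^ j"
      using c1_pos bdist_nonneg by (intro mult_left_mono power_mono) auto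
    also have "\<dots> \<le> W z" using z sub by (intro weight_lower) auto
    finally show ?thesis .
  qed
  have [measurable]: "circled_nbhd a s \<in> sets borel" using open_circled_nbhd s by auto
  have "ennreal (c1 * (1/2) ^ j * s ^ DIM(complex ^ 'n) * weighted_vol j a)
      = ennreal (c1 * (1/2 * bdist \<Omega> a) ^ j) * emeasure lborel (circled_nbhd a s)"
  proof -
    have "0 \<le> c1 * (1/2 * bdist \<Omega> a) ^ j" using c1_pos bdist_nonneg by simp
    from ennreal_mult'[OF this, symmetric] show ?thesis
      unfolding emeasure_circled_nbhd[OF s(1)] weighted_vol_def by (simp only: power_mult_distrib mult_ac)
  qed
  also have "\<dots> = (\<integral>\<^sup>+z. ennreal (c1 * (1/2 * bdist \<Omega> a) ^ j) * indicator (circled_nbhd a s) z \<partial>lborel)"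
    by (rule nn_integral_cmult_indicator[symmetric]) simp
  also have "\<dots> \<le> emeasure wmeasure (circled_nbhd a s)"
    unfolding emeasure_wmeasure[OF \<open>circled_nbhd a s \<in> sets borel\<close> sub]
    using W by (intro nn_integral_mono) (auto simp: indicator_def intro!: ennreal_leI)
  finally show ?thesis .
qed

text \<open>The volume is the measure of a section of the jointly open set in
  \<open>open_circled_nbhd_graph\<close>.\<close>

lemma weighted_vol_measurable [measurable]: "weighted_vol j \<in> borel_measurable borel"
proof -
  have "{p. snd p \<in> circled_nbhd (fst p) 1} \<in> sets (borel \<Otimes>\<^sub>M (lborel :: (complex ^ 'n) measure))"
  proof -
    have "{p :: (complex ^ 'n) \<times> (complex ^ 'n). snd p \<in> circled_nbhd (fst p) 1} \<in> sets (borel \<Otimes>\<^sub>M borel)"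
      unfolding borel_prod using open_circled_nbhd_graph[of 1] by simp
    also have "sets (borel \<Otimes>\<^sub>M borel) = sets (borel \<Otimes>\<^sub>M (lborel :: (complex ^ 'n) measure))"
      by (intro sets_pair_measure_cong) auto
    finally show ?thesis .
  qed
  from lborel.measurable_emeasure_Pair[OF this]
  have [measurable]: "(\<lambda>a. emeasure lborel (circled_nbhd a 1)) \<in> borel_measurable borel"
    by (simp add: vimage_def)
  have [measurable]: "bdist \<Omega> \<in> borel_measurable borel"
    unfolding bdist_def by (intro borel_measurable_continuous_onI continuous_on_infdist continuous_on_id)
  show ?thesis unfolding weighted_vol_def circled_vol_def measure_def by measurable
qed

text \<open>The submean inequality, normalised at the running point \<open>w\<close> instead of at
  the centre \<open>z\<close>. After Fubini the integration in \<open>z\<close> comes first, and the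
  denominator \<open>weighted_vol j w\<close> is then cancelled by the hypothesis on the measure at
  \<open>w\<close>. The bound \<open>t \<le> 1/4\<close> keeps \<open>2 * t\<close>, the parameter
  of the symmetry lemma, within the range \<open>1/2\<close> of
  \<open>weighted_vol_engulf\<close>.\<close>

lemma submean_wmeasure:
  assumes f: "holomorphic_Cn_on f \<Omega>" and z: "z \<in> \<Omega>" and t: "0 < t" "t \<le> 1/4" and q: "1 < q"
  shows "ennreal (cmod (f z) powr q) \<le> ennreal (2 ^ (2 * j + DIM(complex ^ 'n)) / (c1 * t ^ DIM(complex ^ 'n))) *
    (\<integral>\<^sup>+w. indicator (circled_nbhd z t) w *
      (ennreal (W w / weighted_vol j w) * ennreal (cmod (indicator \<Omega> w *\<^sub>R f w) powr q)) \<partial>lborel)"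
proof -
  define d where "d = DIM(complex ^ 'n)"
  define F where "F w = ennreal (cmod (indicator \<Omega> w *\<^sub>R f w) powr q)" for w
  have F[measurable]: "F \<in> borel_measurable borel"
    unfolding F_def using borel_measurable_holomorphic_Cn[OF f] by measurable
  have [measurable]: "circled_nbhd z t \<in> sets borel" using open_circled_nbhd t by auto
  have sub: "circled_nbhd z t \<subseteq> \<Omega>" using t by (intro circled_nbhd_subset_dom) auto
  define v where "v = circled_vol z"
  have v: "0 < v" using circled_vol_pos z by (simp add: v_def)
  \<comment> \<open>One factor \<open>2^j\<close> pays for \<open>bdist\<close> at \<open>w\<close>
    against \<open>z\<close>, the factor \<open>2^(j + d)\<close> for \<open>weighted_vol\<close> at
    \<open>w\<close> against \<open>z\<close>.\<close>
  define A where "A = v * 2 ^ (2 * j + d) / c1"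
  have A: "0 < A" using v c1_pos by (simp add: A_def)
  have key: "1 \<le> A * (W w / weighted_vol j w)" if w: "w \<in> circled_nbhd z t" for w
  proof -
    have wO: "w \<in> \<Omega>" using w sub by auto
    have "z \<in> circled_nbhd w (2 * t)" using t by (intro circled_nbhd_sym[OF w]) auto
    then have "(1/2) ^ (j + d) * weighted_vol j w \<le> weighted_vol j z"
      unfolding d_def by (rule weighted_vol_engulf) (use t in auto)
    then have 1: "weighted_vol j w \<le> 2 ^ (j + d) * weighted_vol j z"
      by (simp add: power_one_over field_simps)
    have "(1/2) * bdist \<Omega> z \<le> bdist \<Omega> w"
      by (rule order_trans[OF mult_right_mono bdist_lower[OF w t(1)]]) (use t bdist_nonneg in auto)
    then have "c1 * (1/2 * bdist \<Omega> z) ^ j \<le> c1 * bdist \<Omega> w ^ j"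
      using c1_pos bdist_nonneg by (intro mult_left_mono power_mono) auto
    also have "\<dots> \<le> W w" using wO by (intro weight_lower)
    finally have "A * (c1 * (1/2 * bdist \<Omega> z) ^ j) \<le> A * W w"
      using A by (intro mult_left_mono) auto
    moreover have "A * (c1 * (1/2 * bdist \<Omega> z) ^ j) = 2 ^ (j + d) * weighted_vol j z"
    proof -
      have "A * (c1 * (1/2 * bdist \<Omega> z) ^ j) = v * 2 ^ (2 * j + d) * (1/2 * bdist \<Omega> z) ^ j"
        using c1_pos by (simp add: A_def)
      also have "\<dots> = (2 * (1/2)) ^ j * 2 ^ (j + d) * (bdist \<Omega> z ^ j * v)"
        unfolding mult_2[of j] power_mult_distrib power_add by (simp only: mult_ac)
      finally show ?thesis by (simp add: weighted_vol_def v_def)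
    qed
    ultimately have "weighted_vol j w \<le> A * W w" using 1 by linarith
    then show ?thesis using weighted_vol_pos[OF wO, of j] by (simp add: field_simps)
  qed
  have "F z * ennreal (t ^ d * v) \<le> (\<integral>\<^sup>+w. indicator (circled_nbhd z t) w * ennreal (cmod (f w) powr q) \<partial>lborel)"
    using submean_circled_nbhd[OF f z t(1) _ q] t by (simp add: F_def z emeasure_circled_nbhd v_def d_def)
  also have "\<dots> = (\<integral>\<^sup>+w. indicator (circled_nbhd z t) w * F w \<partial>lborel)"
    using sub by (intro nn_integral_cong) (auto simp: F_def indicator_def)
  also have "\<dots> \<le> (\<integral>\<^sup>+w. ennreal A * (indicator (circled_nbhd z t) w * (ennreal (W w / weighted_vol j w) * F w)) \<partial>lborel)"
  proof (rule nn_integral_mono)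
    fix w
    show "indicator (circled_nbhd z t) w * F w \<le> ennreal A * (indicator (circled_nbhd z t) w * (ennreal (W w / weighted_vol j w) * F w))"
    proof (cases "w \<in> circled_nbhd z t")
      case True
      have "ennreal 1 * F w \<le> ennreal (A * (W w / weighted_vol j w)) * F w"
        using key[OF True] by (intro mult_right_mono) (auto intro!: ennreal_leI simp del: ennreal_1)
      also have "ennreal (A * (W w / weighted_vol j w)) = ennreal A * ennreal (W w / weighted_vol j w)"
        using A by (intro ennreal_mult') simp
      finally show ?thesis using True by (simp add: mult_ac)
    qed simp
  qed
  also have "\<dots> = ennreal A * (\<integral>\<^sup>+w. indicator (circled_nbhd z t) w * (ennreal (W w / weighted_vol j w) * F w) \<partial>lborel)"
    by (rule nn_integral_cmult) measurable
  finally have "ennreal (1 / (t ^ d * v)) * (F z * ennreal (t ^ d * v)) \<le> ennreal (1 / (t ^ d * v)) *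
     (ennreal A * (\<integral>\<^sup>+w. indicator (circled_nbhd z t) w * (ennreal (W w / weighted_vol j w) * F w) \<partial>lborel))"
    by (rule mult_left_mono) simp
  moreover have "ennreal (1 / (t ^ d * v)) * (F z * ennreal (t ^ d * v)) = F z"
  proof -
    have "ennreal (1 / (t ^ d * v)) * ennreal (t ^ d * v) = 1"
      using t v by (subst ennreal_mult'[symmetric]) (auto)
    then show ?thesis by (metis mult.assoc mult.commute mult_1)
  qed
  moreover have "ennreal (1 / (t ^ d * v)) * ennreal A = ennreal (2 ^ (2 * j + d) / (c1 * t ^ d))"
    using t v A by (subst ennreal_mult'[symmetric]) (auto simp: A_def mult.commute)
  ultimately show ?thesis by (simp add: F_def z mult.assoc[symmetric] d_def)
qed

text \<open>Integrate the submean inequality against \<nu> and exchange the integrals. For fixed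
  \<open>w\<close>, the centres \<open>z\<close> whose neighbourhood contains \<open>w\<close> lie
  in a neighbourhood of \<open>w\<close>, whose \<nu>-measure is controlled by
  \<open>weighted_vol j w\<close>. What remains is the weighted integral of \<open>|f|^q\<close>;
  the exponent never meets the hypothesis on \<nu>.\<close>

lemma carleson_embedding:
  assumes \<nu>: "sets \<nu> = sets borel" "emeasure \<nu> (- \<Omega>) = 0" and c: "0 < c" "c \<le> 1/2" and C: "0 \<le> C"
    and bound: "\<And>a. a \<in> \<Omega> \<Longrightarrow> emeasure \<nu> (circled_nbhd a c) \<le> ennreal (C * weighted_vol j a)"
    and q: "1 < q"
  shows "\<exists>K\<ge>0. \<forall>f. holomorphic_Cn_on f \<Omega> \<longrightarrow>
    (\<integral>\<^sup>+z. indicator \<Omega> z * ennreal (cmod (f z) powr q) \<partial>\<nu>) \<le> ennreal K * (\<integral>\<^sup>+z. ennreal (cmod (f z) powr q) \<partial>wmeasure)"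
proof -
  let ?d = "DIM(complex ^ 'n)"
  \<comment> \<open>Half of \<open>c\<close>, because the symmetry lemma doubles the
    parameter.\<close>
  define t where "t = c / 2"
  have t: "0 < t" "t \<le> 1/4" using c by (auto simp: t_def)
  have sp: "space \<nu> = UNIV" using sets_eq_imp_space_eq[OF \<nu>(1)] by simp
  have open_N: "open (circled_nbhd a s)" if "0 < s" for a s by (rule open_circled_nbhd[OF that])
  interpret \<nu>: sigma_finite_measure \<nu>
  proof
    \<comment> \<open>Fubini requires sigma-finiteness. Countably many of the open sets of finite
      measure already cover \<Omega> by Lindelof's theorem, and the null set
      \<open>- \<Omega>\<close> completes the cover.\<close>
    obtain F' where F': "F' \<subseteq> (\<lambda>a. circled_nbhd a c) ` \<Omega>" "countable F'" "\<Union>F' = \<Union>((\<lambda>a. circled_nbhd a c) ` \<Omega>)"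
      using Lindelof[of "(\<lambda>a. circled_nbhd a c) ` \<Omega>"] open_N c by blast
    have "\<Omega> \<subseteq> \<Union>F'" unfolding F'(3) using circled_nbhd_center by auto
    moreover have "emeasure \<nu> B \<noteq> \<infinity>" if B: "B \<in> F'" for B
    proof -
      obtain a where "a \<in> \<Omega>" "B = circled_nbhd a c" using B F'(1) by blast
      then have "emeasure \<nu> B \<le> ennreal (C * weighted_vol j a)" using bound by auto
      also have "\<dots> < \<infinity>" by simp
      finally show ?thesis by simp
    qed
    ultimately show "\<exists>A. countable A \<and> A \<subseteq> sets \<nu> \<and> \<Union>A = space \<nu> \<and> (\<forall>a\<in>A. emeasure \<nu> a \<noteq> \<infinity>)"
      using F'(1,2) \<nu> c sp
      by (intro exI[of _ "insert (- \<Omega>) F'"]) (auto simp: open_N)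
  qed
  interpret P: pair_sigma_finite \<nu> "lborel :: (complex ^ 'n) measure" ..
  have mcong: "sets (\<nu> \<Otimes>\<^sub>M (lborel :: (complex ^ 'n) measure)) = sets (borel \<Otimes>\<^sub>M borel)"
    by (intro sets_pair_measure_cong) (simp_all add: \<nu>)
  define K where "K = 2 ^ (2 * j + ?d) / (c1 * t ^ ?d)"
  have K: "0 \<le> K" using c1_pos t by (simp add: K_def)
  show ?thesis
  proof (intro exI[of _ "K * C"] conjI allI impI)
    show "0 \<le> K * C" using K C by simp
    fix f assume f: "holomorphic_Cn_on f \<Omega>"
    define F where "F w = ennreal (cmod (indicator \<Omega> w *\<^sub>R f w) powr q)" for w
    have F[measurable]: "F \<in> borel_measurable borel"
      unfolding F_def using borel_measurable_holomorphic_Cn[OF f] by measurable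
    define h where "h w = ennreal (W w / weighted_vol j w) * F w" for w
    have h[measurable]: "h \<in> borel_measurable borel" unfolding h_def by measurable
    have E[measurable]: "{p. snd p \<in> circled_nbhd (fst p) t} \<in> sets (borel \<Otimes>\<^sub>M borel)"
      unfolding borel_prod using open_circled_nbhd_graph[OF t(1)] by simp
    have "(\<lambda>p. indicator {p. snd p \<in> circled_nbhd (fst p) t} p * (indicator \<Omega> (fst p) * h (snd p))) \<in> borel_measurable (borel \<Otimes>\<^sub>M borel)"
      by measurable
    then have H: "(\<lambda>(z, w). indicator (circled_nbhd z t) w * (indicator \<Omega> z * h w)) \<in> borel_measurable (\<nu> \<Otimes>\<^sub>M (lborel :: (complex ^ 'n) measure))"
      unfolding measurable_cong_sets[OF mcong refl] by (simp add: split_beta' indicator_def)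
    have "(\<integral>\<^sup>+z. indicator \<Omega> z * ennreal (cmod (f z) powr q) \<partial>\<nu>)
        \<le> (\<integral>\<^sup>+z. ennreal K * (\<integral>\<^sup>+w. indicator (circled_nbhd z t) w * (indicator \<Omega> z * h w) \<partial>lborel) \<partial>\<nu>)"
    proof (rule nn_integral_mono)
      fix z
      show "indicator \<Omega> z * ennreal (cmod (f z) powr q) \<le> ennreal K * (\<integral>\<^sup>+w. indicator (circled_nbhd z t) w * (indicator \<Omega> z * h w) \<partial>lborel)"
        using submean_wmeasure[OF f _ t q, of z] by (cases "z \<in> \<Omega>") (auto simp: h_def F_def K_def)
    qed
    also have "\<dots> = ennreal K * (\<integral>\<^sup>+z. \<integral>\<^sup>+w. indicator (circled_nbhd z t) w * (indicator \<Omega> z * h w) \<partial>lborel \<partial>\<nu>)"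
      using lborel.borel_measurable_nn_integral_fst[OF H] by (intro nn_integral_cmult) simp
    also have "(\<integral>\<^sup>+z. \<integral>\<^sup>+w. indicator (circled_nbhd z t) w * (indicator \<Omega> z * h w) \<partial>lborel \<partial>\<nu>)
       = (\<integral>\<^sup>+w. \<integral>\<^sup>+z. indicator (circled_nbhd z t) w * (indicator \<Omega> z * h w) \<partial>\<nu> \<partial>lborel)"
      by (rule P.Fubini'[symmetric]) (rule H)
    also have "\<dots> \<le> (\<integral>\<^sup>+w. ennreal C * (indicator \<Omega> w * (ennreal (W w) * F w)) \<partial>lborel)"
    proof (rule nn_integral_mono)
      fix w :: "complex ^ 'n"
      have Nw: "circled_nbhd w c \<in> sets \<nu>" using open_N c \<nu> by auto
      show "(\<integral>\<^sup>+z. indicator (circled_nbhd z t) w * (indicator \<Omega> z * h w) \<partial>\<nu>) \<le> ennreal C * (indicator \<Omega> w * (ennreal (W w) * F w))"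
      proof (cases "w \<in> \<Omega>")
        case True
        \<comment> \<open>Symmetry: \<open>w \<in> circled_nbhd z t\<close> forces
          \<open>z \<in> circled_nbhd w c\<close>.\<close>
        have "(\<integral>\<^sup>+z. indicator (circled_nbhd z t) w * (indicator \<Omega> z * h w) \<partial>\<nu>) \<le> (\<integral>\<^sup>+z. h w * indicator (circled_nbhd w c) z \<partial>\<nu>)"
          using circled_nbhd_sym[of w _ t] t by (intro nn_integral_mono) (auto simp: indicator_def t_def)
        also have "\<dots> = h w * emeasure \<nu> (circled_nbhd w c)"
          using Nw by (simp add: nn_integral_cmult_indicator)
        also have "\<dots> \<le> h w * ennreal (C * weighted_vol j w)"
          using bound[OF True] by (intro mult_left_mono) auto
        also have "\<dots> = ennreal (W w / weighted_vol j w) * ennreal (C * weighted_vol j w) * F w"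
          by (simp add: h_def mult_ac)
        also have "ennreal (W w / weighted_vol j w) * ennreal (C * weighted_vol j w) = ennreal (C * W w)"
          using weighted_vol_pos[OF True, of j] C by (subst ennreal_mult''[symmetric]) (auto simp: mult.commute)
        also have "\<dots> * F w = ennreal C * (indicator \<Omega> w * (ennreal (W w) * F w))"
          using True C by (simp add: ennreal_mult' mult_ac)
        finally show ?thesis .
      next
        case False
        have "indicator (circled_nbhd z t) w * (indicator \<Omega> z * h w) = 0" for z
          using False circled_nbhd_subset_dom[of t z] t by (auto simp: indicator_def)
        then show ?thesis by (simp only: nn_integral_const mult_zero_left zero_le)
      qed
    qed
    also have "\<dots> = ennreal C * (\<integral>\<^sup>+w. F w \<partial>wmeasure)"
      by (simp add: nn_integral_cmult nn_integral_wmeasure)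
    also have "(\<integral>\<^sup>+w. F w \<partial>wmeasure) = (\<integral>\<^sup>+z. ennreal (cmod (f z) powr q) \<partial>wmeasure)"
      by (intro nn_integral_cong) (simp add: space_wmeasure F_def)
    also have "ennreal K * (ennreal C * (\<integral>\<^sup>+z. ennreal (cmod (f z) powr q) \<partial>wmeasure))
       = ennreal (K * C) * (\<integral>\<^sup>+z. ennreal (cmod (f z) powr q) \<partial>wmeasure)"
      using K C by (simp add: ennreal_mult mult.assoc)
    finally show "(\<integral>\<^sup>+z. indicator \<Omega> z * ennreal (cmod (f z) powr q) \<partial>\<nu>) \<le> ennreal (K * C) * (\<integral>\<^sup>+z. ennreal (cmod (f z) powr q) \<partial>wmeasure)"
      by (simp add: mult_left_mono)
  qed
qed

end

section \<open>Support functionals and the McNeal basis\<close>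

lemma herm_add_left: "herm (x + y) z = herm x z + herm y z"
  by (simp add: herm_def sum.distrib algebra_simps)

lemma herm_smult_left: "herm (c *s x) y = c * herm x y"
  by (simp add: herm_def sum_distrib_left mult.assoc)

lemma herm_smult_right: "herm x (c *s y) = cnj c * herm x y"
  by (simp add: herm_def sum_distrib_left mult_ac)

lemma herm_zero_left: "herm 0 y = 0"
  by (simp add: herm_def)

lemma herm_sum_left: "herm (\<Sum>i\<in>I. f i) y = (\<Sum>i\<in>I. herm (f i) y)"
  by (induction I rule: infinite_finite_induct) (simp_all add: herm_zero_left herm_add_left)

lemma inner_eq_Re_herm: "x \<bullet> y = Re (herm x y)"
  by (simp add: herm_def inner_vec_def inner_complex_def)

lemma Re_herm_scaleR_right: "Re (herm x (c *\<^sub>R y)) = c * Re (herm x y)"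
  by (simp add: inner_eq_Re_herm[symmetric])

text \<open>Orthonormal vectors are linearly independent, and \<open>n\<close> of them span by
  dimension; the coefficients are then read off by pairing.\<close>

lemma orthonormal_expansion:
  fixes L :: "nat \<Rightarrow> complex ^ 'n"
  assumes on: "\<And>i j. i \<in> {1..CARD('n)} \<Longrightarrow> j \<in> {1..CARD('n)} \<Longrightarrow> herm (L i) (L j) = (if i = j then 1 else 0)"
  shows "(\<Sum>j=1..CARD('n). herm x (L j) *s L j) = x"
proof -
  let ?I = "{1..CARD('n)}"
  have inj: "inj_on L ?I"
    using on by (intro inj_onI) (metis zero_neq_one)
  have coeff: "herm (\<Sum>j\<in>?I. u j *s L j) (L i) = u i" if "i \<in> ?I" for u i
    using that on by (simp add: herm_sum_left herm_smult_left if_distrib[of "(*) _"] cong: if_cong)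
  have "\<not> vec.dependent (L ` ?I)"
  proof (rule vec.independent_if_scalars_zero)
    fix f x assume s: "(\<Sum>x\<in>L ` ?I. f x *s x) = 0" and x: "x \<in> L ` ?I"
    then obtain i where i: "i \<in> ?I" "x = L i" by auto
    have "(\<Sum>j\<in>?I. f (L j) *s L j) = 0" using s inj by (simp add: sum.reindex)
    then show "f x = 0" using coeff[OF i(1), of "\<lambda>j. f (L j)"] i(2) by (simp add: herm_zero_left)
  qed simp
  then have "(UNIV :: (complex ^ 'n) set) \<subseteq> vec.span (L ` ?I)"
    using inj by (intro vec.card_ge_dim_independent) (auto simp: card_image vec_dim_card simp del: vec.dim_UNIV)
  then have "x \<in> vec.span (L ` ?I)" by auto
  then obtain u where "x = (\<Sum>y\<in>L ` ?I. u y *s y)"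
    unfolding vec.span_finite[OF finite_imageI[OF finite_atLeastAtMost]] by auto
  then have "x = (\<Sum>j\<in>?I. u (L j) *s L j)" using inj by (simp add: sum.reindex)
  then show ?thesis using coeff[of _ "\<lambda>j. u (L j)"] by simp
qed

text \<open>Test with \<xi> of phase \<open>cnj h / |h|\<close> and modulus strictly between
  \<open>1/|h|\<close> and \<open>t\<close>. In this way a real supporting half-space gives a bound
  on the modulus of a complex functional.\<close>

lemma cmod_le_if_Re_rotations_le:
  assumes "\<And>\<xi>. cmod \<xi> < t \<Longrightarrow> Re (\<xi> * h) \<le> 1"
  shows "t * cmod h \<le> 1"
proof (rule ccontr)
  assume "\<not> t * cmod h \<le> 1"
  then have gt: "1 < t * cmod h" by simp
  then have h: "0 < cmod h" by (cases "h = 0") auto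
  then obtain s where s: "1 / cmod h < s" "s < t"
    using gt dense[of "1 / cmod h" t] by (auto simp: field_simps)
  then have "0 < s" using h order.strict_trans[of 0 "1 / cmod h" s] by simp
  then have "cmod (of_real s * cnj h / of_real (cmod h)) < t" using h s by (simp add: norm_mult norm_divide)
  from assms[OF this] have "Re (of_real s * (cnj h * h) / of_real (cmod h)) \<le> 1" by (simp add: mult.assoc)
  also have "of_real s * (cnj h * h) / of_real (cmod h) = complex_of_real (s * cmod h)"
    using h by (simp add: mult.commute[of "cnj h"] complex_norm_square[symmetric] power2_eq_square)
  finally have "s * cmod h \<le> 1" by simp
  then show False using s h by (simp add: field_simps)
qed

context convex_domain
begin

text \<open>A separating hyperplane, rescaled. The ball about \<open>a\<close> in \<Omega> shows
  that the separation of \<open>a\<close> from \<open>p\<close> is strict, so the functional can be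
  normalised to the value 1 at \<open>p\<close>.\<close>

lemma support_functional:
  assumes a: "a \<in> \<Omega>" and p: "p \<notin> \<Omega>"
  obtains q where "Re (herm (p - a) q) = 1" "\<And>z. z \<in> \<Omega> \<Longrightarrow> Re (herm (z - a) q) \<le> 1"
proof -
  obtain w b where w: "w \<noteq> 0" "\<forall>x\<in>\<Omega>. w \<bullet> x \<le> b" "\<forall>x\<in>{p}. b \<le> w \<bullet> x"
    using separating_hyperplane_sets[of \<Omega> "{p}"] convex_dom a p by auto
  obtain e where e: "0 < e" "ball a e \<subseteq> \<Omega>" using open_dom a by (auto simp: open_contains_ball)
  have "a + (e / 2 / norm w) *\<^sub>R w \<in> ball a e" using e w(1) by (simp add: dist_norm)
  then have "w \<bullet> (a + (e / 2 / norm w) *\<^sub>R w) \<le> b" using e w(2) by blast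
  moreover have "0 < w \<bullet> ((e / 2 / norm w) *\<^sub>R w)" using e w(1) by simp
  ultimately have "w \<bullet> a < w \<bullet> p" using w(3) by (simp add: inner_add_right)
  then have pos: "0 < w \<bullet> (p - a)" by (simp add: inner_diff_right)
  show ?thesis
  proof
    show "Re (herm (p - a) ((1 / (w \<bullet> (p - a))) *\<^sub>R w)) = 1"
      unfolding Re_herm_scaleR_right inner_eq_Re_herm[symmetric] using pos by (simp add: inner_commute)
    fix z assume "z \<in> \<Omega>"
    then have "w \<bullet> (z - a) \<le> w \<bullet> (p - a)" using w(2,3) by (simp add: inner_diff_right) (meson order_trans)
    then show "Re (herm (z - a) ((1 / (w \<bullet> (p - a))) *\<^sub>R w)) \<le> 1"
      unfolding Re_herm_scaleR_right inner_eq_Re_herm[symmetric] using pos by (simp add: inner_commute)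
  qed
qed

text \<open>The parameters \<xi> with \<open>a + \<xi> *s v\<close> outside \<Omega> form a closed
  set, nonempty since \<Omega> is bounded. If \<xi>0 is one of least modulus, the set under the
  supremum is exactly the interval from 0, exclusive, to \<open>cmod \<xi>0\<close>,
  inclusive.\<close>

lemma disc_radius_attained:
  assumes a: "a \<in> \<Omega>" and v: "v \<noteq> 0"
  shows "0 < disc_radius \<Omega> a v"
    and "cmod \<xi> < disc_radius \<Omega> a v \<Longrightarrow> a + \<xi> *s v \<in> \<Omega>"
    and "\<exists>\<xi>. cmod \<xi> = disc_radius \<Omega> a v \<and> a + \<xi> *s v \<notin> \<Omega>"
proof -
  define S where "S = (\<lambda>\<xi>. a + \<xi> *s v) -` (- \<Omega>)"
  have "closed S" unfolding S_def vector_scalar_mult_def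
    using open_dom by (intro continuous_closed_vimage continuous_intros) auto
  obtain B where B: "\<And>x. x \<in> \<Omega> \<Longrightarrow> norm x \<le> B" using bounded_dom by (auto simp: bounded_iff)
  have "of_real ((B + norm a + 1) / norm v) \<in> S"
  proof (rule ccontr)
    assume "of_real ((B + norm a + 1) / norm v) \<notin> S"
    then have "norm (a + of_real ((B + norm a + 1) / norm v) *s v) \<le> B" by (intro B) (simp add: S_def)
    moreover have "0 \<le> B" using B[OF a] norm_ge_zero order_trans by blast
    then have "norm (of_real ((B + norm a + 1) / norm v) *s v) = B + norm a + 1"
      using v by (subst norm_vector_smult) (simp add: norm_divide del: of_real_add of_real_divide)
    ultimately show False
      using norm_triangle_ineq2[of "of_real ((B + norm a + 1) / norm v) *s v" "-a"] by (simp add: add.commute)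
  qed
  then have "S \<noteq> {}" by auto
  obtain \<xi>0 where \<xi>0: "\<xi>0 \<in> S" "\<And>\<xi>. \<xi> \<in> S \<Longrightarrow> dist 0 \<xi>0 \<le> dist 0 \<xi>"
    using distance_attains_inf[OF \<open>closed S\<close> \<open>S \<noteq> {}\<close>, of 0] by blast
  have "\<xi>0 \<noteq> 0" using \<xi>0(1) a by (auto simp: S_def)
  have "{s. s > 0 \<and> (\<forall>\<xi>::complex. cmod \<xi> < s \<longrightarrow> a + \<xi> *s v \<in> \<Omega>)} = {0<..cmod \<xi>0}"
    using \<xi>0 by (fastforce simp: S_def not_le[symmetric])
  then have d: "disc_radius \<Omega> a v = cmod \<xi>0"
    using \<open>\<xi>0 \<noteq> 0\<close> by (simp add: disc_radius_def)
  show "0 < disc_radius \<Omega> a v" using d \<open>\<xi>0 \<noteq> 0\<close> by simp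
  show "cmod \<xi> < disc_radius \<Omega> a v \<Longrightarrow> a + \<xi> *s v \<in> \<Omega>" using \<xi>0(2)[of \<xi>] by (auto simp: d S_def)
  show "\<exists>\<xi>. cmod \<xi> = disc_radius \<Omega> a v \<and> a + \<xi> *s v \<notin> \<Omega>" using \<xi>0(1) d by (auto simp: S_def)
qed

text \<open>At a contact point of \<open>\<partial>\<Omega>\<close> with a ball inside a complex subspace, the support
  functional vanishes on the tangential directions of that subspace.\<close>

lemma support_functional_tangential:
  assumes a: "a \<in> \<Omega>" and \<tau>: "0 < \<tau>"
    and ball: "\<And>v. norm v < \<tau> \<Longrightarrow> v \<in> V \<Longrightarrow> a + v \<in> \<Omega>"
    and V: "\<And>c d. c *s x + d *s y \<in> V"
    and xy: "herm x x = 1" "herm y y = 1" "herm x y = 0" "herm y x = 0"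
    and q: "Re (herm (\<xi> *s x) q) = 1" "\<And>z. z \<in> \<Omega> \<Longrightarrow> Re (herm (z - a) q) \<le> 1" and \<xi>: "cmod \<xi> = \<tau>"
  shows "herm y q = 0"
proof -
  define b where "b = cmod (herm y q)"
  \<comment> \<open>The contact vector is tilted along \<open>y\<close> with the phase that makes
    the gain real. With \<open>X = \<tau>^2 b^2\<close> the functional grows to
    \<open>1 + X\<close>, while the length grows only to \<tau> times the square root of
    \<open>1 + X\<close>. Shrinking \<open>v\<close> into the ball gives
    \<open>(1 + X)^2 \<le> 1 + X\<close>, hence \<open>X = 0\<close>.\<close>
  define v where "v = \<xi> *s x + (of_real (\<tau>\<^sup>2) * cnj (herm y q)) *s y"
  have hv: "Re (herm v q) = 1 + \<tau>\<^sup>2 * b\<^sup>2"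
    using q(1) unfolding v_def b_def cmod_power2
    by (simp add: herm_add_left herm_smult_left power2_eq_square algebra_simps)
  have xy': "norm x = 1" "norm y = 1" using xy by (simp_all add: norm_eq_sqrt_inner inner_eq_Re_herm)
  have "orthogonal (\<xi> *s x) ((of_real (\<tau>\<^sup>2) * cnj (herm y q)) *s y)"
    by (simp add: orthogonal_def inner_eq_Re_herm herm_smult_left herm_smult_right xy(3))
  then have "(norm v)\<^sup>2 = (norm (\<xi> *s x))\<^sup>2 + (norm ((of_real (\<tau>\<^sup>2) * cnj (herm y q)) *s y))\<^sup>2"
    unfolding v_def by (rule norm_add_Pythagorean)
  also have "\<dots> = \<tau>\<^sup>2 + (\<tau>\<^sup>2 * b)\<^sup>2"
    using xy' by (simp add: norm_vector_smult \<xi> b_def norm_mult norm_power)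
  finally have nv: "(norm v)\<^sup>2 = \<tau>\<^sup>2 + (\<tau>\<^sup>2 * b)\<^sup>2" .
  have "0 < (norm v)\<^sup>2" unfolding nv using \<tau> by (intro add_pos_nonneg) auto
  then have "0 < norm v" by simp
  have le: "s * Re (herm v q) \<le> 1" if s: "0 < s" "s < \<tau> / norm v" for s
  proof -
    have "a + s *\<^sub>R v \<in> \<Omega>"
    proof (rule ball)
      show "norm (s *\<^sub>R v) < \<tau>" using s \<open>0 < norm v\<close> by (simp add: field_simps)
      have "s *\<^sub>R v = (of_real s * \<xi>) *s x + (of_real s * (of_real (\<tau>\<^sup>2) * cnj (herm y q))) *s y"
        unfolding v_def vec_smult_of_real[symmetric] by (simp add: vector_add_ldistrib vector_smult_assoc)
      then show "s *\<^sub>R v \<in> V" using V by simp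
    qed
    from q(2)[OF this] show ?thesis
      unfolding vec_smult_of_real[symmetric] by (simp add: herm_smult_left)
  qed
  have "Re (herm v q) \<le> norm v / \<tau>"
  proof (rule ccontr)
    assume c: "\<not> ?thesis"
    have "0 \<le> norm v / \<tau>" using \<tau> by simp
    with c have pos: "0 < Re (herm v q)" by linarith
    have "1 / Re (herm v q) < \<tau> / norm v" using c pos \<tau> \<open>0 < norm v\<close> by (simp add: field_simps)
    then obtain s where s: "1 / Re (herm v q) < s" "s < \<tau> / norm v" using dense by blast
    moreover have "0 < s" using s(1) pos order.strict_trans[of 0 "1 / Re (herm v q)" s] by simp
    ultimately show False using le[of s] pos by (simp add: field_simps)
  qed
  then have "\<tau> * (1 + \<tau>\<^sup>2 * b\<^sup>2) \<le> norm v" using \<tau> hv by (simp add: field_simps)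
  then have "(\<tau> * (1 + \<tau>\<^sup>2 * b\<^sup>2))\<^sup>2 \<le> (norm v)\<^sup>2" using \<tau> by (intro power_mono) auto
  then have "\<tau>\<^sup>2 * (1 + \<tau>\<^sup>2 * b\<^sup>2)\<^sup>2 \<le> \<tau>\<^sup>2 * (1 + \<tau>\<^sup>2 * b\<^sup>2)"
    unfolding nv by (simp add: power_mult_distrib algebra_simps power2_eq_square)
  then have "(1 + \<tau>\<^sup>2 * b\<^sup>2)\<^sup>2 \<le> 1 + \<tau>\<^sup>2 * b\<^sup>2" using \<tau> by simp
  then have "(1 + \<tau>\<^sup>2 * b\<^sup>2) * (\<tau>\<^sup>2 * b\<^sup>2) \<le> 0" by (simp add: power2_eq_square algebra_simps)
  moreover have "0 \<le> \<tau>\<^sup>2 * b\<^sup>2" by simp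
  ultimately have "\<tau>\<^sup>2 * b\<^sup>2 = 0" by (auto simp: mult_le_0_iff)
  then show ?thesis using \<tau> by (simp add: b_def)
qed


text \<open>Take \<open>q j\<close> supporting \<Omega> at a contact point of the disc in direction
  \<open>L j\<close>. The matrix of the values \<open>herm (L i) (q j)\<close> vanishes for
  \<open>i > j\<close>, has diagonal entries of modulus at least \<open>1/\<tau> j\<close>, and
  other entries at most \<open>1/\<tau> i\<close>. Forward substitution then recovers the
  coordinates from the functionals; each stage at most doubles the bound, whence
  \<open>2^j\<close>.\<close>

lemma triangular_support_functionals:
  assumes a: "a \<in> \<Omega>"
    and on: "\<And>i j. i \<in> {1..CARD('n)} \<Longrightarrow> j \<in> {1..CARD('n)} \<Longrightarrow> herm (L i) (L j) = (if i = j then 1 else 0)"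
    and ball: "\<And>j v. j \<in> {1..CARD('n)} \<Longrightarrow> norm v < disc_radius \<Omega> a (L j) \<Longrightarrow> \<forall>i\<in>{1..<j}. herm v (L i) = 0 \<Longrightarrow> a + v \<in> \<Omega>"
  obtains q where "\<And>j z. j \<in> {1..CARD('n)} \<Longrightarrow> z \<in> \<Omega> \<Longrightarrow> Re (herm (z - a) (q j)) \<le> 1"
    and "\<And>v R j. (\<And>j. j \<in> {1..CARD('n)} \<Longrightarrow> cmod (herm v (q j)) \<le> R) \<Longrightarrow> j \<in> {1..CARD('n)} \<Longrightarrow>
      cmod (herm v (L j)) \<le> R * 2 ^ j * disc_radius \<Omega> a (L j)"
proof -
  let ?I = "{1..CARD('n)}"
  define \<tau> where "\<tau> j = disc_radius \<Omega> a (L j)" for j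
  have L0: "L j \<noteq> 0" if "j \<in> ?I" for j using on[OF that that] by (auto simp: herm_zero_left)
  have \<tau>: "0 < \<tau> j" if "j \<in> ?I" for j unfolding \<tau>_def by (rule disc_radius_attained(1)[OF a L0[OF that]])
  have disc: "a + \<xi> *s L j \<in> \<Omega>" if "j \<in> ?I" "cmod \<xi> < \<tau> j" for j \<xi>
    using disc_radius_attained(2)[OF a L0[OF that(1)]] that(2) unfolding \<tau>_def by blast
  have "\<exists>\<xi> q. cmod \<xi> = \<tau> j \<and> Re (herm (\<xi> *s L j) q) = 1 \<and> (\<forall>z\<in>\<Omega>. Re (herm (z - a) q) \<le> 1)" if j: "j \<in> ?I" for j
  proof -
    obtain \<xi> where \<xi>: "cmod \<xi> = \<tau> j" "a + \<xi> *s L j \<notin> \<Omega>"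
      using disc_radius_attained(3)[OF a L0[OF j]] unfolding \<tau>_def by blast
    obtain q where "Re (herm (a + \<xi> *s L j - a) q) = 1" "\<And>z. z \<in> \<Omega> \<Longrightarrow> Re (herm (z - a) q) \<le> 1"
      using support_functional[OF a \<xi>(2)] by blast
    with \<xi>(1) show ?thesis by auto
  qed
  then obtain \<xi> q where \<xi>q: "\<And>j. j \<in> ?I \<Longrightarrow> cmod (\<xi> j) = \<tau> j" "\<And>j. j \<in> ?I \<Longrightarrow> Re (herm (\<xi> j *s L j) (q j)) = 1"
    "\<And>j z. j \<in> ?I \<Longrightarrow> z \<in> \<Omega> \<Longrightarrow> Re (herm (z - a) (q j)) \<le> 1"
    by metis
  \<comment> \<open>The subspace is the orthogonal complement of \<open>L 1\<close>, ...,
    \<open>L (j - 1)\<close>. The hypothesis \<open>ball\<close> puts its ball of radius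
    \<open>\<tau> j\<close> inside \<Omega>, so \<open>q j\<close> can only see the direction of
    contact.\<close>
  have lower: "herm (L i) (q j) = 0" if ij: "i \<in> ?I" "j \<in> ?I" "j < i" for i j
  proof (rule support_functional_tangential[OF a \<tau>[OF ij(2)], where V = "{v. \<forall>i\<in>{1..<j}. herm v (L i) = 0}" and x = "L j"])
    show "a + v \<in> \<Omega>" if "norm v < \<tau> j" "v \<in> {v. \<forall>i\<in>{1..<j}. herm v (L i) = 0}" for v
      using that ball[OF ij(2)] by (auto simp: \<tau>_def)
    show "c *s L j + d *s L i \<in> {v. \<forall>i\<in>{1..<j}. herm v (L i) = 0}" for c d
      using ij on by (auto simp: herm_add_left herm_smult_left)
    show "Re (herm (\<xi> j *s L j) (q j)) = 1" "cmod (\<xi> j) = \<tau> j" using \<xi>q ij by auto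
    show "Re (herm (z - a) (q j)) \<le> 1" if "z \<in> \<Omega>" for z using \<xi>q(3) that ij by auto
  qed (use on ij in auto)
  have upper: "\<tau> i * cmod (herm (L i) (q j)) \<le> 1" if ij: "i \<in> ?I" "j \<in> ?I" for i j
  proof (rule cmod_le_if_Re_rotations_le)
    fix \<xi> assume "cmod \<xi> < \<tau> i"
    from \<xi>q(3)[OF ij(2) disc[OF ij(1) this]] show "Re (\<xi> * herm (L i) (q j)) \<le> 1"
      by (simp add: herm_smult_left)
  qed
  have diag: "1 \<le> \<tau> j * cmod (herm (L j) (q j))" if j: "j \<in> ?I" for j
    using complex_Re_le_cmod[of "herm (\<xi> j *s L j) (q j)"] \<xi>q(1,2)[OF j] by (simp add: herm_smult_left norm_mult)
  have bound: "cmod (herm v (L j)) \<le> R * 2 ^ j * \<tau> j"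
    if v: "\<And>j. j \<in> ?I \<Longrightarrow> cmod (herm v (q j)) \<le> R" and j: "j \<in> ?I" for v R j
    using j
  proof (induction j rule: less_induct)
    case (less j)
    note j = less.prems
    have R: "0 \<le> R" using v[OF j] norm_ge_zero order_trans by blast
    let ?t = "\<lambda>i. herm v (L i) * herm (L i) (q j)"
    have "herm v (q j) = (\<Sum>i\<in>?I. ?t i)"
      by (subst orthonormal_expansion[OF on, of v, symmetric]) (simp_all add: herm_sum_left herm_smult_left)
    also have "\<dots> = (\<Sum>i\<in>{1..j}. ?t i)"
      using lower j by (intro sum.mono_neutral_right) auto
    also have "\<dots> = (\<Sum>i\<in>{1..<j}. ?t i) + ?t j"
      using j by (subst sum.last_plus) (auto simp: atLeastLessThanSuc_atLeastAtMost add.commute)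
    finally have "cmod (?t j) \<le> cmod (herm v (q j)) + cmod (\<Sum>i\<in>{1..<j}. ?t i)"
      by (metis add_diff_cancel_left' norm_triangle_ineq4)
    also have "cmod (\<Sum>i\<in>{1..<j}. ?t i) \<le> (\<Sum>i\<in>{1..<j}. R * 2 ^ i)"
    proof (rule sum_norm_le)
      fix i assume i: "i \<in> {1..<j}"
      then have iI: "i \<in> ?I" using j by auto
      have "cmod (?t i) \<le> R * 2 ^ i * \<tau> i * cmod (herm (L i) (q j))"
        unfolding norm_mult using less.IH[of i] i iI by (intro mult_right_mono) auto
      also have "\<dots> \<le> R * 2 ^ i * 1" unfolding mult.assoc
        using upper[OF iI j] R by (intro mult_left_mono) auto
      finally show "cmod (?t i) \<le> R * 2 ^ i" by simp
    qed
    \<comment> \<open>The subtracted \<open>R\<close> is the term \<open>i = 0\<close>; it later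
      absorbs the bound \<open>R\<close> for \<open>herm v (q j)\<close>.\<close>
    also have "(\<Sum>i\<in>{1..<j}. R * 2 ^ i) \<le> (\<Sum>i\<in>{0..<j}. R * 2 ^ i) - R"
      using j R by (subst (2) sum.atLeast_Suc_lessThan) auto
    also have "(\<Sum>i\<in>{0..<j}. R * 2 ^ i) = R * (2 ^ j - 1)"
      by (simp add: sum_distrib_left[symmetric] atLeast0LessThan) (simp add: sum_gp_strict)
    finally have *: "cmod (?t j) \<le> R * 2 ^ j" using v[OF j] R by (simp add: algebra_simps)
    have "cmod (herm v (L j)) * 1 \<le> cmod (herm v (L j)) * (\<tau> j * cmod (herm (L j) (q j)))"
      using diag[OF j] by (intro mult_left_mono) auto
    also have "\<dots> = \<tau> j * cmod (?t j)" by (simp add: norm_mult)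
    also have "\<dots> \<le> \<tau> j * (R * 2 ^ j)" using * \<tau>[OF j] by (intro mult_left_mono) auto
    finally show ?case by (simp add: mult_ac)
  qed
  show ?thesis using that[of q] \<xi>q(3) bound unfolding \<tau>_def by blast
qed

text \<open>The vector is the average of the \<open>n\<close> vectors obtained by multiplying its
  components along the \<open>L j\<close> by \<open>n\<close>, and each of these stays in the disc
  of its own direction. The factor 2 makes the inequality for the open discs strict.\<close>

lemma circled_nbhd_if_coords_le:
  assumes a: "a \<in> \<Omega>"
    and on: "\<And>i j. i \<in> {1..CARD('n)} \<Longrightarrow> j \<in> {1..CARD('n)} \<Longrightarrow> herm (L i) (L j) = (if i = j then 1 else 0)"
    and le: "\<And>j. j \<in> {1..CARD('n)} \<Longrightarrow> cmod (herm v (L j)) \<le> \<rho> * disc_radius \<Omega> a (L j)" and \<rho>: "0 < \<rho>"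
  shows "a + v \<in> circled_nbhd a (2 * real CARD('n) * \<rho>)"
  unfolding circled_nbhd_def
proof safe
  fix \<xi> assume \<xi>: "cmod \<xi> * (2 * real CARD('n) * \<rho>) \<le> 1"
  let ?I = "{1..CARD('n)}"
  let ?n = "real CARD('n)"
  have n: "0 < ?n" by simp
  have "a + (of_real ?n * \<xi> * herm v (L j)) *s L j \<in> \<Omega>" if j: "j \<in> ?I" for j
  proof -
    have L0: "L j \<noteq> 0" using on[OF j j] by (auto simp: herm_zero_left)
    have pos: "0 < disc_radius \<Omega> a (L j)" by (rule disc_radius_attained(1)[OF a L0])
    have "cmod (of_real ?n * \<xi> * herm v (L j)) \<le> ?n * cmod \<xi> * (\<rho> * disc_radius \<Omega> a (L j))"
      unfolding norm_mult using le[OF j] by (simp add: mult_left_mono)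
    also have "\<dots> = (cmod \<xi> * (2 * ?n * \<rho>)) * (disc_radius \<Omega> a (L j) / 2)" by simp
    also have "\<dots> \<le> 1 * (disc_radius \<Omega> a (L j) / 2)" using \<xi> pos by (intro mult_right_mono) auto
    also have "\<dots> < disc_radius \<Omega> a (L j)" using pos by simp
    finally show ?thesis by (rule disc_radius_attained(2)[OF a L0])
  qed
  then have "(\<Sum>j\<in>?I. (1 / ?n) *\<^sub>R (a + (of_real ?n * \<xi> * herm v (L j)) *s L j)) \<in> \<Omega>"
    using convex_dom by (intro convex_sum) auto
  also have "(\<Sum>j\<in>?I. (1 / ?n) *\<^sub>R (a + (of_real ?n * \<xi> * herm v (L j)) *s L j))
      = (\<Sum>j\<in>?I. (1 / ?n) *\<^sub>R a) + (\<Sum>j\<in>?I. \<xi> *s (herm v (L j) *s L j))"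
    unfolding sum.distrib[symmetric]
    by (intro sum.cong refl) (simp add: vec_smult_of_real[symmetric] vector_add_ldistrib vector_smult_assoc)
  also have "(\<Sum>j\<in>?I. (1 / ?n) *\<^sub>R a) = a" unfolding sum_constant_scaleR by simp
  also have "(\<Sum>j\<in>?I. \<xi> *s (herm v (L j) *s L j)) = \<xi> *s v"
    using orthonormal_expansion[OF on, of v] vec.scale_sum_right[of \<xi> _ ?I] by metis
  finally show "a + \<xi> *s (a + v - a) \<in> \<Omega>" by simp
qed

end

section \<open>The normal direction and the largest inscribed ball\<close>

lemma GDERIV_grad:
  fixes f :: "'a::euclidean_space \<Rightarrow> real"
  assumes "f differentiable (at x)"
  shows "GDERIV f x :> grad f x"
proof -
  obtain f' where f': "(f has_derivative f') (at x)" using assms by (auto simp: differentiable_def)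
  then interpret bounded_linear f' by (rule has_derivative_bounded_linear)
  have "f' = (\<lambda>h. h \<bullet> (\<Sum>b\<in>Basis. f' b *\<^sub>R b))"
  proof
    fix h
    have "f' h = f' (\<Sum>b\<in>Basis. (h \<bullet> b) *\<^sub>R b)" by (simp add: euclidean_representation)
    then show "f' h = h \<bullet> (\<Sum>b\<in>Basis. f' b *\<^sub>R b)" by (simp add: sum scaleR inner_sum_right mult.commute)
  qed
  with f' have D: "GDERIV f x :> (\<Sum>b\<in>Basis. f' b *\<^sub>R b)" unfolding gderiv_def by simp
  have "D' = (\<Sum>b\<in>Basis. f' b *\<^sub>R b)" if "GDERIV f x :> D'" for D'
  proof -
    have "(\<lambda>h. h \<bullet> D') = (\<lambda>h. h \<bullet> (\<Sum>b\<in>Basis. f' b *\<^sub>R b))"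
      using that D unfolding gderiv_def by (rule has_derivative_unique)
    then show ?thesis by (metis vector_eq_ldot)
  qed
  with D show ?thesis unfolding grad_def by (rule theI)
qed

context convex_domain
begin

text \<open>A connected set that meets both \<Omega> and its complement meets the frontier, which is
  too far away.\<close>

lemma ball_frontier_dist_subset:
  assumes "a \<in> \<Omega>" shows "ball a (infdist a (frontier \<Omega>)) \<subseteq> \<Omega>"
proof (rule ccontr)
  assume *: "\<not> ?thesis"
  then have "0 < infdist a (frontier \<Omega>)" by (metis ball_eq_empty empty_subsetI not_le)
  then have "a \<in> ball a (infdist a (frontier \<Omega>)) \<inter> \<Omega>" using assms by simp
  then have "ball a (infdist a (frontier \<Omega>)) \<inter> \<Omega> \<noteq> {}" by blast
  then have "ball a (infdist a (frontier \<Omega>)) \<inter> frontier \<Omega> \<noteq> {}"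
    using * by (intro connected_Int_frontier) auto
  then obtain y where "y \<in> frontier \<Omega>" "dist a y < infdist a (frontier \<Omega>)" by auto
  then show False using infdist_le[of y "frontier \<Omega>" a] by simp
qed

text \<open>The gradient at the nearest boundary point \<open>w\<close> is a positive multiple of
  \<open>w - a\<close>, so the disc in the complex normal direction reaches \<open>w\<close> at a
  parameter of modulus \<delta>. Its radius is therefore at most \<delta>, and the ball of radius
  \<delta> about \<open>a\<close> lies in \<Omega>.\<close>

lemma normal_disc_radius_ball:
  assumes \<Omega>: "\<Omega> = {z. r z < 0}" and diff: "r differentiable (at w)"
    and a: "a \<in> \<Omega>" and w: "is_nearest_bdry_point \<Omega> a w"
    and u: "u = c *s grad r w" "norm u = 1"
    and v: "norm v < disc_radius \<Omega> a u"
  shows "a + v \<in> \<Omega>"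
proof -
  define \<delta> where "\<delta> = infdist a (frontier \<Omega>)"
  define D where "D = grad r w"
  have w': "w \<in> frontier \<Omega>" "norm (w - a) = \<delta>"
    using w by (auto simp: is_nearest_bdry_point_def \<delta>_def dist_norm norm_minus_commute)
  have w_out: "w \<notin> \<Omega>" and w_cl: "w \<in> closure \<Omega>"
    using w'(1) open_dom by (auto simp: frontier_def interior_open)
  have ball: "ball a \<delta> \<subseteq> \<Omega>" unfolding \<delta>_def by (rule ball_frontier_dist_subset[OF a])
  have \<delta>: "0 < \<delta>" using w'(2) w_out a by (metis norm_eq_zero right_minus_eq norm_ge_zero less_le)
  have D0: "D \<noteq> 0" using u by (auto simp: D_def)
  \<comment> \<open>The tangent half-space at \<open>w\<close> contains \<Omega>: otherwise
    \<open>r\<close> would increase strictly from \<open>r w \<ge> 0\<close> towards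
    \<open>z\<close>, although the segment from \<open>w\<close> to \<open>z\<close> enters the
    interior at once.\<close>
  have le: "(z - w) \<bullet> D \<le> 0" if z: "z \<in> \<Omega>" for z
  proof (rule ccontr)
    assume "\<not> ?thesis"
    then have pos: "0 < (z - w) \<bullet> D" by simp
    have "((\<lambda>t. r (w + t *\<^sub>R (z - w))) has_derivative (\<lambda>t. (t *\<^sub>R (z - w)) \<bullet> D)) (at 0)"
    proof -
      have 1: "((\<lambda>t. w + t *\<^sub>R (z - w)) has_derivative (\<lambda>t. t *\<^sub>R (z - w))) (at 0)"
        by (auto intro!: derivative_eq_intros)
      have "(r has_derivative (\<lambda>h. h \<bullet> D)) (at (w + 0 *\<^sub>R (z - w)))"
        using GDERIV_grad[OF diff] by (simp add: gderiv_def D_def)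
      from has_derivative_compose[OF 1 this] show ?thesis .
    qed
    then have "((\<lambda>t. r (w + t *\<^sub>R (z - w))) has_real_derivative (z - w) \<bullet> D) (at 0)"
      by (simp add: has_field_derivative_def mult_commute_abs)
    from has_real_derivative_pos_inc_right[OF has_field_derivative_at_within[OF this, of UNIV] pos]
    obtain d where d: "0 < d" "\<And>h. 0 < h \<Longrightarrow> h < d \<Longrightarrow> r w < r (w + h *\<^sub>R (z - w))" by auto
    define h where "h = min 1 (d / 2)"
    have h: "0 < h" "h \<le> 1" "h < d" using d(1) by (auto simp: h_def)
    have "w - h *\<^sub>R (w - z) \<in> interior \<Omega>"
      using convex_dom open_dom z w_cl h by (intro mem_interior_closure_convex_shrink) (auto simp: interior_open)
    then have "r (w + h *\<^sub>R (z - w)) < 0"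
      using open_dom \<Omega> by (simp add: interior_open algebra_simps)
    moreover have "0 \<le> r w" using w_out \<Omega> by simp
    ultimately show False using d(2)[OF h(1,3)] by simp
  qed
  \<comment> \<open>The inscribed ball lies in the half-space, which forces equality in the
    Cauchy-Schwarz inequality. The factor \<open>s < 1\<close> keeps the test point in the open
    ball.\<close>
  have "norm (w - a) * norm D \<le> (w - a) \<bullet> D"
  proof (rule field_le_mult_one_interval)
    fix s :: real assume s: "0 < s" "s < 1"
    have "a + (s * \<delta> / norm D) *\<^sub>R D \<in> ball a \<delta>" using s \<delta> D0 by (simp add: dist_norm)
    with ball have "(a + (s * \<delta> / norm D) *\<^sub>R D - w) \<bullet> D \<le> 0" by (intro le) auto
    moreover have "(a + (s * \<delta> / norm D) *\<^sub>R D - w) \<bullet> D = s * \<delta> / norm D * (D \<bullet> D) - (w - a) \<bullet> D"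
      by (simp add: inner_diff_left inner_add_left)
    moreover have "s * \<delta> / norm D * (D \<bullet> D) = s * (\<delta> * norm D)"
      using D0 by (simp add: power2_norm_eq_inner[symmetric] power2_eq_square)
    ultimately show "s * (norm (w - a) * norm D) \<le> (w - a) \<bullet> D" by (simp add: w'(2))
  qed
  then have "(w - a) \<bullet> D = norm (w - a) * norm D"
    using norm_cauchy_schwarz[of "w - a" D] by simp
  then have "\<delta> *\<^sub>R D = norm D *\<^sub>R (w - a)" using norm_cauchy_schwarz_eq[of "w - a" D] by (simp add: w'(2))
  then have "(1 / norm D) *\<^sub>R (norm D *\<^sub>R (w - a)) = (1 / norm D) *\<^sub>R (\<delta> *\<^sub>R D)" by simp
  then have wa: "w - a = (\<delta> / norm D) *\<^sub>R D" using D0 by simp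
  have c: "cmod c * norm D = 1" using u by (simp add: D_def norm_vector_smult)
  then have c0: "c \<noteq> 0" by auto
  define \<xi> where "\<xi> = of_real (\<delta> / norm D) / c"
  have "\<xi> *s u = w - a"
    unfolding wa u(1) D_def[symmetric] vec_smult_of_real[symmetric] \<xi>_def using c0 by (simp add: vector_smult_assoc)
  moreover have "cmod \<xi> = \<delta>"
    using c \<delta> D0 by (simp add: \<xi>_def norm_divide norm_mult mult.commute)
  ultimately have "disc_radius \<Omega> a u \<le> \<delta>"
    using disc_radius_attained(2)[OF a, of u \<xi>] u(2) w_out by (force simp: not_le[symmetric])
  then have "a + v \<in> ball a \<delta>" using v by (simp add: dist_norm)
  then show ?thesis using ball by blast
qed

text \<open>For \<open>j \<ge> 2\<close>, minimality makes the disc in direction \<open>L j\<close>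
  the smallest in its subspace, so every shorter vector there is covered by its own disc. The first
  direction is not chosen by minimality but as the normal, and the inscribed ball takes
  over.\<close>

lemma mcneal_basis_ball:
  assumes \<Omega>: "\<Omega> = {z. r z < 0}" and diff: "\<And>w. r differentiable (at w)"
    and a: "a \<in> \<Omega>" and ex1: "\<exists>!w. is_nearest_bdry_point \<Omega> a w" and L: "mcneal_basis \<Omega> r a L"
    and j: "j \<in> {1..CARD('n)}" and v: "norm v < disc_radius \<Omega> a (L j)" "\<forall>i\<in>{1..<j}. herm v (L i) = 0"
  shows "a + v \<in> \<Omega>"
proof -
  have norm_L: "norm (L i) = 1" if "i \<in> {1..CARD('n)}" for i
    using L that by (simp add: mcneal_basis_def norm_eq_sqrt_inner inner_eq_Re_herm)
  show ?thesis
  proof (cases "j = 1")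
    case True
    obtain c where c: "L 1 = c *s grad r (normal_proj \<Omega> a)" using L by (auto simp: mcneal_basis_def)
    have "is_nearest_bdry_point \<Omega> a (normal_proj \<Omega> a)"
      unfolding normal_proj_def by (rule theI'[OF ex1])
    from normal_disc_radius_ball[OF \<Omega> diff a this c norm_L] v(1) j show ?thesis by (simp add: True)
  next
    case False
    show ?thesis
    proof (cases "v = 0")
      case False
      define u where "u = (1 / norm v) *\<^sub>R v"
      have "norm u = 1" using False by (simp add: u_def)
      moreover have "herm u (L i) = 0" if "i \<in> {1..<j}" for i
        using v(2) that by (simp add: u_def vec_smult_of_real[symmetric] herm_smult_left del: of_real_divide)
      ultimately have "disc_radius \<Omega> a (L j) \<le> disc_radius \<Omega> a u"
        using L j \<open>j \<noteq> 1\<close> by (auto simp: mcneal_basis_def)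
      then have "a + of_real (norm v) *s u \<in> \<Omega>"
        using v(1) \<open>norm u = 1\<close> by (intro disc_radius_attained(2)[OF a]) auto
      then show ?thesis using False by (simp only: vec_smult_of_real) (simp add: u_def)
    qed (use a in simp)
  qed
qed

end

section \<open>Test functions\<close>

lemma linear_herm_left: "linear (\<lambda>x. herm x y)"
proof (rule linearI)
  fix c :: real and x
  show "herm (c *\<^sub>R x) y = c *\<^sub>R herm x y"
    using herm_smult_left[of "of_real c" x y] by (simp only: vec_smult_of_real scaleR_conv_of_real)
qed (rule herm_add_left)

lemma has_derivative_herm_left: "((\<lambda>z. herm (z - a) q) has_derivative (\<lambda>h. herm h q)) (at z)"
proof -
  have "((\<lambda>z. herm z q) has_derivative (\<lambda>h. herm h q)) (at (z - a))"
    by (intro bounded_linear_imp_has_derivative) (simp add: linear_conv_bounded_linear[symmetric] linear_herm_left)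
  moreover have "((\<lambda>z. z - a) has_derivative (\<lambda>h. h)) (at z)" by (auto intro!: derivative_eq_intros)
  ultimately show ?thesis using has_derivative_compose by blast
qed

lemma holomorphic_Cn_on_compose_herm:
  assumes "\<And>z. z \<in> S \<Longrightarrow> g field_differentiable (at (herm (z - a) q))"
  shows "holomorphic_Cn_on (\<lambda>z. g (herm (z - a) q)) S"
  unfolding holomorphic_Cn_on_def
proof
  fix z assume "z \<in> S"
  then obtain D where "(g has_field_derivative D) (at (herm (z - a) q))"
    using assms by (auto simp: field_differentiable_def)
  then have "(g has_derivative (*) D) (at (herm (z - a) q))" by (simp add: has_field_derivative_def)
  from has_derivative_compose[OF has_derivative_herm_left this]
  have "((\<lambda>z. g (herm (z - a) q)) has_derivative (\<lambda>h. D * herm h q)) (at z)" .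
  moreover have "D * herm (c *s h) q = c * (D * herm h q)" for c h by (simp add: herm_smult_left)
  ultimately show "\<exists>f'. ((\<lambda>z. g (herm (z - a) q)) has_derivative f') (at z) \<and> (\<forall>c h. f' (c *s h) = c * f' h)"
    by blast
qed

lemma holomorphic_Cn_on_prod:
  assumes "\<And>i. i \<in> I \<Longrightarrow> holomorphic_Cn_on (f i) S"
  shows "holomorphic_Cn_on (\<lambda>z. \<Prod>i\<in>I. f i z) S"
  using assms
proof (induction I rule: infinite_finite_induct)
  case (insert i I)
  have 1: "holomorphic_Cn_on (f i) S" "holomorphic_Cn_on (\<lambda>z. \<Prod>i\<in>I. f i z) S" using insert by auto
  show ?case unfolding holomorphic_Cn_on_def
  proof
    fix z assume "z \<in> S"
    then obtain F G where F: "(f i has_derivative F) (at z)" "\<And>c h. F (c *s h) = c * F h"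
      and G: "((\<lambda>z. \<Prod>i\<in>I. f i z) has_derivative G) (at z)" "\<And>c h. G (c *s h) = c * G h"
      using 1 unfolding holomorphic_Cn_on_def by blast
    from has_derivative_mult[OF F(1) G(1)] insert.hyps
    have "((\<lambda>z. \<Prod>i\<in>insert i I. f i z) has_derivative (\<lambda>h. f i z * G h + F h * (\<Prod>i\<in>I. f i z))) (at z)" by simp
    moreover have "f i z * G (c *s h) + F (c *s h) * (\<Prod>i\<in>I. f i z) = c * (f i z * G h + F h * (\<Prod>i\<in>I. f i z))" for c h
      by (simp add: F(2) G(2) algebra_simps)
    ultimately show "\<exists>f'. ((\<lambda>z. \<Prod>i\<in>insert i I. f i z) has_derivative f') (at z) \<and> (\<forall>c h. f' (c *s h) = c * f' h)"
      by blast
  qed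
qed (auto simp: holomorphic_Cn_on_def intro!: exI[of _ "\<lambda>_. 0"])

text \<open>All rotations of \<open>(z - a)/s\<close> remain admissible, so the bound on the real
  part becomes one on the modulus.\<close>

lemma (in convex_domain) circled_nbhd_functional_le:
  assumes z: "z \<in> circled_nbhd a s" and s: "0 < s" and q: "\<And>z. z \<in> \<Omega> \<Longrightarrow> Re (herm (z - a) q) \<le> 1"
  shows "cmod (herm (z - a) q) \<le> s"
proof -
  have "(1 / s) * cmod (herm (z - a) q) \<le> 1"
  proof (rule cmod_le_if_Re_rotations_le)
    fix \<xi> assume "cmod \<xi> < 1 / s"
    then have "cmod \<xi> * s \<le> 1" using s by (simp add: field_simps)
    with z have "a + \<xi> *s (z - a) \<in> \<Omega>" by (auto simp: circled_nbhd_def)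
    from q[OF this] show "Re (\<xi> * herm (z - a) q) \<le> 1" by (simp add: herm_smult_left del: vector_ssub_ldistrib)
  qed
  then show ?thesis using s by (simp add: field_simps)
qed

text \<open>When each functional has real part at most 1 on the domain, the number 2 keeps every
  factor free of poles and of modulus at most 1. One large functional then suffices to make the
  whole product small.\<close>

definition peak_product :: "(complex ^ 'n) set \<Rightarrow> nat \<Rightarrow> complex ^ 'n \<Rightarrow> complex ^ 'n \<Rightarrow> complex" where
  "peak_product Q N a z = (\<Prod>q\<in>Q. inverse (2 - herm (z - a) q) ^ N)"

context weighted_convex_domain
begin

text \<open>The integral is estimated on the shells of \<open>circled_nbhd a (K 2\<^sup>i)\<close>, on which the decay
  of the test function beats the growth of the volume.\<close>

lemma peak_product_estimates:
  fixes Q :: "(complex ^ 'n) set"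
  assumes a: "a \<in> \<Omega>" and Q: "finite Q" "card Q \<le> m"
    and re: "\<And>q z. q \<in> Q \<Longrightarrow> z \<in> \<Omega> \<Longrightarrow> Re (herm (z - a) q) \<le> 1"
    and absorb: "\<And>v R. 0 < R \<Longrightarrow> \<forall>q\<in>Q. cmod (herm v q) \<le> R \<Longrightarrow> a + v \<in> circled_nbhd a (K * R)"
    and K: "1 \<le> K" and p: "1 < p" and N: "N = Suc (j + DIM(complex ^ 'n))"
  shows "holomorphic_Cn_on (peak_product Q N a) \<Omega>"
    and "z \<in> \<Omega> \<Longrightarrow> z \<in> circled_nbhd a s \<Longrightarrow> 0 < s \<Longrightarrow> (1 / (2 + s)) ^ (N * m) \<le> cmod (peak_product Q N a z)"
    and "(\<integral>\<^sup>+z. ennreal (cmod (peak_product Q N a z) powr p) \<partial>wmeasure)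
      \<le> ennreal ((6 ^ N) powr p * c2 * (2 * K) ^ (j + DIM(complex ^ 'n)) * 2 * weighted_vol j a)"
proof -
  let ?f = "peak_product Q N a"
  have ge1: "1 \<le> cmod (2 - herm (z - a) q)" if "q \<in> Q" "z \<in> \<Omega>" for q z
    using complex_Re_le_cmod[of "2 - herm (z - a) q"] re[OF that] by simp
  have "holomorphic_Cn_on (\<lambda>z. inverse (2 - herm (z - a) q) ^ N) \<Omega>" if "q \<in> Q" for q
    using ge1[OF that] by (intro holomorphic_Cn_on_compose_herm[where g = "\<lambda>w. inverse (2 - w) ^ N"] derivative_intros) fastforce+
  then show "holomorphic_Cn_on ?f \<Omega>"
    unfolding peak_product_def by (rule holomorphic_Cn_on_prod)
  have cmod_f: "cmod (?f z) = (\<Prod>q\<in>Q. inverse (cmod (2 - herm (z - a) q)) ^ N)" for z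
    by (simp add: peak_product_def prod_norm[symmetric] norm_power norm_inverse)
  show "(1 / (2 + s)) ^ (N * m) \<le> cmod (?f z)" if zO: "z \<in> \<Omega>" and z: "z \<in> circled_nbhd a s" and s: "0 < s" for z s
  proof -
    have nz: "2 - herm (z - a) q \<noteq> 0 \<and> cmod (2 - herm (z - a) q) \<le> 2 + s" if q: "q \<in> Q" for q
    proof
      show "cmod (2 - herm (z - a) q) \<le> 2 + s"
        using norm_triangle_ineq4[of 2 "herm (z - a) q"] circled_nbhd_functional_le[OF z s re[OF q]] by simp
      show "2 - herm (z - a) q \<noteq> 0" using ge1[OF q zO] by auto
    qed
    have "(1 / (2 + s)) ^ (N * m) \<le> (1 / (2 + s)) ^ (N * card Q)"
      using s Q(2) by (intro power_decreasing) auto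
    also have "\<dots> = (\<Prod>q\<in>Q. (1 / (2 + s)) ^ N)" by (simp add: power_mult)
    also have "\<dots> \<le> cmod (?f z)" unfolding cmod_f
      using s nz by (intro prod_mono) (auto intro!: power_mono simp: field_simps)
    finally show ?thesis .
  qed
  define A where "A = (6 ^ N :: real) powr p"
  \<comment> \<open>From the first index on, \<open>K * 2 ^ i \<ge> 1\<close>, so the neighbourhood
    may leave \<Omega> and is cut back to it.\<close>
  define B where "B i = \<Omega> \<inter> circled_nbhd a (K * 2 ^ i)" for i :: nat
  have B[measurable]: "B i \<in> sets borel" for i
    unfolding B_def using open_dom K by (intro sets.Int borel_open open_circled_nbhd) auto
  have B_sets: "B i \<in> sets wmeasure" for i
    unfolding sets_wmeasure sets_restrict_space using B by (auto simp: B_def)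
  have factor_le: "inverse (cmod (2 - herm (z - a) q)) ^ N \<le> 1" if "q \<in> Q" "z \<in> \<Omega>" for q z
    using ge1[OF that] by (intro power_le_one) (auto simp: inverse_le_1_iff)
  have point: "ennreal (cmod (?f z) powr p) \<le> (\<Sum>i. ennreal (A * (1/2) ^ (i * N)) * indicator (B i) z)" if z: "z \<in> \<Omega>" for z
  proof -
    define R where "R = 1 + (\<Sum>q\<in>Q. cmod (herm (z - a) q))"
    obtain i0 :: nat where i0: "R < 2 ^ i0" using real_arch_pow[of 2 R] by auto
    have "a + (z - a) \<in> circled_nbhd a (K * 2 ^ i0)"
    proof (rule absorb)
      show "\<forall>q\<in>Q. cmod (herm (z - a) q) \<le> 2 ^ i0"
      proof
        fix q assume "q \<in> Q"
        then have "cmod (herm (z - a) q) \<le> (\<Sum>q\<in>Q. cmod (herm (z - a) q))"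
          using Q(1) by (intro member_le_sum) auto
        then show "cmod (herm (z - a) q) \<le> 2 ^ i0" using i0 by (simp add: R_def)
      qed
    qed simp
    then have "z \<in> B i0" using z by (simp add: B_def)
    define i where "i = (LEAST i. z \<in> B i)"
    have zi: "z \<in> B i" unfolding i_def by (rule LeastI) (rule \<open>z \<in> B i0\<close>)
    have f_le: "cmod (?f z) \<le> (6 * (1/2) ^ i) ^ N"
    proof (cases i)
      case 0
      have "cmod (?f z) \<le> 1" unfolding cmod_f using factor_le z by (intro prod_le_1) auto
      also have "1 \<le> (6 * (1/2) ^ i :: real) ^ N" using 0 by (intro one_le_power) auto
      finally show ?thesis .
    next
      case (Suc k)
      have "z \<notin> B k" using not_less_Least[of k "\<lambda>i. z \<in> B i"] Suc by (simp add: i_def)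
      then have "a + (z - a) \<notin> circled_nbhd a (K * 2 ^ k)" using z by (simp add: B_def)
      then obtain q where q: "q \<in> Q" "2 ^ k < cmod (herm (z - a) q)"
        using absorb[of "2 ^ k" "z - a"] by (meson not_le zero_less_numeral zero_less_power)
      \<comment> \<open>Since the denominator has modulus at least 1, the additive 2 is absorbed:
        \<open>2^k \<le> 3 |2 - herm (z - a) q|\<close>. Passing from \<open>k\<close> to
        \<open>i = k + 1\<close> doubles the 3 into the 6 of \<open>A\<close>.\<close>
      have "cmod (herm (z - a) q) \<le> cmod (2 - herm (z - a) q) + 2"
        using norm_triangle_ineq2[of "herm (z - a) q" 2] by (simp add: norm_minus_commute)
      with ge1[OF q(1) z] q(2) have "2 ^ k \<le> 3 * cmod (2 - herm (z - a) q)" by linarith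
      have "inverse (cmod (2 - herm (z - a) q)) \<le> 6 * (1/2) ^ i"
      proof -
        have "2 ^ k \<le> 3 * x \<Longrightarrow> 1 \<le> x \<Longrightarrow> inverse x \<le> 6 * (1/2) ^ Suc k" for x :: real
          by (simp add: divide_simps power_one_over)
        then show ?thesis using \<open>2 ^ k \<le> _\<close> ge1[OF q(1) z] by (simp add: Suc)
      qed
      then have "inverse (cmod (2 - herm (z - a) q)) ^ N \<le> (6 * (1/2) ^ i) ^ N"
        by (intro power_mono) auto
      moreover have "(\<Prod>q\<in>Q - {q}. inverse (cmod (2 - herm (z - a) q)) ^ N) \<le> 1"
        using factor_le z by (intro prod_le_1) auto
      ultimately have "inverse (cmod (2 - herm (z - a) q)) ^ N * (\<Prod>q\<in>Q - {q}. inverse (cmod (2 - herm (z - a) q)) ^ N)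
          \<le> (6 * (1/2) ^ i) ^ N * 1"
        by (intro mult_mono prod_nonneg) auto
      then show ?thesis unfolding cmod_f prod.remove[OF Q(1) q(1)] by simp
    qed
    have "cmod (?f z) powr p \<le> ((6 * (1/2) ^ i) ^ N) powr p"
      using f_le p by (intro powr_mono2) auto
    also have "\<dots> = A * ((1/2) ^ (i * N)) powr p"
      by (simp add: A_def power_mult_distrib powr_mult power_mult)
    \<comment> \<open>Decay to the power \<open>p > 1\<close> is at least the decay to the power 1,
      so the same \<open>N\<close> serves all exponents.\<close>
    also have "\<dots> \<le> A * ((1/2) ^ (i * N)) powr 1"
      using p by (intro mult_left_mono powr_mono') (auto simp: A_def power_le_one)
    finally have "ennreal (cmod (?f z) powr p) \<le> ennreal (A * (1/2) ^ (i * N))"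
      by (intro ennreal_leI) simp
    also have "\<dots> = (\<Sum>i\<in>{i}. ennreal (A * (1/2) ^ (i * N)) * indicator (B i) z)" using zi by simp
    \<comment> \<open>Only the term of the least index is needed; bounding it by the full series
      avoids disjoint shells.\<close>
    also have "\<dots> \<le> (\<Sum>i. ennreal (A * (1/2) ^ (i * N)) * indicator (B i) z)"
      by (intro sum_le_suminf summableI) auto
    finally show ?thesis .
  qed
  have layer: "ennreal (A * (1/2) ^ (i * N)) * emeasure wmeasure (B i)
      \<le> ennreal (A * c2 * (2 * K) ^ (j + DIM(complex ^ 'n)) * weighted_vol j a * (1/2) ^ i)" for i
  proof -
    define M where "M = j + DIM(complex ^ 'n)"
    have s: "1 \<le> K * 2 ^ i" using mult_mono[OF K one_le_power[of 2 i]] K by simp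
    have w: "0 < weighted_vol j a" by (rule weighted_vol_pos[OF a])
    have "emeasure wmeasure (B i) \<le> ennreal (c2 * (1 + K * 2 ^ i) ^ j * (K * 2 ^ i) ^ DIM(complex ^ 'n) * weighted_vol j a)"
      using s by (intro emeasure_wmeasure_upper B) (auto simp: B_def)
    \<comment> \<open>Both \<open>1 + S\<close> and \<open>S\<close> are at most
      \<open>2 * S\<close> for \<open>S = K * 2 ^ i \<ge> 1\<close>, so the weight and the volume
      combine into one power with exponent \<open>M\<close>.\<close>
    also have "\<dots> \<le> ennreal (c2 * (2 * (K * 2 ^ i)) ^ j * (2 * (K * 2 ^ i)) ^ DIM(complex ^ 'n) * weighted_vol j a)"
    proof (intro ennreal_leI mult_right_mono)
      have "c2 * (1 + S) ^ j * S ^ d \<le> c2 * (2 * S) ^ j * (2 * S) ^ d" if "1 \<le> S" for S :: real and d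
        using that c2_pos by (intro mult_mono power_mono mult_left_mono) auto
      from this[OF s] show "c2 * (1 + K * 2 ^ i) ^ j * (K * 2 ^ i) ^ DIM(complex ^ 'n)
        \<le> c2 * (2 * (K * 2 ^ i)) ^ j * (2 * (K * 2 ^ i)) ^ DIM(complex ^ 'n)" .
    qed (use w in simp)
    also have "c2 * (2 * (K * 2 ^ i)) ^ j * (2 * (K * 2 ^ i)) ^ DIM(complex ^ 'n) * weighted_vol j a
        = c2 * (2 * K) ^ M * weighted_vol j a * (2 ^ i) ^ M"
      unfolding M_def by (simp only: power_add power_mult_distrib mult_ac)
    finally have "ennreal (A * (1/2) ^ (i * N)) * emeasure wmeasure (B i)
       \<le> ennreal (A * (1/2) ^ (i * N)) * ennreal (c2 * (2 * K) ^ M * weighted_vol j a * (2 ^ i) ^ M)"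
      by (rule mult_left_mono) simp
    also have "\<dots> = ennreal (A * (1/2) ^ (i * N) * (c2 * (2 * K) ^ M * weighted_vol j a * (2 ^ i) ^ M))"
      by (rule ennreal_mult'[symmetric]) (simp add: A_def)
    \<comment> \<open>As \<open>N = Suc M\<close>, the growth \<open>(2^i)^M\<close> is cancelled
      and one factor \<open>(1/2)^i\<close> is left over for the geometric series.\<close>
    also have "A * (1/2) ^ (i * N) * (c2 * (2 * K) ^ M * weighted_vol j a * (2 ^ i) ^ M)
       = A * c2 * (2 * K) ^ M * weighted_vol j a * (1/2) ^ i * (((1/2) ^ i) ^ M * (2 ^ i) ^ M)"
      unfolding N M_def[symmetric] power_mult power_Suc by (simp only: mult_ac)
    also have "((1/2) ^ i) ^ M * (2 ^ i :: real) ^ M = 1"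
      unfolding power_mult_distrib[symmetric] by simp
    finally show ?thesis by (simp add: M_def)
  qed
  have "(\<integral>\<^sup>+z. ennreal (cmod (?f z) powr p) \<partial>wmeasure)
      \<le> (\<integral>\<^sup>+z. (\<Sum>i. ennreal (A * (1/2) ^ (i * N)) * indicator (B i) z) \<partial>wmeasure)"
    by (rule nn_integral_mono) (use point space_wmeasure in blast)
  also have "\<dots> = (\<Sum>i. \<integral>\<^sup>+z. ennreal (A * (1/2) ^ (i * N)) * indicator (B i) z \<partial>wmeasure)"
    by (intro nn_integral_suminf borel_measurable_times_ennreal borel_measurable_const borel_measurable_indicator B_sets)
  also have "\<dots> = (\<Sum>i. ennreal (A * (1/2) ^ (i * N)) * emeasure wmeasure (B i))"
    by (intro suminf_cong nn_integral_cmult_indicator B_sets)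
  also have "\<dots> \<le> (\<Sum>i. ennreal (A * c2 * (2 * K) ^ (j + DIM(complex ^ 'n)) * weighted_vol j a * (1/2) ^ i))"
    by (intro suminf_le layer summableI)
  also have "\<dots> = ennreal (A * c2 * (2 * K) ^ (j + DIM(complex ^ 'n)) * weighted_vol j a * 2)"
  proof (rule suminf_ennreal_eq)
    show "0 \<le> A * c2 * (2 * K) ^ (j + DIM(complex ^ 'n)) * weighted_vol j a * (1/2) ^ i" for i
      using K c2_pos weighted_vol_pos[OF a, of j] by (simp add: A_def)
    have "(\<lambda>i. (1/2 :: real) ^ i) sums 2" using geometric_sums[of "1/2 :: real"] by simp
    then show "(\<lambda>i. A * c2 * (2 * K) ^ (j + DIM(complex ^ 'n)) * weighted_vol j a * (1/2) ^ i)
       sums (A * c2 * (2 * K) ^ (j + DIM(complex ^ 'n)) * weighted_vol j a * 2)" by (rule sums_mult)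
  qed
  finally show "(\<integral>\<^sup>+z. ennreal (cmod (?f z) powr p) \<partial>wmeasure)
      \<le> ennreal ((6 ^ N) powr p * c2 * (2 * K) ^ (j + DIM(complex ^ 'n)) * 2 * weighted_vol j a)"
    by (simp only: A_def mult_ac)
qed

end

section \<open>Comparison of polydiscs with circled neighbourhoods\<close>

lemma polydisc_eq_herm_coords:
  fixes L :: "nat \<Rightarrow> complex ^ 'n"
  assumes on: "\<And>i j. i \<in> {1..CARD('n)} \<Longrightarrow> j \<in> {1..CARD('n)} \<Longrightarrow> herm (L i) (L j) = (if i = j then 1 else 0)"
  shows "{a + (\<Sum>j=1..CARD('n). \<xi> j *s L j) | \<xi>. \<forall>j\<in>{1..CARD('n)}. cmod (\<xi> j) < t j}
    = {z. \<forall>j\<in>{1..CARD('n)}. cmod (herm (z - a) (L j)) < t j}"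
proof (intro equalityI subsetI)
  fix z assume "z \<in> {a + (\<Sum>j=1..CARD('n). \<xi> j *s L j) | \<xi>. \<forall>j\<in>{1..CARD('n)}. cmod (\<xi> j) < t j}"
  then obtain \<xi> where \<xi>: "z = a + (\<Sum>j=1..CARD('n). \<xi> j *s L j)" "\<forall>j\<in>{1..CARD('n)}. cmod (\<xi> j) < t j" by blast
  have "herm (z - a) (L i) = \<xi> i" if "i \<in> {1..CARD('n)}" for i
    using that on by (simp add: \<xi>(1) herm_sum_left herm_smult_left if_distrib[of "(*) _"] cong: if_cong)
  with \<xi>(2) show "z \<in> {z. \<forall>j\<in>{1..CARD('n)}. cmod (herm (z - a) (L j)) < t j}" by simp
next
  fix z assume "z \<in> {z. \<forall>j\<in>{1..CARD('n)}. cmod (herm (z - a) (L j)) < t j}"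
  then show "z \<in> {a + (\<Sum>j=1..CARD('n). \<xi> j *s L j) | \<xi>. \<forall>j\<in>{1..CARD('n)}. cmod (\<xi> j) < t j}"
    using orthonormal_expansion[OF on, of "z - a"]
    by (intro CollectI exI[of _ "\<lambda>j. herm (z - a) (L j)"]) simp
qed

context convex_domain
begin

text \<open>What the test functions require of the geometry: few functionals, each bounded by 1 on
  \<Omega>, whose joint smallness confines a vector to a multiple of \<open>D_a\<close>. The bound
  on the cardinality makes the lower estimate of the product uniform in \<open>a\<close>.\<close>

definition support_frame :: "real \<Rightarrow> complex ^ 'n \<Rightarrow> (complex ^ 'n) set \<Rightarrow> bool" where
  "support_frame K a Q \<longleftrightarrow> finite Q \<and> card Q \<le> CARD('n) \<and>
     (\<forall>q\<in>Q. \<forall>z\<in>\<Omega>. Re (herm (z - a) q) \<le> 1) \<and>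
     (\<forall>v R. 0 < R \<longrightarrow> (\<forall>q\<in>Q. cmod (herm v q) \<le> R) \<longrightarrow> a + v \<in> circled_nbhd a (K * R))"

lemma support_frame_mono:
  assumes "support_frame K a Q" "K \<le> K'"
  shows "support_frame K' a Q"
  using assms circled_nbhd_mono[OF mult_right_mono[OF assms(2)], of _ a]
  unfolding support_frame_def by (meson less_imp_le subsetD)

text \<open>On \<open>a + 2^(-n) D_a\<close> the support functionals are at most
  \<open>2^(-n)\<close>, so forward substitution bounds the coordinates by \<tau>, strictly below
  the \<open>2 * \<tau>\<close> of the polydisc. Conversely, coordinates below
  \<open>2 * \<tau>\<close> give \<open>2n * 2\<close> by averaging. The frame constant combines
  both losses.\<close>

lemma mcneal_polydisc_comparable_near:
  assumes \<Omega>: "\<Omega> = {z. r z < 0}" and diff: "\<And>w. r differentiable (at w)"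
    and a: "a \<in> \<Omega>" "a \<in> U" and ex1: "\<exists>!w. is_nearest_bdry_point \<Omega> a w" and L: "mcneal_basis \<Omega> r a (L a)"
  shows "open (mcneal_polydisc \<Omega> U L i1 a 2)"
    and "circled_nbhd a ((1/2) ^ CARD('n)) \<subseteq> mcneal_polydisc \<Omega> U L i1 a 2"
    and "mcneal_polydisc \<Omega> U L i1 a 2 \<subseteq> circled_nbhd a (4 * real CARD('n))"
    and "\<exists>Q. support_frame (2 * real CARD('n) * 2 ^ CARD('n)) a Q"
proof -
  let ?I = "{1..CARD('n)}"
  let ?\<tau> = "\<lambda>j. disc_radius \<Omega> a (L a j)"
  have on: "herm (L a i) (L a j) = (if i = j then 1 else 0)" if "i \<in> ?I" "j \<in> ?I" for i j
    using L that by (simp add: mcneal_basis_def)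
  have \<tau>: "0 < ?\<tau> j" if j: "j \<in> ?I" for j
    using on[OF j j] by (intro disc_radius_attained(1)[OF a(1)]) (auto simp: herm_zero_left)
  have P: "mcneal_polydisc \<Omega> U L i1 a 2 = {z. \<forall>j\<in>?I. cmod (herm (z - a) (L a j)) < 2 * ?\<tau> j}"
    using a(2) polydisc_eq_herm_coords[OF on, of a "\<lambda>j. 2 * ?\<tau> j"] by (simp add: mcneal_polydisc_def)
  obtain q where q: "\<And>j z. j \<in> ?I \<Longrightarrow> z \<in> \<Omega> \<Longrightarrow> Re (herm (z - a) (q j)) \<le> 1"
    "\<And>v R j. (\<And>j. j \<in> ?I \<Longrightarrow> cmod (herm v (q j)) \<le> R) \<Longrightarrow> j \<in> ?I \<Longrightarrow> cmod (herm v (L a j)) \<le> R * 2 ^ j * ?\<tau> j"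
  proof (rule triangular_support_functionals[OF a(1), where L = "L a"])
    fix j v assume "j \<in> ?I" "norm v < ?\<tau> j" "\<forall>i\<in>{1..<j}. herm v (L a i) = 0"
    then show "a + v \<in> \<Omega>" by (rule mcneal_basis_ball[OF \<Omega> diff a(1) ex1 L])
  next
    fix q assume "\<And>j z. j \<in> ?I \<Longrightarrow> z \<in> \<Omega> \<Longrightarrow> Re (herm (z - a) (q j)) \<le> 1"
      "\<And>v R j. (\<And>j. j \<in> ?I \<Longrightarrow> cmod (herm v (q j)) \<le> R) \<Longrightarrow> j \<in> ?I \<Longrightarrow> cmod (herm v (L a j)) \<le> R * 2 ^ j * ?\<tau> j"
    then show thesis by (rule that)
  qed (rule on)
  have q2: "cmod (herm v (L a j)) \<le> R * 2 ^ CARD('n) * ?\<tau> j"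
    if v: "\<And>j. j \<in> ?I \<Longrightarrow> cmod (herm v (q j)) \<le> R" and j: "j \<in> ?I" for v R j
  proof -
    have "0 \<le> R" using v[OF j] norm_ge_zero order_trans by blast
    then have "R * 2 ^ j * ?\<tau> j \<le> R * 2 ^ CARD('n) * ?\<tau> j"
      using \<tau>[OF j] j by (intro mult_right_mono mult_left_mono power_increasing) auto
    with q(2)[OF v j] show ?thesis by linarith
  qed
  show "open (mcneal_polydisc \<Omega> U L i1 a 2)"
  proof -
    have "continuous_on UNIV (\<lambda>z. cmod (herm (z - a) (L a j)))" for j
      unfolding herm_def by (intro continuous_intros)
    then have "open {z. cmod (herm (z - a) (L a j)) < 2 * ?\<tau> j}" for j
      by (intro open_Collect_less continuous_on_const)
    then have "open (\<Inter>j\<in>?I. {z. cmod (herm (z - a) (L a j)) < 2 * ?\<tau> j})" by (intro open_INT) auto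
    also have "(\<Inter>j\<in>?I. {z. cmod (herm (z - a) (L a j)) < 2 * ?\<tau> j}) = mcneal_polydisc \<Omega> U L i1 a 2"
      unfolding P by auto
    finally show ?thesis .
  qed
  show "circled_nbhd a ((1/2) ^ CARD('n)) \<subseteq> mcneal_polydisc \<Omega> U L i1 a 2"
    unfolding P
  proof safe
    fix z j assume z: "z \<in> circled_nbhd a ((1/2) ^ CARD('n))" and j: "j \<in> ?I"
    have "cmod (herm (z - a) (L a j)) \<le> (1/2) ^ CARD('n) * 2 ^ CARD('n) * ?\<tau> j"
      by (rule q2[OF circled_nbhd_functional_le[OF z _ q(1)] j]) auto
    also have "(1/2 :: real) ^ CARD('n) * 2 ^ CARD('n) = 1" by (simp add: power_mult_distrib[symmetric])
    finally show "cmod (herm (z - a) (L a j)) < 2 * ?\<tau> j" using \<tau>[OF j] by simp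
  qed
  show "mcneal_polydisc \<Omega> U L i1 a 2 \<subseteq> circled_nbhd a (4 * real CARD('n))"
  proof
    fix z assume "z \<in> mcneal_polydisc \<Omega> U L i1 a 2"
    then have "cmod (herm (z - a) (L a j)) \<le> 2 * ?\<tau> j" if "j \<in> ?I" for j
      using that unfolding P by force
    from circled_nbhd_if_coords_le[OF a(1) on this] show "z \<in> circled_nbhd a (4 * real CARD('n))" by simp
  qed
  have "support_frame (2 * real CARD('n) * 2 ^ CARD('n)) a (q ` ?I)"
    unfolding support_frame_def
  proof (intro conjI allI impI)
    show "card (q ` ?I) \<le> CARD('n)" using card_image_le[of ?I q] by simp
    show "\<forall>p\<in>q ` ?I. \<forall>z\<in>\<Omega>. Re (herm (z - a) p) \<le> 1" using q(1) by auto
    fix v R assume R: "0 < (R::real)" "\<forall>p\<in>q ` ?I. cmod (herm v p) \<le> R"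
    have "a + v \<in> circled_nbhd a (2 * real CARD('n) * (R * 2 ^ CARD('n)))"
      using R by (intro circled_nbhd_if_coords_le[OF a(1) on] q2) auto
    then show "a + v \<in> circled_nbhd a (2 * real CARD('n) * 2 ^ CARD('n) * R)" by (simp add: mult_ac)
  qed simp
  then show "\<exists>Q. support_frame (2 * real CARD('n) * 2 ^ CARD('n)) a Q" by blast
qed

lemma herm_axis: "herm v (axis i (of_real t)) = v $ i * of_real t"
proof -
  have "herm v (axis i (of_real t)) = (\<Sum>k\<in>UNIV. if k = i then v $ k * of_real t else 0)"
    unfolding herm_def by (intro sum.cong) (auto simp: axis_def)
  then show ?thesis by simp
qed

text \<open>Away from the boundary the inner radius is at least \<open>e\<close> and the domain has
  size \<open>d\<close>, so everything is compared with balls about \<open>a\<close>. The shape of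
  the polydisc enters through its shortest side, at least
  \<open>min (2 * e) (2 * e powr (1/2))\<close>. The frame consists of the coordinate functionals
  divided by \<open>d\<close>.\<close>

lemma mcneal_polydisc_comparable_far:
  assumes a: "a \<in> \<Omega>" "a \<notin> U" and e: "0 < e" "e \<le> bdist \<Omega> a" and d: "0 < d" "\<And>a. a \<in> \<Omega> \<Longrightarrow> \<Omega> \<subseteq> ball a d"
  shows "open (mcneal_polydisc \<Omega> U L i1 a 2)"
    and "0 < s \<Longrightarrow> s * d \<le> min (2 * e) (2 * e powr (1/2)) \<Longrightarrow> circled_nbhd a s \<subseteq> mcneal_polydisc \<Omega> U L i1 a 2"
    and "\<Omega> \<subseteq> circled_nbhd a (d / e)"
    and "\<exists>Q. support_frame (2 * real CARD('n) * d / e) a Q"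
proof -
  define w where "w i = 2 * (if i = i1 then bdist \<Omega> a else bdist \<Omega> a powr (1/2))" for i
  have P: "mcneal_polydisc \<Omega> U L i1 a 2 = {z. \<forall>i. cmod (z $ i - a $ i) < w i}"
    using a(2) by (simp add: mcneal_polydisc_def w_def)
  have w_ge: "min (2 * e) (2 * e powr (1/2)) \<le> w i" for i
  proof -
    have "e powr (1/2) \<le> bdist \<Omega> a powr (1/2)" using e by (intro powr_mono2) auto
    then show ?thesis using e(2) by (auto simp: w_def)
  qed
  show "open (mcneal_polydisc \<Omega> U L i1 a 2)"
  proof -
    have "open {z::complex^'n. cmod (z $ i - a $ i) < w i}" for i
      by (intro open_Collect_less continuous_intros)
    then have "open (\<Inter>i\<in>UNIV. {z::complex^'n. cmod (z $ i - a $ i) < w i})" by (intro open_INT) auto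
    also have "(\<Inter>i\<in>UNIV. {z::complex^'n. cmod (z $ i - a $ i) < w i}) = mcneal_polydisc \<Omega> U L i1 a 2"
      unfolding P by auto
    finally show ?thesis .
  qed
  show "circled_nbhd a s \<subseteq> mcneal_polydisc \<Omega> U L i1 a 2" if s: "0 < s" "s * d \<le> min (2 * e) (2 * e powr (1/2))"
    unfolding P
  proof safe
    fix z i assume "z \<in> circled_nbhd a s"
    then have "a + (1/s) *\<^sub>R (z - a) \<in> \<Omega>" using s by (intro circled_nbhd_scaled_dom) auto
    then have "a + (1/s) *\<^sub>R (z - a) \<in> ball a d" using d(2)[OF a(1)] by blast
    then have "norm (z - a) < s * d" using s(1) by (simp add: dist_norm pos_divide_less_eq mult.commute)
    moreover have "cmod ((z - a) $ i) \<le> norm (z - a)" by (rule Finite_Cartesian_Product.norm_nth_le)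
    ultimately show "cmod (z $ i - a $ i) < w i"
      using s(2) w_ge[of i] unfolding vector_minus_component by linarith
  qed
  have ball: "ball a (S * d) \<subseteq> circled_nbhd a (S * d / e)" if S: "0 < S" for S
  proof -
    have "S * d * e \<le> S * d * bdist \<Omega> a" using e d(1) S by (intro mult_left_mono) auto
    then have "S * d \<le> S * d / e * bdist \<Omega> a" using e(1) by (simp add: field_simps)
    then have "ball a (S * d) \<subseteq> ball a (S * d / e * bdist \<Omega> a)" by (rule subset_ball)
    also have "\<dots> \<subseteq> circled_nbhd a (S * d / e)" using S d(1) e(1) by (intro ball_subset_circled_nbhd a(1)) simp
    finally show ?thesis .
  qed
  show "\<Omega> \<subseteq> circled_nbhd a (d / e)" using ball[of 1] d(2)[OF a(1)] by simp
  define Q where "Q = range (\<lambda>i::'n. axis i (complex_of_real (1 / d)))"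
  have "support_frame (2 * real CARD('n) * d / e) a Q"
    unfolding support_frame_def
  proof (intro conjI allI impI ballI)
    show "finite Q" by (simp add: Q_def)
    show "card Q \<le> CARD('n)" unfolding Q_def by (rule card_image_le) simp
  next
    fix q z assume "q \<in> Q" and z: "z \<in> \<Omega>"
    then obtain i where i: "q = axis i (complex_of_real (1 / d))" by (auto simp: Q_def)
    have "Re ((z - a) $ i) \<le> norm (z - a)"
      using complex_Re_le_cmod Finite_Cartesian_Product.norm_nth_le order_trans by blast
    also have "\<dots> \<le> d" using d(2)[OF a(1)] z by (auto simp: dist_norm norm_minus_commute)
    finally have "Re ((z - a) $ i) * (1 / d) \<le> 1" using d(1) by (simp add: field_simps)
    then show "Re (herm (z - a) q) \<le> 1" unfolding i herm_axis by (simp del: of_real_divide)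
  next
    fix v R assume R: "0 < (R::real)" "\<forall>q\<in>Q. cmod (herm v q) \<le> R"
    have "cmod (v $ i) \<le> d * R" for i
    proof -
      have "cmod (herm v (axis i (complex_of_real (1 / d)))) \<le> R" using R(2) by (auto simp: Q_def)
      then show ?thesis unfolding herm_axis norm_mult norm_of_real using d(1) by (simp add: field_simps)
    qed
    then have "norm v \<le> real CARD('n) * (d * R)"
      using L2_set_le_sum[of UNIV "\<lambda>i. cmod (v $ i)"] sum_bounded_above[of UNIV "\<lambda>i. cmod (v $ i)" "d * R"]
      by (simp add: norm_vec_def)
    \<comment> \<open>The factor 2 in the frame constant provides the strict inequality needed for
      an open ball.\<close>
    also have "\<dots> < (2 * real CARD('n) * R) * d" using d(1) R(1) by simp
    finally have "a + v \<in> ball a ((2 * real CARD('n) * R) * d)" by (simp add: dist_norm)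
    then have "a + v \<in> circled_nbhd a ((2 * real CARD('n) * R) * d / e)" using ball R(1) by (meson mult_pos_pos of_nat_0_less_iff subsetD zero_less_card_finite zero_less_numeral)
    then show "a + v \<in> circled_nbhd a (2 * real CARD('n) * d / e * R)" by (simp add: mult_ac)
  qed
  then show "\<exists>Q. support_frame (2 * real CARD('n) * d / e) a Q" by blast
qed

lemma mcneal_polydisc_comparable:
  assumes \<Omega>: "\<Omega> = {z. r z < 0}" and diff: "\<And>w. r differentiable (at w)"
    and U: "projection_nbhd \<Omega> U" and L: "\<And>a. a \<in> U \<Longrightarrow> mcneal_basis \<Omega> r a (L a)"
  obtains c K where "0 < c" "c \<le> 1/2" "1 \<le> K"
    "\<And>a. a \<in> \<Omega> \<Longrightarrow> open (mcneal_polydisc \<Omega> U L i1 a 2)"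
    "\<And>a. a \<in> \<Omega> \<Longrightarrow> circled_nbhd a c \<subseteq> mcneal_polydisc \<Omega> U L i1 a 2"
    "\<And>a. a \<in> \<Omega> \<Longrightarrow> \<Omega> \<inter> mcneal_polydisc \<Omega> U L i1 a 2 \<subseteq> circled_nbhd a K"
    "\<And>a. a \<in> \<Omega> \<Longrightarrow> \<exists>Q. support_frame K a Q"
proof -
  obtain V where V: "open V" "frontier \<Omega> \<subseteq> V" "U = \<Omega> \<inter> V" using U by (auto simp: projection_nbhd_def)
  have ex1: "\<exists>!w. is_nearest_bdry_point \<Omega> a w" if "a \<in> U" for a using U that by (auto simp: projection_nbhd_def)
  obtain e where e: "0 < e" "\<And>a. a \<in> \<Omega> \<Longrightarrow> a \<notin> U \<Longrightarrow> e \<le> bdist \<Omega> a"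
  proof (cases "\<Omega> - U = {}")
    case False
    \<comment> \<open>As \<open>V\<close> covers the whole frontier, the points outside
      \<open>U\<close> form a compact subset of \<Omega>, where \<open>bdist\<close> attains a
      positive minimum.\<close>
    have eq: "\<Omega> - U = closure \<Omega> - V"
      using V closure_subset[of \<Omega>] open_dom by (auto simp: frontier_def interior_open)
    have "compact (\<Omega> - U)"
      unfolding eq using V(1) bounded_dom by (intro compact_diff) (auto simp: compact_closure)
    moreover have "continuous_on (\<Omega> - U) (bdist \<Omega>)"
      unfolding bdist_def by (intro continuous_on_infdist continuous_on_id)
    ultimately obtain b where "b \<in> \<Omega> - U" "\<forall>a\<in>\<Omega> - U. bdist \<Omega> b \<le> bdist \<Omega> a"
      using continuous_attains_inf[of "\<Omega> - U" "bdist \<Omega>"] False by blast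
    then show ?thesis using that[of "bdist \<Omega> b"] bdist_pos by auto
  qed (use that[of 1] in auto)
  obtain B where B: "\<And>x. x \<in> \<Omega> \<Longrightarrow> norm x \<le> B" using bounded_dom by (auto simp: bounded_iff)
  obtain x0 where "x0 \<in> \<Omega>" using nonempty_dom by blast
  then have B0: "0 \<le> B" using B norm_ge_zero order_trans by blast
  define d where "d = 2 * B + 1"
  have d: "0 < d" "\<And>a. a \<in> \<Omega> \<Longrightarrow> \<Omega> \<subseteq> ball a d"
  proof -
    show "0 < d" using B0 by (simp add: d_def)
    show "\<Omega> \<subseteq> ball a d" if "a \<in> \<Omega>" for a
    proof
      fix x assume "x \<in> \<Omega>"
      then show "x \<in> ball a d" using B[of a] B[of x] that norm_triangle_ineq4[of a x] by (simp add: dist_norm d_def)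
    qed
  qed
  define n where "n = real CARD('n)"
  have n: "1 \<le> n" by (simp add: n_def Suc_leI)
  define m where "m = min (2 * e) (2 * e powr (1/2))"
  have m: "0 < m" using e by (simp add: m_def)
  define c where "c = min ((1/2) ^ CARD('n)) (m / d)"
  \<comment> \<open>A sum of terms that dominates all the constants of the near and far cases at
    once; likewise \<open>c\<close> is a minimum.\<close>
  define K where "K = 4 * n * 2 ^ CARD('n) + 2 * n * d / e"
  have p2: "1 \<le> (2::real) ^ CARD('n)" by simp
  have nd: "0 \<le> n * d / e" "d / e \<le> n * d / e" using n d(1) e(1) by (auto intro!: divide_right_mono simp: mult_le_cancel_right1)
  have np: "n \<le> n * 2 ^ CARD('n)" using n p2 by (simp add: mult_le_cancel_left1)
  have K: "1 \<le> K" "4 * n \<le> K" "2 * n * 2 ^ CARD('n) \<le> K" "d / e \<le> K" "2 * n * d / e \<le> K"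
  proof -
    define x where "x = n * d / e"
    have eq: "K = 4 * (n * 2 ^ CARD('n)) + 2 * x" "2 * n * d / e = 2 * x" "2 * n * 2 ^ CARD('n) = 2 * (n * 2 ^ CARD('n))"
      by (simp_all add: K_def x_def)
    show "1 \<le> K" "4 * n \<le> K" "2 * n * 2 ^ CARD('n) \<le> K" "d / e \<le> K" "2 * n * d / e \<le> K"
      unfolding eq using n nd[folded x_def] np by linarith+
  qed
  have c: "0 < c" "c \<le> 1/2" "c \<le> (1/2) ^ CARD('n)" "c * d \<le> m"
  proof -
    show "0 < c" and le: "c \<le> (1/2) ^ CARD('n)" using m d(1) by (auto simp: c_def)
    have "(1/2 :: real) ^ CARD('n) \<le> (1/2) ^ 1" by (intro power_decreasing) (auto simp: Suc_leI)
    with le show "c \<le> 1/2" unfolding power_one_right by linarith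
    have "c * d \<le> (m / d) * d" using d(1) by (intro mult_right_mono) (auto simp: c_def)
    then show "c * d \<le> m" using d(1) by simp
  qed
  show ?thesis
  proof (rule that[OF c(1,2) K(1)])
    fix a assume a: "a \<in> \<Omega>"
    show "open (mcneal_polydisc \<Omega> U L i1 a 2)"
    proof (cases "a \<in> U")
      case True
      then show ?thesis
        using mcneal_polydisc_comparable_near(1)[where L = L, OF \<Omega> diff a True ex1[OF True] L[OF True]] by blast
    next
      case False
      then show ?thesis
        using mcneal_polydisc_comparable_far(1)[OF a False e(1) e(2)[OF a False] d] by blast
    qed
    show "circled_nbhd a c \<subseteq> mcneal_polydisc \<Omega> U L i1 a 2"
    proof (cases "a \<in> U")
      case True
      then show ?thesis
        using mcneal_polydisc_comparable_near(2)[where L = L, OF \<Omega> diff a True ex1[OF True] L[OF True]] circled_nbhd_mono[OF c(3), of a] by blast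
    next
      case False
      then show ?thesis
        using mcneal_polydisc_comparable_far(2)[OF a False e(1) e(2)[OF a False] d] c(1,4) unfolding m_def by blast
    qed
    show "\<Omega> \<inter> mcneal_polydisc \<Omega> U L i1 a 2 \<subseteq> circled_nbhd a K"
    proof (cases "a \<in> U")
      case True
      then show ?thesis
        using mcneal_polydisc_comparable_near(3)[where L = L, OF \<Omega> diff a True ex1[OF True] L[OF True]] circled_nbhd_mono[OF K(2), of a] unfolding n_def by blast
    next
      case False
      then show ?thesis
        using mcneal_polydisc_comparable_far(3)[OF a False e(1) e(2)[OF a False] d] circled_nbhd_mono[OF K(4), of a] by blast
    qed
    show "\<exists>Q. support_frame K a Q"
    proof (cases "a \<in> U")
      case True
      then show ?thesis
        using mcneal_polydisc_comparable_near(4)[where L = L, OF \<Omega> diff a True ex1[OF True] L[OF True]] support_frame_mono[OF _ K(3)] unfolding n_def by blast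
    next
      case False
      then show ?thesis
        using mcneal_polydisc_comparable_far(4)[OF a False e(1) e(2)[OF a False] d] support_frame_mono[OF _ K(5)] unfolding n_def by blast
    qed
  qed
qed

end

section \<open>Carleson measures\<close>

text \<open>Finiteness of the integral is essential here: \<open>enn2real\<close> sends infinity to
  0, so only inside the Bergman space does the power of the norm return the integral.\<close>

lemma carleson_inequality_iff:
  assumes "0 < p"
  shows "carleson_inequality \<mu> \<Omega> r j p C \<longleftrightarrow>
    (\<forall>f. holomorphic_Cn_on f \<Omega> \<longrightarrow> (\<integral>\<^sup>+z. ennreal (cmod (f z) powr p) \<partial>bergman_measure \<Omega> r j) < \<infinity> \<longrightarrow>
      (\<integral>\<^sup>+z. ennreal (cmod (f z) powr p) \<partial>\<mu>)
        \<le> ennreal (C powr p) * (\<integral>\<^sup>+z. ennreal (cmod (f z) powr p) \<partial>bergman_measure \<Omega> r j))"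
proof -
  have "ennreal (C powr p * bergman_norm \<Omega> r j p f powr p)
      = ennreal (C powr p) * (\<integral>\<^sup>+z. ennreal (cmod (f z) powr p) \<partial>bergman_measure \<Omega> r j)"
    if "(\<integral>\<^sup>+z. ennreal (cmod (f z) powr p) \<partial>bergman_measure \<Omega> r j) < \<infinity>" for f
    using that assms by (simp add: bergman_norm_def powr_powr ennreal_mult less_top)
  then show ?thesis
    unfolding carleson_inequality_def bergman_space_def by auto
qed

context weighted_convex_domain
begin

text \<open>The inequality is tested on the peak product of a frame at \<open>a\<close>. Its
  weighted integral is at most \<open>D * weighted_vol j a\<close>, while its power \<open>p\<close>
  is at least \<open>l\<close> on \<open>\<Omega> \<inter> circled_nbhd a K\<close>. Neither
  constant depends on \<open>a\<close>.\<close>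

lemma carleson_necessary:
  assumes \<mu>: "sets \<mu> = sets (restrict_space borel \<Omega>)" and p: "1 < p" and C: "0 \<le> C"
    and carleson: "\<And>f. holomorphic_Cn_on f \<Omega> \<Longrightarrow> (\<integral>\<^sup>+z. ennreal (cmod (f z) powr p) \<partial>wmeasure) < \<infinity> \<Longrightarrow>
      (\<integral>\<^sup>+z. ennreal (cmod (f z) powr p) \<partial>\<mu>) \<le> ennreal C * (\<integral>\<^sup>+z. ennreal (cmod (f z) powr p) \<partial>wmeasure)"
    and K: "1 \<le> K" and frame: "\<And>a. a \<in> \<Omega> \<Longrightarrow> \<exists>Q. support_frame K a Q"
  shows "\<exists>C'\<ge>0. \<forall>a\<in>\<Omega>. emeasure \<mu> (\<Omega> \<inter> circled_nbhd a K) \<le> ennreal (C' * weighted_vol j a)"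
proof -
  define N where "N = Suc (j + DIM(complex ^ 'n))"
  define D where "D = (6 ^ N) powr p * c2 * (2 * K) ^ (j + DIM(complex ^ 'n)) * 2"
  define l where "l = ((1 / (2 + K)) ^ (N * CARD('n))) powr p"
  have D: "0 \<le> D" using c2_pos K by (simp add: D_def)
  have l: "0 < l" using K by (simp add: l_def)
  show ?thesis
  proof (intro exI[of _ "C * D / l"] conjI ballI)
    show "0 \<le> C * D / l" using C D l by simp
    fix a assume a: "a \<in> \<Omega>"
    obtain Q where "support_frame K a Q" using frame[OF a] by blast
    then have Q: "finite Q" "card Q \<le> CARD('n)" "\<And>q z. q \<in> Q \<Longrightarrow> z \<in> \<Omega> \<Longrightarrow> Re (herm (z - a) q) \<le> 1"
      "\<And>v R. 0 < R \<Longrightarrow> \<forall>q\<in>Q. cmod (herm v q) \<le> R \<Longrightarrow> a + v \<in> circled_nbhd a (K * R)"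
      unfolding support_frame_def by blast+
    note peak = peak_product_estimates[OF a Q K p N_def]
    define f where "f = peak_product Q N a"
    define S where "S = \<Omega> \<inter> circled_nbhd a K"
    have S: "S \<in> sets \<mu>"
      unfolding \<mu> sets_restrict_space S_def using open_circled_nbhd[of K a] K by auto
    have int: "(\<integral>\<^sup>+z. ennreal (cmod (f z) powr p) \<partial>wmeasure) \<le> ennreal (D * weighted_vol j a)"
      unfolding f_def D_def by (rule peak(3))
    have "ennreal l * emeasure \<mu> S = (\<integral>\<^sup>+z. ennreal l * indicator S z \<partial>\<mu>)"
      by (rule nn_integral_cmult_indicator[OF S, symmetric])
    also have "\<dots> \<le> (\<integral>\<^sup>+z. ennreal (cmod (f z) powr p) \<partial>\<mu>)"
    proof (rule nn_integral_mono)
      fix z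
      have "l \<le> cmod (f z) powr p" if "z \<in> S"
        unfolding l_def f_def using that K p by (intro powr_mono2 peak(2)) (auto simp: S_def)
      then show "ennreal l * indicator S z \<le> ennreal (cmod (f z) powr p)"
        by (auto simp: indicator_def intro!: ennreal_leI)
    qed
    also have "\<dots> \<le> ennreal C * (\<integral>\<^sup>+z. ennreal (cmod (f z) powr p) \<partial>wmeasure)"
    proof (rule carleson[of f])
      show "holomorphic_Cn_on f \<Omega>" unfolding f_def by (rule peak(1))
      show "(\<integral>\<^sup>+z. ennreal (cmod (f z) powr p) \<partial>wmeasure) < \<infinity>"
        using int by (rule order.strict_trans1) simp
    qed
    also have "\<dots> \<le> ennreal C * ennreal (D * weighted_vol j a)" by (rule mult_left_mono[OF int]) simp
    also have "\<dots> = ennreal (C * D * weighted_vol j a)" using C by (simp add: ennreal_mult'[symmetric] mult.assoc)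
    finally have "ennreal (1 / l) * (ennreal l * emeasure \<mu> S) \<le> ennreal (1 / l) * ennreal (C * D * weighted_vol j a)"
      by (rule mult_left_mono) simp
    moreover have "ennreal (1 / l) * ennreal l = 1" using l by (subst ennreal_mult'[symmetric]) auto
    ultimately show "emeasure \<mu> (\<Omega> \<inter> circled_nbhd a K) \<le> ennreal (C * D / l * weighted_vol j a)"
      using l by (simp add: mult.assoc[symmetric] ennreal_mult'[symmetric] S_def)
  qed
qed

text \<open>A transfer: \<mu> lives on the Borel sets of \<Omega>, whereas
  \<open>carleson_embedding\<close> speaks of Borel measures on the whole space, so \<mu> is pushed
  forward along the inclusion.\<close>

lemma carleson_sufficient:
  assumes \<mu>: "sets \<mu> = sets (restrict_space borel \<Omega>)" and c: "0 < c" "c \<le> 1/2" and C: "0 \<le> C"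
    and bound: "\<And>a. a \<in> \<Omega> \<Longrightarrow> emeasure \<mu> (circled_nbhd a c) \<le> ennreal (C * weighted_vol j a)" and q: "1 < q"
  shows "\<exists>K\<ge>0. \<forall>f. holomorphic_Cn_on f \<Omega> \<longrightarrow>
    (\<integral>\<^sup>+z. ennreal (cmod (f z) powr q) \<partial>\<mu>) \<le> ennreal K * (\<integral>\<^sup>+z. ennreal (cmod (f z) powr q) \<partial>wmeasure)"
proof -
  have sp: "space \<mu> = \<Omega>" using sets_eq_imp_space_eq[OF \<mu>] by (simp add: space_restrict_space)
  have id: "(\<lambda>x. x) \<in> measurable \<mu> borel"
    unfolding measurable_cong_sets[OF \<mu> refl] by (rule measurable_restrict_space1) simp
  define \<nu> where "\<nu> = distr \<mu> borel (\<lambda>x. x)"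
  have em: "emeasure \<nu> A = emeasure \<mu> (A \<inter> \<Omega>)" if "A \<in> sets borel" for A
    unfolding \<nu>_def using emeasure_distr[OF id that] by (simp add: sp)
  have "\<exists>K\<ge>0. \<forall>f. holomorphic_Cn_on f \<Omega> \<longrightarrow>
    (\<integral>\<^sup>+z. indicator \<Omega> z * ennreal (cmod (f z) powr q) \<partial>\<nu>) \<le> ennreal K * (\<integral>\<^sup>+z. ennreal (cmod (f z) powr q) \<partial>wmeasure)"
  proof (rule carleson_embedding[OF _ _ c C _ q])
    show "sets \<nu> = sets borel" by (simp add: \<nu>_def)
    show "emeasure \<nu> (- \<Omega>) = 0" using dom_borel by (subst em) auto
    fix a assume a: "a \<in> \<Omega>"
    have "circled_nbhd a c \<inter> \<Omega> = circled_nbhd a c" using circled_nbhd_subset_dom[of c a] c by auto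
    then show "emeasure \<nu> (circled_nbhd a c) \<le> ennreal (C * weighted_vol j a)"
      using bound[OF a] c by (subst em) (auto simp: open_circled_nbhd)
  qed
  moreover have "(\<integral>\<^sup>+z. indicator \<Omega> z * ennreal (cmod (f z) powr q) \<partial>\<nu>) = (\<integral>\<^sup>+z. ennreal (cmod (f z) powr q) \<partial>\<mu>)"
    if f: "holomorphic_Cn_on f \<Omega>" for f
  proof -
    have "(\<lambda>z. indicator \<Omega> z * ennreal (cmod (indicator \<Omega> z *\<^sub>R f z) powr q)) \<in> borel_measurable borel"
      using borel_measurable_holomorphic_Cn[OF f] by measurable
    also have "(\<lambda>z. indicator \<Omega> z * ennreal (cmod (indicator \<Omega> z *\<^sub>R f z) powr q))
        = (\<lambda>z. indicator \<Omega> z * ennreal (cmod (f z) powr q))"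
      by (auto simp: indicator_def)
    finally have "(\<integral>\<^sup>+z. indicator \<Omega> z * ennreal (cmod (f z) powr q) \<partial>\<nu>)
        = (\<integral>\<^sup>+z. indicator \<Omega> z * ennreal (cmod (f z) powr q) \<partial>\<mu>)"
      unfolding \<nu>_def by (subst nn_integral_distr[OF id]) simp_all
    also have "\<dots> = (\<integral>\<^sup>+z. ennreal (cmod (f z) powr q) \<partial>\<mu>)"
      by (intro nn_integral_cong) (simp add: sp)
    finally show ?thesis .
  qed
  ultimately show ?thesis by simp
qed

text \<open>The sandwich in both directions. Monotonicity changes the set measured by \<mu>, and the
  weighted measure of \<open>\<Omega> \<inter> P a\<close> is comparable to
  \<open>weighted_vol j a\<close>: from below through the neighbourhood with \<open>c\<close>, from
  above through the one with \<open>K\<close>.\<close>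

lemma measure_condition_circled_nbhd:
  assumes \<mu>: "sets \<mu> = sets (restrict_space borel \<Omega>)" and c: "0 < c" "c \<le> 1/2" and K: "1 \<le> K"
    and P: "\<And>a. a \<in> \<Omega> \<Longrightarrow> open (P a)" "\<And>a. a \<in> \<Omega> \<Longrightarrow> circled_nbhd a c \<subseteq> P a"
      "\<And>a. a \<in> \<Omega> \<Longrightarrow> \<Omega> \<inter> P a \<subseteq> circled_nbhd a K"
  shows "\<exists>C\<ge>0. \<forall>a\<in>\<Omega>. emeasure \<mu> (\<Omega> \<inter> circled_nbhd a K) \<le> ennreal (C * weighted_vol j a) \<Longrightarrow>
      \<exists>C>0. \<forall>a\<in>\<Omega>. emeasure \<mu> (\<Omega> \<inter> P a) \<le> ennreal C * emeasure wmeasure (\<Omega> \<inter> P a)"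
    and "\<exists>C>0. \<forall>a\<in>\<Omega>. emeasure \<mu> (\<Omega> \<inter> P a) \<le> ennreal C * emeasure wmeasure (\<Omega> \<inter> P a) \<Longrightarrow>
      \<exists>C\<ge>0. \<forall>a\<in>\<Omega>. emeasure \<mu> (circled_nbhd a c) \<le> ennreal (C * weighted_vol j a)"
proof -
  have OP: "\<Omega> \<inter> P a \<in> sets borel" "\<Omega> \<inter> P a \<in> sets \<mu>" "\<Omega> \<inter> P a \<in> sets wmeasure" if "a \<in> \<Omega>" for a
    using P(1)[OF that] by (auto simp: \<mu> sets_wmeasure sets_restrict_space)
  have sub: "circled_nbhd a c \<subseteq> \<Omega> \<inter> P a" if "a \<in> \<Omega>" for a
    using P(2)[OF that] circled_nbhd_subset_dom[of c a] c by auto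
  {
    assume "\<exists>C\<ge>0. \<forall>a\<in>\<Omega>. emeasure \<mu> (\<Omega> \<inter> circled_nbhd a K) \<le> ennreal (C * weighted_vol j a)"
    then obtain C where C: "0 \<le> C" "\<And>a. a \<in> \<Omega> \<Longrightarrow> emeasure \<mu> (\<Omega> \<inter> circled_nbhd a K) \<le> ennreal (C * weighted_vol j a)"
      by blast
    define b where "b = c1 * (1/2) ^ j * c ^ DIM(complex ^ 'n)"
    have b: "0 < b" using c1_pos c by (simp add: b_def)
    show "\<exists>C>0. \<forall>a\<in>\<Omega>. emeasure \<mu> (\<Omega> \<inter> P a) \<le> ennreal C * emeasure wmeasure (\<Omega> \<inter> P a)"
    \<comment> \<open>The summand 1 keeps the constant positive when \<open>C = 0\<close>.\<close>
    proof (intro exI[of _ "C / b + 1"] conjI ballI)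
      show "0 < C / b + 1" using C b by (simp add: add_nonneg_pos)
      fix a assume a: "a \<in> \<Omega>"
      note w = weighted_vol_pos[OF a, of j]
      have "emeasure \<mu> (\<Omega> \<inter> P a) \<le> emeasure \<mu> (\<Omega> \<inter> circled_nbhd a K)"
        using P(3)[OF a] open_circled_nbhd[of K a] K by (intro emeasure_mono) (auto simp: \<mu> sets_restrict_space)
      also have "\<dots> \<le> ennreal (C * weighted_vol j a)" by (rule C(2)[OF a])
      also have "\<dots> \<le> ennreal ((C / b + 1) * (b * weighted_vol j a))"
        using b w by (intro ennreal_leI) (simp add: field_simps)
      also have "\<dots> = ennreal (C / b + 1) * ennreal (b * weighted_vol j a)"
        using C(1) b by (intro ennreal_mult') simp
      also have "ennreal (b * weighted_vol j a) \<le> emeasure wmeasure (circled_nbhd a c)"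
        unfolding b_def by (rule emeasure_wmeasure_lower[OF c])
      also have "\<dots> \<le> emeasure wmeasure (\<Omega> \<inter> P a)" by (rule emeasure_mono[OF sub[OF a] OP(3)[OF a]])
      finally show "emeasure \<mu> (\<Omega> \<inter> P a) \<le> ennreal (C / b + 1) * emeasure wmeasure (\<Omega> \<inter> P a)"
        by (simp add: mult_left_mono)
    qed
  next
    assume "\<exists>C>0. \<forall>a\<in>\<Omega>. emeasure \<mu> (\<Omega> \<inter> P a) \<le> ennreal C * emeasure wmeasure (\<Omega> \<inter> P a)"
    then obtain C where C: "0 < C" "\<And>a. a \<in> \<Omega> \<Longrightarrow> emeasure \<mu> (\<Omega> \<inter> P a) \<le> ennreal C * emeasure wmeasure (\<Omega> \<inter> P a)"
      by blast
    define b where "b = c2 * (1 + K) ^ j * K ^ DIM(complex ^ 'n)"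
    have b: "0 < b" using c2_pos K by (simp add: b_def)
    show "\<exists>C\<ge>0. \<forall>a\<in>\<Omega>. emeasure \<mu> (circled_nbhd a c) \<le> ennreal (C * weighted_vol j a)"
    proof (intro exI[of _ "C * b"] conjI ballI)
      show "0 \<le> C * b" using C b by simp
      fix a assume a: "a \<in> \<Omega>"
      have "emeasure \<mu> (circled_nbhd a c) \<le> emeasure \<mu> (\<Omega> \<inter> P a)" by (rule emeasure_mono[OF sub[OF a] OP(2)[OF a]])
      also have "\<dots> \<le> ennreal C * emeasure wmeasure (\<Omega> \<inter> P a)" by (rule C(2)[OF a])
      also have "\<dots> \<le> ennreal C * ennreal (b * weighted_vol j a)"
        unfolding b_def using K by (intro mult_left_mono emeasure_wmeasure_upper OP(1) P(3) a) auto
      also have "\<dots> = ennreal (C * b * weighted_vol j a)" using C by (simp add: ennreal_mult'[symmetric] mult.assoc)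
      finally show "emeasure \<mu> (circled_nbhd a c) \<le> ennreal (C * b * weighted_vol j a)" .
    qed
  }
qed

end

text \<open>The comparison of \<open>- r\<close> with \<open>bdist\<close> on the closure is raised
  to the power \<open>j\<close>. The normalising constant, 1 for \<open>j = 0\<close>, is absorbed
  into both bounds.\<close>

lemma weighted_convex_domain_bergman_measure:
  assumes \<Omega>: "convex_finite_type_domain \<Omega> r"
  obtains W c1 c2 where "weighted_convex_domain \<Omega> W j c1 c2"
    "weighted_convex_domain.wmeasure \<Omega> W = bergman_measure \<Omega> r j"
proof -
  define \<kappa> where "\<kappa> = (if j = 0 then 1 else real (j + 1) * unit_ball_vol (real (2 * (j + 1))))"
  define W where "W z = \<kappa> * (- r z) ^ j" for z
  obtain c C where cC: "0 < c" "0 < C" "\<And>z. z \<in> closure \<Omega> \<Longrightarrow> c * bdist \<Omega> z \<le> - r z \<and> - r z \<le> C * bdist \<Omega> z"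
    using \<Omega> by (auto simp: convex_finite_type_domain_def)
  have \<kappa>: "0 < \<kappa>" by (simp add: \<kappa>_def)
  have bd: "0 \<le> bdist \<Omega> z" for z by (simp add: bdist_def infdist_nonneg)
  have W: "\<kappa> * c ^ j * bdist \<Omega> z ^ j \<le> W z \<and> W z \<le> \<kappa> * C ^ j * bdist \<Omega> z ^ j" if "z \<in> \<Omega>" for z
  proof -
    have z: "c * bdist \<Omega> z \<le> - r z" "- r z \<le> C * bdist \<Omega> z" using cC(3) closure_subset that by blast+
    have "0 \<le> c * bdist \<Omega> z" using cC(1) bd by simp
    then have "(c * bdist \<Omega> z) ^ j \<le> (- r z) ^ j" "(- r z) ^ j \<le> (C * bdist \<Omega> z) ^ j"
      using z by (intro power_mono; simp)+
    then show ?thesis unfolding W_def mult.assoc power_mult_distrib[symmetric] using \<kappa> by (auto intro!: mult_left_mono)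
  qed
  have "continuous_on UNIV r"
    using \<Omega> unfolding convex_finite_type_domain_def smooth_on_def by (metis Ck_on.simps(1))
  then have "continuous_on UNIV W" unfolding W_def by (intro continuous_intros)
  then have "W \<in> borel_measurable borel" by (rule borel_measurable_continuous_onI)
  then have "weighted_convex_domain \<Omega> W j (\<kappa> * c ^ j) (\<kappa> * C ^ j)"
    using \<Omega> W cC(1,2) \<kappa> by unfold_locales (auto simp: convex_finite_type_domain_def)
  moreover from this have "weighted_convex_domain.wmeasure \<Omega> W = bergman_measure \<Omega> r j"
    by (simp add: weighted_convex_domain.wmeasure_def bergman_measure_def W_def[abs_def] \<kappa>_def if_distrib cong: if_cong)
  ultimately show ?thesis by (rule that)
qed

theorem theorem1p4:
  fixes \<Omega> U :: "(complex ^ 'n) set"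
    and r :: "complex ^ 'n \<Rightarrow> real"
    and L :: "complex ^ 'n \<Rightarrow> nat \<Rightarrow> complex ^ 'n"
    and i1 :: 'n
    and \<mu> :: "(complex ^ 'n) measure"
    and k :: nat
  assumes "convex_finite_type_domain \<Omega> r"
    and "projection_nbhd \<Omega> U"
    and "\<And>a. a \<in> U \<Longrightarrow> mcneal_basis \<Omega> r a (L a)"
    and "k \<ge> 1"
    and "sets \<mu> = sets (restrict_space borel \<Omega>)"
  shows "((\<exists>p>1. \<exists>Cp>0. carleson_inequality \<mu> \<Omega> r (k - 1) p Cp) \<longleftrightarrow>
          (\<exists>C>0. \<forall>a\<in>\<Omega>. emeasure \<mu> (\<Omega> \<inter> mcneal_polydisc \<Omega> U L i1 a 2)
              \<le> ennreal C * emeasure (bergman_measure \<Omega> r (k - 1)) (\<Omega> \<inter> mcneal_polydisc \<Omega> U L i1 a 2))) \<and>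
         (\<forall>p>1. (\<exists>Cp>0. carleson_inequality \<mu> \<Omega> r (k - 1) p Cp) \<longrightarrow>
            (\<forall>q>1. \<exists>Cq>0. carleson_inequality \<mu> \<Omega> r (k - 1) q Cq))"
proof -
  define j where "j = k - 1"
  define P where "P a = mcneal_polydisc \<Omega> U L i1 a 2" for a
  obtain W c1 c2 where "weighted_convex_domain \<Omega> W j c1 c2"
    and wm: "weighted_convex_domain.wmeasure \<Omega> W = bergman_measure \<Omega> r j"
    using weighted_convex_domain_bergman_measure[OF assms(1)] by blast
  then interpret weighted_convex_domain \<Omega> W j c1 c2 by blast
  have \<Omega>: "\<Omega> = {z. r z < 0}" using assms(1) by (simp add: convex_finite_type_domain_def)
  have "Ck_on (Suc 0) UNIV r" using assms(1) by (simp add: convex_finite_type_domain_def smooth_on_def del: Ck_on.simps)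
  then have diff: "r differentiable (at w)" for w by simp
  obtain c K where c: "0 < c" "c \<le> 1/2" and K: "1 \<le> K"
    and P: "\<And>a. a \<in> \<Omega> \<Longrightarrow> open (P a)" "\<And>a. a \<in> \<Omega> \<Longrightarrow> circled_nbhd a c \<subseteq> P a"
      "\<And>a. a \<in> \<Omega> \<Longrightarrow> \<Omega> \<inter> P a \<subseteq> circled_nbhd a K"
    and frame: "\<And>a. a \<in> \<Omega> \<Longrightarrow> \<exists>Q. support_frame K a Q"
    using mcneal_polydisc_comparable[OF \<Omega> diff assms(2,3), of i1] unfolding P_def[symmetric] by metis
  \<comment> \<open>The measure condition, which contains no exponent. Necessity from any
    \<open>p\<close> followed by sufficiency for any \<open>q\<close> gives the change of
    exponent.\<close>
  let ?doubling = "\<exists>C>0. \<forall>a\<in>\<Omega>. emeasure \<mu> (\<Omega> \<inter> P a) \<le> ennreal C * emeasure wmeasure (\<Omega> \<inter> P a)"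
  have nec: ?doubling if p: "1 < p" and C: "carleson_inequality \<mu> \<Omega> r j p C" for p C
  proof -
    have "(\<integral>\<^sup>+z. ennreal (cmod (f z) powr p) \<partial>\<mu>) \<le> ennreal (C powr p) * (\<integral>\<^sup>+z. ennreal (cmod (f z) powr p) \<partial>wmeasure)"
      if "holomorphic_Cn_on f \<Omega>" "(\<integral>\<^sup>+z. ennreal (cmod (f z) powr p) \<partial>wmeasure) < \<infinity>" for f
      using C that p unfolding wm by (subst (asm) carleson_inequality_iff) auto
    then have "\<exists>C\<ge>0. \<forall>a\<in>\<Omega>. emeasure \<mu> (\<Omega> \<inter> circled_nbhd a K) \<le> ennreal (C * weighted_vol j a)"
      by (rule carleson_necessary[OF assms(5) p powr_ge_zero _ K frame])
    then show ?thesis by (rule measure_condition_circled_nbhd(1)[OF assms(5) c K P, rotated -1])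
  qed
  have suf: "\<exists>Cq>0. carleson_inequality \<mu> \<Omega> r j q Cq" if D: ?doubling and q: "1 < q" for q
  proof -
    obtain C where C: "0 \<le> C" "\<And>a. a \<in> \<Omega> \<Longrightarrow> emeasure \<mu> (circled_nbhd a c) \<le> ennreal (C * weighted_vol j a)"
      using measure_condition_circled_nbhd(2)[where P = P, OF assms(5) c K, rotated -1, OF D] P by blast
    obtain M where M: "0 \<le> M" "\<And>f. holomorphic_Cn_on f \<Omega> \<Longrightarrow>
      (\<integral>\<^sup>+z. ennreal (cmod (f z) powr q) \<partial>\<mu>) \<le> ennreal M * (\<integral>\<^sup>+z. ennreal (cmod (f z) powr q) \<partial>wmeasure)"
      using carleson_sufficient[OF assms(5) c C q] by blast
    \<comment> \<open>The constant enters the inequality through its power \<open>q\<close>;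
      \<open>M + 1\<close> instead of \<open>M\<close> makes it positive.\<close>
    have "carleson_inequality \<mu> \<Omega> r j q ((M + 1) powr (1 / q))"
    proof (subst carleson_inequality_iff, use q in simp, intro allI impI)
      fix f assume f: "holomorphic_Cn_on f \<Omega>"
      have "((M + 1) powr (1 / q)) powr q = M + 1" using q M(1) by (simp add: powr_powr)
      then have "ennreal M \<le> ennreal (((M + 1) powr (1 / q)) powr q)" by (simp add: ennreal_leI)
      from order_trans[OF M(2)[OF f] mult_right_mono[OF this]]
      show "(\<integral>\<^sup>+z. ennreal (cmod (f z) powr q) \<partial>\<mu>)
          \<le> ennreal (((M + 1) powr (1 / q)) powr q) * (\<integral>\<^sup>+z. ennreal (cmod (f z) powr q) \<partial>bergman_measure \<Omega> r j)"
        unfolding wm by simp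
    qed
    then show ?thesis using M(1) by (intro exI[of _ "(M + 1) powr (1 / q)"]) auto
  qed
  \<comment> \<open>For the existence of an exponent, 2 is taken as the witness.\<close>
  show ?thesis
    unfolding j_def[symmetric] P_def[symmetric] wm[symmetric]
    by (intro conjI iffI allI impI; (elim exE conjE)?) (use nec suf suf[of 2] in \<open>force intro: exI[of _ 2]\<close>)+
qed

end
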